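(* Let $p>0$, $\alpha\in(-\infty,2)$, $\lambda>0$, $b\in\mathbb R^d$, and let $R\neq 0$ be a finite Borel measure on $\mathbb R^d$ that is an admissible Rosiński measure for $\alpha$ (see context). Let $Y=\{Y_t:t\ge0\}$ be an OUTS process on $\mathbb R^d$ with parameter $\lambda$ and BDLP distribution $\mathrm{TS}^p_\alpha(\lambda R,\lambda b)$. If $\alpha\in(0,2)$ set $\gamma=1+\lfloor\alpha/p\rfloor$, otherwise set $\gamma=1$. If $t>0$, then for every $s\ge 0$, given $Y_s=y$, we have $$ Y_{s+t} \stackrel{d}{=} e^{-\lambda t} y + (1-e^{-\lambda t})b - \sum_{n=0}^{\gamma-1}b^*_n + e^{-\lambda t} \sum_{n=0}^{\gamma-1}X_n + \sum_{n=1}^{N} V_n W_n, $$ where $b_0^*,\dots,b_{\gamma-1}^*\in\mathbb R^d$ are constants and $N, X_0, X_1,\dots,X_{\gamma-1}$, $V_1, V_2, \dots$, $W_1, W_2, \dots$ are independent random variables with: 1. $X_0\sim \mathrm{TS}^p_\alpha(R^*_0,0)$ with $R^*_0(dx) = \frac{e^{\alpha\lambda t}-1}{\alpha}R(dx)$, where for $\alpha=0$ the factor $\frac{e^{\alpha\lambda t}-1}{\alpha}$ is interpreted as its limiting value $\lambda t$; 2. if $\gamma\ge2$, then $X_n \sim \mathrm{TS}^p_{\alpha-np}(R^*_n,0)$ with $R^*_n(dx) = \kappa_{\lambda,t,n}R(dx)$ and $\kappa_{\lambda,t,n} =\int^1_{e^{-\lambda t}}\frac{(1-u^p)^n}{n!}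 u^{-1-\alpha}\, du$, for $n=1,2,\dots,\gamma-1$; 3. $V_1, V_2, \dots$ are i.i.d. with distribution $R^1$, where $R^1(dx)=R(dx)/R(\mathbb R^{d})$; 4. $W_1, W_2, \dots$ are i.i.d. with distribution $\mathrm{IBGM}(\alpha,\gamma,p,e^{\lambda t})$; 5. $N$ has a Poisson distribution with mean $\frac{p\,C_{\alpha,\gamma,p,e^{\lambda t}}\, R(\mathbb R^d)}{(\gamma-1)!}$; 6. $$ b^*_0 = \begin{cases} \frac{p\,C_{\alpha,\gamma,p,e^{\lambda t}}\, R(\mathbb R^d)}{(\gamma-1)!}\, \mathrm E[V_1]\,\mathrm E[W_1], & \alpha\in[1,2),\\ 0, & \alpha<1,\end{cases} $$ and if $\gamma\ge2$ then for $n=1,2,\dots,\gamma-1$ $$ b^*_n = \begin{cases} e^{-\lambda t}\, p^{-1}\Gamma\!\left(\frac{1-\alpha+np}{p}\right)\int_{\mathbb R^{d}}x\, R^*_n(dx), & 1\le \alpha<1+ np,\\ 0, & \text{otherwise}.\end{cases} $$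
   Context: **$p$-tempered $\alpha$-stable distributions.** Fix $\alpha\in(-\infty,2)$ and $p>0$. A finite Borel measure $R$ on $\mathbb R^d$ is an admissible Rosiński measure for $\alpha$ if $R(\{0\})=0$ and: $\int_{|x|>2}|x|^\alpha R(dx)<\infty$ if $\alpha\in(0,2)\setminus\{1\}$; $\int_{|x|>2}|x|\log|x| R(dx)<\infty$ if $\alpha=1$; $\int_{|x|>2}\log|x| R(dx)<\infty$ if $\alpha=0$; no additional assumption if $\alpha<0$. For such $R$ and $b\in\mathbb R^d$, $\mathrm{TS}^p_\alpha(R,b)$ is the (infinitely divisible) distribution on $\mathbb R^d$ with characteristic function $z\mapsto e^{c(z)}$, where $$ c(z) = i\langle b,z\rangle + \int_{\mathbb R^d}\int_0^\infty \left(e^{iu\langle x,z\rangle}-1-iu\langle x,z\rangle 1_{[\alpha\ge1]}\right) u^{-1-\alpha}e^{-u^p}\, du\, R(dx). $$ **OU and OUTS processes.** Given a Lévy process $L=\{L_t:t\ge0\}$ on $\mathbb R^d$ and $\lambda>0$, the OU process with parameter $\lambda$ and background driving Lévy process (BDLP) $L$ is the strong solution of $dY_t=-\lambda Y_t\,dt+dL_t$ with initial value $Y_0$ (independent of $L$), i.e. $Y_t=Y_0e^{-\lambda t}+\int_0^t e^{-\lambda(t-s)}dL_s$. It is a Markov process. The distribution of $L_1$ is called the BDLP distribution. If it is a $\mathrm{TS}^p_\alpha$ distribution, $Y$ is called an OUTS process. "Given $Y_s=y$, $Y_{s+t}\stackrel{d}{=}\cdots$" describes the transition law, i.e. the conditional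 distribution of $Y_{s+t}$ given $Y_s=y$. **IBGM distribution.** For $p>0$, $\gamma>0$, $\beta\in(-\infty,p\gamma)$, $\eta>1$, $\mathrm{IBGM}(\beta,\gamma,p,\eta)$ is the distribution on $(0,\infty)$ with probability density function $$ f^\sharp_{\beta,\gamma,p,\eta}(v) = \frac{1}{C_{\beta,\gamma,p,\eta}} v^{p\gamma-\beta-1} \int_1^{\eta} \theta^{p\gamma-\beta-1} e^{-v^p\theta^p} \int_{1/\theta}^1 (1-u^p)^{\gamma-1} u^{-1-\beta}\, du\, d\theta,\quad v>0, $$ where $C_{\beta,\gamma,p,\eta}$ is the normalizing constant, given by $$C_{\beta,\gamma,p,\eta}=p^{-1}\Gamma(\gamma-\beta/p)\int_1^\eta \theta^{-1}\int_{1/\theta}^1(1-u^p)^{\gamma-1}u^{-1-\beta}\,du\,d\theta.$$ An empty sum $\sum_{n=1}^0$ is $0$. *)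

theory Defs
  imports "HOL-Probability.Probability"
begin

section \<open>Tempered stable distributions\<close>

definition rosinski_measure :: "real \<Rightarrow> 'a::euclidean_space measure \<Rightarrow> bool" where
  "rosinski_measure \<alpha> R \<longleftrightarrow>
     sets R = sets borel \<and> finite_measure R \<and> emeasure R {0} = 0 \<and>
     (0 < \<alpha> \<and> \<alpha> < 2 \<and> \<alpha> \<noteq> 1 \<longrightarrow> set_integrable R {x. norm x > 2} (\<lambda>x. norm x powr \<alpha>)) \<and>
     (\<alpha> = 1 \<longrightarrow> set_integrable R {x. norm x > 2} (\<lambda>x. norm x * ln (norm x))) \<and>
     (\<alpha> = 0 \<longrightarrow> set_integrable R {x. norm x > 2} (\<lambda>x. ln (norm x)))"

definition charfun :: "'a::euclidean_space measure \<Rightarrow> 'a \<Rightarrow> complex" where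
  "charfun \<mu> z = (CLINT x|\<mu>. iexp (x \<bullet> z))"

definition TS_exponent ::
  "real \<Rightarrow> real \<Rightarrow> 'a::euclidean_space measure \<Rightarrow> 'a \<Rightarrow> 'a \<Rightarrow> complex" where
  "TS_exponent p \<alpha> R b z =
     \<i> * complex_of_real (b \<bullet> z) +
     (CLINT x|R. CLBINT u:{0<..}.
        (iexp (u * (x \<bullet> z)) - 1 - (if \<alpha> \<ge> 1 then \<i> * complex_of_real (u * (x \<bullet> z)) else 0)) *
        complex_of_real (u powr (- 1 - \<alpha>) * exp (- (u powr p))))"

text \<open>\<open>TS_distr p \<alpha> R b \<mu>\<close> says that \<open>\<mu>\<close> is the distribution written TS with upper index \<open>p\<close>
  and lower index \<open>\<alpha>\<close>.  It is a predicate on \<open>\<mu>\<close>, so that no existence or uniqueness result has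
  to precede the definition.  Admissibility of \<open>R\<close> is included because the Bochner integrals in
  the exponent take a default value outside that case.\<close>

definition TS_distr ::
  "real \<Rightarrow> real \<Rightarrow> 'a::euclidean_space measure \<Rightarrow> 'a \<Rightarrow> 'a measure \<Rightarrow> bool" where
  "TS_distr p \<alpha> R b \<mu> \<longleftrightarrow>
     rosinski_measure \<alpha> R \<and> prob_space \<mu> \<and> sets \<mu> = sets borel \<and>
     (\<forall>z. charfun \<mu> z = exp (TS_exponent p \<alpha> R b z))"


section \<open>Levy processes and Ornstein-Uhlenbeck processes\<close>

definition cadlag :: "(real \<Rightarrow> 'a::topological_space) \<Rightarrow> bool" where
  "cadlag f \<longleftrightarrow>
     (\<forall>t\<ge>0. continuous (at_right t) f) \<and> (\<forall>t>0. \<exists>l. (f \<longlongrightarrow> l) (at_left t))"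

text \<open>Processes are functions on \<^typ>\<open>real\<close> of which only the values at nonnegative times matter.
  Stochastic continuity of a Levy process follows from stationarity of the increments and right
  continuity at \<open>0\<close>.\<close>

definition levy_process ::
  "'w measure \<Rightarrow> (real \<Rightarrow> 'w \<Rightarrow> 'a::euclidean_space) \<Rightarrow> bool" where
  "levy_process M L \<longleftrightarrow>
     prob_space M \<and>
     (\<forall>t\<ge>0. L t \<in> borel_measurable M) \<and>
     (AE \<omega> in M. L 0 \<omega> = 0) \<and>
     (\<forall>(\<tau>::nat \<Rightarrow> real) n. 0 \<le> \<tau> 0 \<and> mono \<tau> \<longrightarrow>
        prob_space.indep_vars M (\<lambda>_. borel) (\<lambda>i \<omega>. L (\<tau> (Suc i)) \<omega> - L (\<tau> i) \<omega>) {..<n}) \<and>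
     (\<forall>s\<ge>0. \<forall>h\<ge>0. distr M borel (\<lambda>\<omega>. L (s + h) \<omega> - L s \<omega>) = distr M borel (L h)) \<and>
     (AE \<omega> in M. cadlag (\<lambda>t. L t \<omega>))"

text \<open>Since the noise is additive, the equation \<open>dY = - l Y dt + dL\<close> is the pathwise integral
  equation below.  Its solution is pathwise unique and is a functional of the initial value and
  of \<open>L\<close>; adaptedness and cadlag paths of \<open>Y\<close> are therefore automatic.\<close>

definition OU_process ::
  "'w measure \<Rightarrow> real \<Rightarrow> (real \<Rightarrow> 'w \<Rightarrow> 'a::euclidean_space) \<Rightarrow> (real \<Rightarrow> 'w \<Rightarrow> 'a) \<Rightarrow> bool" where
  "OU_process M l L Y \<longleftrightarrow>
     levy_process M L \<and> l > 0 \<and>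
     (\<forall>t\<ge>0. Y t \<in> borel_measurable M) \<and>
     prob_space.indep_set M
       (sets (vimage_algebra (space M) (Y 0) borel))
       (sets (vimage_algebra (space M) (\<lambda>\<omega>. \<lambda>t\<in>{0..}. L t \<omega>) (PiM {0..} (\<lambda>_. borel)))) \<and>
     (AE \<omega> in M. \<forall>t\<ge>0.
        set_integrable lborel {0..t} (\<lambda>s. Y s \<omega>) \<and>
        Y t \<omega> = Y 0 \<omega> - l *\<^sub>R (LBINT s:{0..t}. Y s \<omega>) + L t \<omega>)"

definition OUTS_process ::
  "'w measure \<Rightarrow> real \<Rightarrow> real \<Rightarrow> real \<Rightarrow> 'a::euclidean_space measure \<Rightarrow> 'a \<Rightarrow>
    (real \<Rightarrow> 'w \<Rightarrow> 'a) \<Rightarrow> bool" where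
  "OUTS_process M l p \<alpha> R b Y \<longleftrightarrow>
     (\<exists>L. OU_process M l L Y \<and> TS_distr p \<alpha> R b (distr M borel (L 1)))"

text \<open>The kernel \<open>K\<close> is a (regular) conditional distribution of \<open>Z\<close> given \<open>U\<close>: the measure \<open>K y\<close>
  is the law of \<open>Z\<close> given \<open>U = y\<close>.\<close>

definition cond_distr ::
  "'w measure \<Rightarrow> ('w \<Rightarrow> 'a::topological_space) \<Rightarrow> ('w \<Rightarrow> 'b::topological_space) \<Rightarrow>
    ('b \<Rightarrow> 'a measure) \<Rightarrow> bool" where
  "cond_distr M Z U K \<longleftrightarrow>
     K \<in> borel \<rightarrow>\<^sub>M prob_algebra borel \<and>
     (\<forall>B\<in>sets borel. AE \<omega> in M.
        real_cond_exp M (vimage_algebra (space M) U borel) (\<lambda>\<omega>. indicator B (Z \<omega>)) \<omega>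
          = measure (K (U \<omega>)) B)"


section \<open>The IBGM distribution\<close>

definition IBGM_const :: "real \<Rightarrow> real \<Rightarrow> real \<Rightarrow> real \<Rightarrow> real" where
  "IBGM_const \<beta> \<gamma> p \<eta> =
     1 / p * Gamma (\<gamma> - \<beta> / p) *
     (LBINT \<theta>:{1..\<eta>}. \<theta> powr (- 1) *
        (LBINT u:{1/\<theta>..1}. (1 - u powr p) powr (\<gamma> - 1) * u powr (- 1 - \<beta>)))"

definition IBGM_density :: "real \<Rightarrow> real \<Rightarrow> real \<Rightarrow> real \<Rightarrow> real \<Rightarrow> real" where
  "IBGM_density \<beta> \<gamma> p \<eta> v =
     (if v > 0 then
        1 / IBGM_const \<beta> \<gamma> p \<eta> * v powr (p * \<gamma> - \<beta> - 1) *
        (LBINT \<theta>:{1..\<eta>}. \<theta> powr (p * \<gamma> - \<beta> - 1) * exp (- (v powr p * \<theta> powr p)) *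
           (LBINT u:{1/\<theta>..1}. (1 - u powr p) powr (\<gamma> - 1) * u powr (- 1 - \<beta>)))
      else 0)"

definition IBGM :: "real \<Rightarrow> real \<Rightarrow> real \<Rightarrow> real \<Rightarrow> real measure" where
  "IBGM \<beta> \<gamma> p \<eta> = density lborel (\<lambda>v. ennreal (IBGM_density \<beta> \<gamma> p \<eta> v))"


section \<open>The random variables of the transition law\<close>

text \<open>The factor of \<open>R\<close> in the Rosinski measure of \<open>X\<^sub>n\<close>.  For \<open>n = 0\<close> and \<open>\<alpha> = 0\<close> it is the
  limiting value \<open>l * t\<close>.\<close>

definition kappa :: "real \<Rightarrow> real \<Rightarrow> real \<Rightarrow> real \<Rightarrow> nat \<Rightarrow> real" where
  "kappa p \<alpha> l t n =
     (if n = 0 then (if \<alpha> = 0 then l * t else (exp (\<alpha> * l * t) - 1) / \<alpha>)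
      else (LBINT u:{exp (- l * t)..1}. (1 - u powr p) ^ n / fact n * u powr (- 1 - \<alpha>)))"

text \<open>The variables have three different value types, so their joint independence is expressed
  by \<open>indep_sets\<close> for the generated sigma-algebras.  The family is \<open>N\<close>, \<open>X\<^sub>n\<close> for \<open>n < \<gamma>\<close>, and
  \<open>V\<^sub>n\<close>, \<open>W\<^sub>n\<close> for \<open>n \<ge> 1\<close>.\<close>

datatype rv_index = Idx_N | Idx_X nat | Idx_V nat | Idx_W nat

definition indep_family ::
  "'w measure \<Rightarrow> nat \<Rightarrow> ('w \<Rightarrow> nat) \<Rightarrow> (nat \<Rightarrow> 'w \<Rightarrow> 'a::euclidean_space) \<Rightarrow>
    (nat \<Rightarrow> 'w \<Rightarrow> 'a) \<Rightarrow> (nat \<Rightarrow> 'w \<Rightarrow> real) \<Rightarrow> bool" where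
  "indep_family \<Omega> \<gamma> N X V W \<longleftrightarrow>
     prob_space.indep_sets \<Omega>
       (\<lambda>i. case i of
              Idx_N \<Rightarrow> sets (vimage_algebra (space \<Omega>) N (count_space UNIV))
            | Idx_X n \<Rightarrow> sets (vimage_algebra (space \<Omega>) (X n) borel)
            | Idx_V n \<Rightarrow> sets (vimage_algebra (space \<Omega>) (V n) borel)
            | Idx_W n \<Rightarrow> sets (vimage_algebra (space \<Omega>) (W n) borel))
       ({Idx_N} \<union> Idx_X ` {..<\<gamma>} \<union> Idx_V ` {1..} \<union> Idx_W ` {1..})"

end

theory Submission
  imports Defs
begin

text \<open>Summation by parts turns the integral equation into a limit of sums of increments of \<open>L\<close>, so that
  \<open>Y\<^sub>s\<^sub>+\<^sub>t - e\<^sup>-\<^sup>l\<^sup>t Y\<^sub>s\<close> is independent of \<open>Y\<^sub>s\<close> and has the exponent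
  \<open>\<integral>\<^sub>0\<^sup>t \<psi> (e\<^sup>-\<^sup>l\<^sup>r v) dr\<close>, where \<open>\<psi>\<close> is the exponent of \<open>L\<^sub>1\<close>.  Substituting \<open>\<theta> = e\<^sup>l\<^sup>r\<close>, each jump direction
  contributes the function \<open>u \<mapsto> \<integral> \<theta>\<^sup>-\<^sup>1\<^sup>-\<^sup>\<alpha> exp (- u\<^sup>p \<theta>\<^sup>p) d\<theta>\<close> over \<open>1 \<le> \<theta> \<le> e\<^sup>l\<^sup>t\<close> as the density of its jump sizes with
  respect to \<open>u\<^sup>-\<^sup>1\<^sup>-\<^sup>\<alpha> du\<close>.  Integrating by parts \<open>\<gamma>\<close> times in \<open>\<theta>\<close> produces boundary terms
  proportional to \<open>u\<^sup>n\<^sup>p exp (- u\<^sup>p e\<^sup>p\<^sup>l\<^sup>t)\<close>, which belong to the tempered stable variables \<open>X\<^sub>n\<close> of order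
  \<open>\<alpha> - n p\<close>, and a remainder which is integrable because \<open>\<gamma> p > \<alpha>\<close>: it is the jump measure of
  the compound Poisson sum.  The constants \<open>b\<^sup>*\<^sub>n\<close> collect the compensators that are present for order
  \<open>\<alpha>\<close> but not for the parts.\<close>

text \<open>The laws in the statement are prescribed only through characteristic functions, and this
  shapes the proof. Uniqueness in several dimensions turns a factorised joint characteristic
  function into independence and hence into a conditional law. The laws of the X_n have to be
  constructed: they are almost sure sums of compensated compound Poisson variables over shells of
  shrinking jump sizes. A continuous logarithm vanishing at 0 excludes wrong branches when roots of
  the characteristic function of L_1 are taken. \<gamma> is the least positive integer with \<gamma>
  p > \<alpha>: each integration by parts gains a factor v^p, and v^(\<gamma> p - \<alpha> - 1) is
  integrable at 0. The boundary terms live at \<theta> = e^(l t); rescaling the jumps by this number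
  restores the standard tempering exp (- u^p) and produces the factor e^(- l t) in front of the X_n.
  The Gamma factors in the b*_n are first moments of u^(- 1 - \<beta>) exp (- u^p) with \<beta> =
  \<alpha> - n p.\<close>

lemma scale_measure_eq_density: "scale_measure r M = density M (\<lambda>_. r)"
  by (rule measure_eqI) (auto simp: emeasure_density_const)

lemma integral_scale_measure:
  fixes f :: "'a \<Rightarrow> 'b::{banach, second_countable_topology}"
  assumes "0 \<le> r"
  shows "(\<integral>x. f x \<partial>scale_measure (ennreal r) M) = r *\<^sub>R (\<integral>x. f x \<partial>M)"
proof (cases "f \<in> borel_measurable M")
  case True
  then show ?thesis
    using assms unfolding scale_measure_eq_density by (subst integral_density) auto
next
  case False
  \<comment> \<open>Scaling does not change measurability, so in this case both integrals take the
    default value 0.\<close>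
  then have "f \<notin> borel_measurable (scale_measure (ennreal r) M)"
    by (auto simp: measurable_def space_scale_measure)
  with False show ?thesis
    by (metis borel_measurable_integrable not_integrable_integral_eq scaleR_zero_right)
qed

lemma integrable_scale_measure:
  fixes f :: "'a \<Rightarrow> 'b::{banach, second_countable_topology}"
  assumes "0 \<le> r" "integrable M f"
  shows "integrable (scale_measure (ennreal r) M) f"
  using assms borel_measurable_integrable[OF assms(2)]
  unfolding scale_measure_eq_density by (subst integrable_density) auto

subsection \<open>Characteristic functions on Euclidean spaces\<close>

lemma norm_iexp_diff_one_le: "cmod (iexp y - 1) \<le> min \<bar>y\<bar> 2"
proof -
  have "cmod (iexp y - 1) \<le> \<bar>y\<bar>"
    using iexp_approx1[of y 0] by simp
  moreover have "cmod (iexp y - 1) \<le> 2"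
    using norm_triangle_ineq4[of "iexp y" 1] by simp
  ultimately show ?thesis by simp
qed

lemma (in finite_measure) integrable_iexp_real:
  assumes "f \<in> borel_measurable M"
  shows "integrable M (\<lambda>x. iexp (f x))"
  using assms by (intro integrable_const_bound [of _ 1]) auto

text \<open>The value at \<open>t = 0\<close> shows that the total masses agree, so one factor 1 / c
  normalises both measures and Levy's theorem for probability measures applies. Finite measures are
  needed because weights will be put on the measures as densities.\<close>

lemma measure_eqI_char:
  fixes \<mu> \<nu> :: "real measure"
  assumes fin: "finite_measure \<mu>" "finite_measure \<nu>"
    and [simp, measurable_cong]: "sets \<mu> = sets borel" "sets \<nu> = sets borel"
    and char: "\<And>t. (CLINT x|\<mu>. iexp (t * x)) = (CLINT x|\<nu>. iexp (t * x))"
  shows "\<mu> = \<nu>"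
proof -
  interpret \<mu>: finite_measure \<mu> by fact
  interpret \<nu>: finite_measure \<nu> by fact
  have sp [simp]: "space \<mu> = UNIV" "space \<nu> = UNIV"
    by (simp_all add: sets_eq_imp_space_eq[of _ "borel :: real measure"])
  define c where "c = measure \<mu> UNIV"
  have "complex_of_real (measure \<mu> UNIV) = complex_of_real (measure \<nu> UNIV)"
    using char[of 0] by simp
  then have c: "c = measure \<nu> UNIV" "c \<ge> 0"
    by (auto simp: c_def)
  show ?thesis
  proof (cases "c = 0")
    case True
    then have 0: "emeasure \<mu> UNIV = 0" "emeasure \<nu> UNIV = 0"
      using c c_def \<mu>.emeasure_eq_measure \<nu>.emeasure_eq_measure by simp_all
    have "emeasure \<mu> A = 0 \<and> emeasure \<nu> A = 0" for A
      using emeasure_mono[of A UNIV \<mu>] emeasure_mono[of A UNIV \<nu>] 0 by simp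
    then show ?thesis
      by (intro measure_eqI) auto
  next
    case False
    then have cpos: "c > 0" using c(2) by linarith
    let ?n = "\<lambda>M. scale_measure (ennreal (1 / c)) (M :: real measure)"
    have prob: "real_distribution (?n M)"
      if M: "finite_measure M" "sets M = sets borel" "space M = UNIV" "c = measure M UNIV" for M
    proof -
      interpret finite_measure M by fact
      have "emeasure (?n M) (space (?n M)) = 1"
        using cpos by (simp add: space_scale_measure M(3) emeasure_eq_measure M(4)[symmetric]
            flip: ennreal_mult)
      then interpret prob_space "?n M" by (rule prob_spaceI)
      show ?thesis
        by unfold_locales (simp_all add: M space_scale_measure)
    qed
    have "?n \<mu> = ?n \<nu>"
    proof (rule Levy_uniqueness)
      show "real_distribution (?n \<mu>)" "real_distribution (?n \<nu>)"
        using prob[of \<mu>] prob[of \<nu>] fin c c_def by auto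
      show "char (?n \<mu>) = char (?n \<nu>)"
        unfolding char_def using cpos by (intro ext) (use char in \<open>simp add: integral_scale_measure\<close>)
    qed
    then have "scale_measure (ennreal c) (?n \<mu>) = scale_measure (ennreal c) (?n \<nu>)"
      by simp
    then show ?thesis
      using cpos by (simp flip: ennreal_mult)
  qed
qed

text \<open>This is the uniqueness theorem for the image under \<open>f\<close> of the measure with
  density \<open>h\<close>. A bounded nonnegative weight can thus be carried along while one
  coordinate is turned into an indicator.\<close>

lemma integral_indicator_eqI_char:
  fixes \<mu> \<nu> :: "'a measure" and h f :: "'a \<Rightarrow> real"
  assumes fin: "finite_measure \<mu>" "finite_measure \<nu>" and sets: "sets \<nu> = sets \<mu>"
    and [measurable]: "h \<in> borel_measurable \<mu>" "f \<in> borel_measurable \<mu>"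
    and h: "\<And>x. 0 \<le> h x" "\<And>x. h x \<le> K"
    and char: "\<And>t. (CLINT x|\<mu>. h x * iexp (t * f x)) = (CLINT x|\<nu>. h x * iexp (t * f x))"
    and [measurable]: "A \<in> sets borel"
  shows "(\<integral>x. h x * indicator A (f x) \<partial>\<mu>) = (\<integral>x. h x * indicator A (f x) \<partial>\<nu>)"
proof -
  have meas: "h \<in> borel_measurable \<rho>" "f \<in> borel_measurable \<rho>" if "sets \<rho> = sets \<mu>" for \<rho>
    using that by (simp_all cong: measurable_cong_sets)
  let ?D = "\<lambda>\<rho>. distr (density \<rho> (\<lambda>x. ennreal (h x))) borel f"
  have D: "finite_measure (?D \<rho>)"
    "(CLINT x|?D \<rho>. iexp (t * x)) = (CLINT x|\<rho>. h x * iexp (t * f x))"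
    "measure (?D \<rho>) A = (\<integral>x. h x * indicator A (f x) \<partial>\<rho>)"
    if "finite_measure \<rho>" "sets \<rho> = sets \<mu>" for \<rho> t
  proof -
    interpret finite_measure \<rho> by fact
    note [measurable] = meas[OF that(2)]
    have "(\<integral>\<^sup>+x. h x \<partial>\<rho>) \<le> (\<integral>\<^sup>+x. ennreal K \<partial>\<rho>)"
      using h by (intro nn_integral_mono ennreal_leI) auto
    also have "\<dots> < \<infinity>"
      by (simp add: ennreal_mult_less_top emeasure_eq_measure)
    finally have "finite_measure (density \<rho> (\<lambda>x. ennreal (h x)))"
      by (intro finite_measureI) (auto simp: emeasure_density cong: nn_integral_cong_simp)
    then interpret d: finite_measure "density \<rho> (\<lambda>x. ennreal (h x))" .
    show "finite_measure (?D \<rho>)"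
      by (rule d.finite_measure_distr) simp
    show "(CLINT x|?D \<rho>. iexp (t * x)) = (CLINT x|\<rho>. h x * iexp (t * f x))"
      using h by (subst integral_distr, simp, simp, subst integral_density) (auto simp: scaleR_conv_of_real)
    have "measure (?D \<rho>) A = (\<integral>x. indicator A x \<partial>?D \<rho>)"
      by simp
    also have "\<dots> = (\<integral>x. h x * indicator A (f x) \<partial>\<rho>)"
      using h by (subst integral_distr, simp, simp, subst integral_density) auto
    finally show "measure (?D \<rho>) A = (\<integral>x. h x * indicator A (f x) \<partial>\<rho>)" .
  qed
  have "?D \<mu> = ?D \<nu>"
    using D[OF fin(1) refl] D[OF fin(2) sets] char by (intro measure_eqI_char) auto
  with D(3)[OF fin(1) refl] D(3)[OF fin(2) sets] show ?thesis
    by simp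
qed

text \<open>Written with exponentials, every factor 1 + cos shifts the frequency \<open>w\<close> by
  0 or by plus or minus \<open>z j\<close> in direction \<open>j\<close>, so the integrand is a
  linear combination of characters. The induction needs all \<open>w\<close> because of these
  shifts.\<close>

lemma trig_integral_eqI_charfun:
  fixes \<mu> \<nu> :: "'a::euclidean_space measure"
  assumes fin: "finite_measure \<mu>" "finite_measure \<nu>"
    and [simp, measurable_cong]: "sets \<mu> = sets borel" "sets \<nu> = sets borel"
    and char: "\<And>z. charfun \<mu> z = charfun \<nu> z" and "finite T"
  shows "(CLINT x|\<mu>. (\<Prod>i\<in>T. complex_of_real (1 + cos (z i * (x \<bullet> i) + c i))) * iexp (x \<bullet> w)) =
    (CLINT x|\<nu>. (\<Prod>i\<in>T. complex_of_real (1 + cos (z i * (x \<bullet> i) + c i))) * iexp (x \<bullet> w))"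
  using \<open>finite T\<close>
proof (induction T arbitrary: w rule: finite_induct)
  case empty
  then show ?case using char[of w] by (simp add: charfun_def)
next
  case (insert j T)
  let ?P = "\<lambda>x::'a. \<Prod>i\<in>T. complex_of_real (1 + cos (z i * (x \<bullet> i) + c i))"
  have int: "integrable \<rho> (\<lambda>x. ?P x * iexp (x \<bullet> w))"
    if "finite_measure \<rho>" "sets \<rho> = sets borel" for \<rho> w
  proof -
    interpret finite_measure \<rho> by fact
    note [measurable_cong] = that(2)
    have "cmod (?P x) \<le> (\<Prod>i\<in>T. 2)" for x
      unfolding prod_norm[symmetric]
    proof (rule prod_mono, safe)
      fix i show "cmod (complex_of_real (1 + cos (z i * (x \<bullet> i) + c i))) \<le> 2"
        using cos_le_one[of "z i * (x \<bullet> i) + c i"] cos_ge_minus_one[of "z i * (x \<bullet> i) + c i"]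
        unfolding norm_of_real by (intro abs_leI) linarith+
    qed simp
    then show ?thesis
      by (intro integrable_const_bound[of _ "2 ^ card T"]) (auto simp: norm_mult)
  qed
  have cos: "complex_of_real (1 + cos \<theta>) = 1 + (iexp \<theta> + iexp (- \<theta>)) / 2" for \<theta>
    by (simp add: cos_of_real[symmetric] cos_exp_eq)
  have eq: "(\<Prod>i\<in>insert j T. complex_of_real (1 + cos (z i * (x \<bullet> i) + c i))) * iexp (x \<bullet> w) =
     ?P x * iexp (x \<bullet> w) + iexp (c j) / 2 * (?P x * iexp (x \<bullet> (w + z j *\<^sub>R j)))
       + iexp (- c j) / 2 * (?P x * iexp (x \<bullet> (w - z j *\<^sub>R j)))" for x
  proof -
    have e: "iexp (z j * (x \<bullet> j) + c j) * iexp (x \<bullet> w) = iexp (c j) * iexp (x \<bullet> (w + z j *\<^sub>R j))"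
      "iexp (- (z j * (x \<bullet> j) + c j)) * iexp (x \<bullet> w) = iexp (- c j) * iexp (x \<bullet> (w - z j *\<^sub>R j))"
      unfolding exp_add[symmetric] by (simp_all add: algebra_simps)
    have "(1 + (B + B') / 2) * P * A = P * A + C / 2 * (P * D) + C' / 2 * (P * D')"
      if "B * A = C * D" "B' * A = C' * D'" for A B B' C C' D D' P :: complex
    proof -
      have "(1 + (B + B') / 2) * P * A = P * A + P * (B * A) / 2 + P * (B' * A) / 2"
        by (simp add: field_simps)
      also have "\<dots> = P * A + P * (C * D) / 2 + P * (C' * D') / 2"
        by (simp only: that)
      finally show ?thesis by (simp add: mult_ac)
    qed
    from this[OF e] show ?thesis
      unfolding prod.insert[OF insert(1,2)] cos .
  qed
  show ?case
    unfolding eq using int[OF fin(1)] int[OF fin(2)] insert.IH by simp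
qed

text \<open>The induction runs over the set \<open>S\<close> of coordinates that already carry
  indicators, with the trigonometric coordinates \<open>T\<close> arbitrary. To move
  \<open>j\<close> into \<open>S\<close>, the induction hypothesis is used with \<open>j\<close> in
  \<open>T\<close>, and the remaining product serves as the weight in the one-dimensional
  theorem.\<close>

lemma rect_integral_eqI_charfun:
  fixes \<mu> \<nu> :: "'a::euclidean_space measure"
  assumes fin: "finite_measure \<mu>" "finite_measure \<nu>"
    and [simp, measurable_cong]: "sets \<mu> = sets borel" "sets \<nu> = sets borel"
    and char: "\<And>z. charfun \<mu> z = charfun \<nu> z" and "finite S" "finite T" "S \<inter> T = {}"
  shows "(\<integral>x. (\<Prod>i\<in>T. 1 + cos (z i * (x \<bullet> i) + c i)) * (\<Prod>i\<in>S. indicator {..a i} (x \<bullet> i)) \<partial>\<mu>) =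
    (\<integral>x. (\<Prod>i\<in>T. 1 + cos (z i * (x \<bullet> i) + c i)) * (\<Prod>i\<in>S. indicator {..a i} (x \<bullet> i)) \<partial>\<nu>)"
  using \<open>finite S\<close> \<open>finite T\<close> \<open>S \<inter> T = {}\<close>
proof (induction S arbitrary: T z c rule: finite_induct)
  case empty
  have "complex_of_real (\<integral>x. (\<Prod>i\<in>T. 1 + cos (z i * (x \<bullet> i) + c i)) \<partial>\<mu>) =
    complex_of_real (\<integral>x. (\<Prod>i\<in>T. 1 + cos (z i * (x \<bullet> i) + c i)) \<partial>\<nu>)"
    using trig_integral_eqI_charfun[OF assms(1-5) empty(1), of z c 0]
    by (simp flip: integral_complex_of_real)
  then show ?case
    unfolding of_real_eq_iff by simp
next
  case (insert j S)
  have "finite T" by (fact insert.prems)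
  define h where "h x = (\<Prod>i\<in>T. 1 + cos (z i * (x \<bullet> i) + c i)) * (\<Prod>i\<in>S. indicator {..a i} (x \<bullet> i))"
    for x :: 'a
  have h0: "0 \<le> 1 + cos y" "1 + cos y \<le> 2" for y :: real
    using cos_ge_minus_one[of y] cos_le_one[of y] by linarith+
  have h: "0 \<le> h x" "h x \<le> 2 ^ card T" for x
  proof -
    have "(\<Prod>i\<in>T. 1 + cos (z i * (x \<bullet> i) + c i)) \<le> (\<Prod>i\<in>T. 2)"
      by (rule prod_mono) (use h0 in auto)
    moreover have "0 \<le> (\<Prod>i\<in>T. 1 + cos (z i * (x \<bullet> i) + c i))"
      by (rule prod_nonneg) (use h0 in auto)
    moreover have "(\<Prod>i\<in>S. indicator {..a i} (x \<bullet> i) :: real) \<le> 1"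
      by (rule prod_le_1) (auto simp: indicator_def)
    moreover have "0 \<le> (\<Prod>i\<in>S. indicator {..a i} (x \<bullet> i) :: real)"
      by (rule prod_nonneg) (auto simp: indicator_def)
    ultimately show "0 \<le> h x" "h x \<le> 2 ^ card T"
      using mult_mono[of "\<Prod>i\<in>T. 1 + cos (z i * (x \<bullet> i) + c i)" "2 ^ card T"
          "\<Prod>i\<in>S. indicator {..a i} (x \<bullet> i)" 1] by (auto simp: h_def)
  qed
  have hm [measurable]: "h \<in> borel_measurable borel"
    unfolding h_def[abs_def] by measurable
  have int: "integrable \<rho> (\<lambda>x. h x * g x)" if "finite_measure \<rho>" "sets \<rho> = sets borel"
    "g \<in> borel_measurable borel" "\<And>x. \<bar>g x\<bar> \<le> 1" for \<rho> :: "'a measure" and g :: "'a \<Rightarrow> real"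
  proof -
    interpret finite_measure \<rho> by fact
    note [measurable_cong] = that(2) note [measurable] = that(3)
    have "\<bar>h x * g x\<bar> \<le> 2 ^ card T" for x
      using mult_mono[OF h(2)[of x] that(4)[of x]] h(1)[of x] by (simp add: abs_mult)
    then show ?thesis
      by (intro integrable_const_bound[of _ "2 ^ card T"]) auto
  qed
  have False: "j \<notin> T" using insert by auto
    \<comment> \<open>Here \<open>j\<close> is still a trigonometric coordinate; its frequency
      \<open>t\<close> and phase \<open>d\<close> are free, which is why \<open>z\<close> and
      \<open>c\<close> are generalised in the induction.\<close>
    have *: "(\<integral>x. h x * (1 + cos (t * (x \<bullet> j) + d)) \<partial>\<mu>) = (\<integral>x. h x * (1 + cos (t * (x \<bullet> j) + d)) \<partial>\<nu>)"
      for t d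
    proof -
      have p: "(\<Prod>i\<in>insert j T. 1 + cos ((z(j := t)) i * (x \<bullet> i) + (c(j := d)) i)) =
          (1 + cos (t * (x \<bullet> j) + d)) * (\<Prod>i\<in>T. 1 + cos (z i * (x \<bullet> i) + c i))" for x
        using False insert by (simp add: prod.insert cong: prod.cong) 
           (intro disjI2 prod.cong, auto)
      have fT: "finite (insert j T)" "S \<inter> insert j T = {}"
        using insert by auto
      show ?thesis
        using insert.IH[OF fT, of "z(j := t)" "c(j := d)"]
        unfolding p by (simp add: h_def mult_ac)
    qed
    \<comment> \<open>For t = d = 0 the extra factor is the constant 2. Subtracting this case
      isolates the pure cosine.\<close>
    have h1: "(\<integral>x. h x \<partial>\<mu>) = (\<integral>x. h x \<partial>\<nu>)"
      using *[of 0 0] by simp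
    have cos: "(\<integral>x. h x * cos (t * (x \<bullet> j) + d) \<partial>\<mu>) = (\<integral>x. h x * cos (t * (x \<bullet> j) + d) \<partial>\<nu>)" for t d
      using *[of t d] h1 int[OF fin(1), of "\<lambda>_. 1"] int[OF fin(2), of "\<lambda>_. 1"]
        int[OF fin(1), of "\<lambda>x. cos (t * (x \<bullet> j) + d)"] int[OF fin(2), of "\<lambda>x. cos (t * (x \<bullet> j) + d)"]
      by (simp add: ring_distribs)
    have char: "(CLINT x|\<mu>. h x * iexp (t * (x \<bullet> j))) = (CLINT x|\<nu>. h x * iexp (t * (x \<bullet> j)))" for t
    proof -
      \<comment> \<open>This phase turns the cosine into a sine, so the real and imaginary parts of
        the character are both covered by the cosine identity.\<close>
      obtain d where d: "d = - (pi / 2)" by blast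
      let ?g = "\<lambda>x d. h x * cos (t * (x \<bullet> j) + d)"
      have eq: "h x * iexp (t * (x \<bullet> j)) = complex_of_real (?g x 0) + \<i> * complex_of_real (?g x d)" for x
        unfolding d by (simp add: complex_eq_iff Re_exp Im_exp cos_diff)
      have g: "integrable \<mu> (\<lambda>x. ?g x d)" "integrable \<nu> (\<lambda>x. ?g x d)" for d
        by (rule int; use fin in simp)+
      have gc: "integrable \<mu> (\<lambda>x. complex_of_real (?g x 0))" "integrable \<nu> (\<lambda>x. complex_of_real (?g x 0))"
        "integrable \<mu> (\<lambda>x. \<i> * complex_of_real (?g x d))" "integrable \<nu> (\<lambda>x. \<i> * complex_of_real (?g x d))"
        by (intro integrable_mult_right integrable_of_real g)+
      show ?thesis
        unfolding eq Bochner_Integration.integral_add[OF gc(1,3)] Bochner_Integration.integral_add[OF gc(2,4)]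
          integral_mult_right_zero integral_complex_of_real cos ..
    qed
    have "(\<integral>x. h x * indicator {..a j} (x \<bullet> j) \<partial>\<mu>) = (\<integral>x. h x * indicator {..a j} (x \<bullet> j) \<partial>\<nu>)"
      by (rule integral_indicator_eqI_char[OF fin _ _ _ h char]) simp_all
    then show ?case
      unfolding prod.insert[OF insert(1,2)] by (simp add: h_def mult_ac)
qed

text \<open>A half space in direction \<open>j\<close> is the countable union of the orthants with
  the given bound in direction \<open>j\<close> and the bound n in all others. The orthants are
  closed under intersections, as a generator must be for the uniqueness of measures.\<close>

lemma borel_eq_sigma_lower_orthants:
  "borel = sigma UNIV (range (\<lambda>a::'a::euclidean_space. {x. \<forall>i\<in>Basis. x \<bullet> i \<le> a \<bullet> i}))"
proof (rule borel_eq_sigmaI4[OF borel_eq_halfspace_le])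
  fix a :: real and j :: 'a assume "(a, j) \<in> UNIV \<times> Basis"
  then have j: "j \<in> Basis" by simp
  let ?v = "\<lambda>n. \<Sum>i\<in>Basis. (if i = j then a else real n) *\<^sub>R i :: 'a"
  let ?O = "\<lambda>a::'a. {x. \<forall>i\<in>Basis. x \<bullet> i \<le> a \<bullet> i}"
  have v: "?v n \<bullet> i = (if i = j then a else real n)" if "i \<in> Basis" for n i
    using that by (subst inner_sum_left_Basis) auto
  have "{x::'a. x \<bullet> j \<le> a} = (\<Union>n. ?O (?v n))"
  proof safe
    fix x :: 'a assume x: "x \<bullet> j \<le> a"
    obtain n where n: "norm x \<le> real n" using real_arch_simple by blast
    have "x \<bullet> i \<le> real n" if "i \<in> Basis" for i
      using n Basis_le_norm[OF that, of x] by linarith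
    then have "x \<in> ?O (?v n)" using x v by auto
    then show "x \<in> (\<Union>n. ?O (?v n))" by blast
  next
    fix x :: 'a and n :: nat assume "\<forall>i\<in>Basis. x \<bullet> i \<le> ?v n \<bullet> i"
    then show "x \<bullet> j \<le> a" using v[OF j] j by metis
  qed
  also have "\<dots> \<in> sets (sigma UNIV (range ?O))"
  proof (rule sets.countable_UN'')
    fix n show "?O (?v n) \<in> sets (sigma UNIV (range ?O))"
      unfolding sets_measure_of[OF subset_UNIV[of "range ?O", folded Pow_UNIV]]
      by (rule sigma_sets.Basic) (rule rangeI)
  qed simp
  finally show "{x. x \<bullet> j \<le> a} \<in> sets (sigma UNIV (range ?O))" .
next
  fix a :: 'a show "{x. \<forall>i\<in>Basis. x \<bullet> i \<le> a \<bullet> i} \<in> sets borel"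
    by measurable
qed

text \<open>Bounded functions of the form \<open>\<Prod>i\<in>T. 1 + cos (z i * (x \<bullet> i) + c i)\<close> are nonnegative, so that the
  coordinates can be exchanged for indicators one at a time by the one-dimensional theorem.\<close>

theorem charfun_eqI:
  fixes \<mu> \<nu> :: "'a::euclidean_space measure"
  assumes fin: "finite_measure \<mu>" "finite_measure \<nu>"
    and s [simp, measurable_cong]: "sets \<mu> = sets borel" "sets \<nu> = sets borel"
    and char: "\<And>z. charfun \<mu> z = charfun \<nu> z"
  shows "\<mu> = \<nu>"
proof -
  interpret \<mu>: finite_measure \<mu> by fact
  interpret \<nu>: finite_measure \<nu> by fact
  let ?O = "\<lambda>a::'a. {x. \<forall>i\<in>Basis. x \<bullet> i \<le> a \<bullet> i}"
  have O [measurable]: "?O a \<in> sets borel" for a by measurable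
  have "measure \<mu> (?O a) = measure \<nu> (?O a)" for a
  proof -
    have ind: "(\<Prod>i\<in>Basis. indicator {..a \<bullet> i} (x \<bullet> i)) = (indicator (?O a) x :: real)" for x
      by (auto simp: indicator_def prod_zero_iff)
    have "(\<integral>x. indicator (?O a) x \<partial>\<mu>) = (\<integral>x. indicator (?O a) x \<partial>\<nu> :: real)"
      using rect_integral_eqI_charfun[OF fin s char finite_Basis finite.emptyI, of "\<lambda>_. 0" "\<lambda>_. 0" "\<lambda>i. a \<bullet> i"]
      by (simp add: ind)
    then show ?thesis by simp
  qed
  then have eq: "emeasure \<mu> (?O a) = emeasure \<nu> (?O a)" for a
    by (simp add: \<mu>.emeasure_eq_measure \<nu>.emeasure_eq_measure)
  have sg: "sets (borel :: 'a measure) = sigma_sets UNIV (range ?O)"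
    using arg_cong[OF borel_eq_sigma_lower_orthants, of sets] by simp
  show ?thesis
  proof (rule measure_eqI_generator_eq[where \<Omega>=UNIV and E="range ?O" and A="\<lambda>n. ?O (\<Sum>i\<in>Basis. real n *\<^sub>R i)"])
    show "Int_stable (range ?O)"
    proof (rule Int_stableI_image)
      fix a b :: 'a
      let ?c = "\<Sum>i\<in>Basis. min (a \<bullet> i) (b \<bullet> i) *\<^sub>R i :: 'a"
      have "?O a \<inter> ?O b = ?O ?c"
        by (auto simp: inner_sum_left_Basis)
      then show "\<exists>c\<in>UNIV. ?O a \<inter> ?O b = ?O c" by blast
    qed
    show "(\<Union>n. ?O (\<Sum>i\<in>Basis. real n *\<^sub>R i)) = UNIV"
    proof safe
      fix x :: 'a
      obtain n where n: "norm x \<le> real n" using real_arch_simple by blast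
      have "x \<bullet> i \<le> real n" if "i \<in> Basis" for i
        using n Basis_le_norm[OF that, of x] by linarith
      then have "x \<in> ?O (\<Sum>i\<in>Basis. real n *\<^sub>R i)"
        by (auto simp: inner_sum_left_Basis)
      then show "x \<in> (\<Union>n. ?O (\<Sum>i\<in>Basis. real n *\<^sub>R i))" by blast
    qed simp
    show "range (\<lambda>n. ?O (\<Sum>i\<in>Basis. real n *\<^sub>R i)) \<subseteq> range ?O"
      by blast
  qed (use eq sg in \<open>auto simp: \<mu>.emeasure_finite\<close>)
qed

section \<open>Images, continuity, convolution and translation of characteristic functions\<close>

lemma charfun_distr:
  "f \<in> borel_measurable M \<Longrightarrow> charfun (distr M borel f) z = (CLINT x|M. iexp (f x \<bullet> z))"
  unfolding charfun_def by (subst integral_distr) auto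

lemma charfun_0: "prob_space \<mu> \<Longrightarrow> charfun \<mu> 0 = 1"
  by (simp add: charfun_def prob_space.prob_space)

lemma continuous_charfun:
  fixes \<mu> :: "'a::euclidean_space measure"
  assumes "finite_measure \<mu>" and [measurable_cong]: "sets \<mu> = sets borel"
  shows "continuous_on S (charfun \<mu>)"
proof (rule continuous_on_subset[of UNIV])
  interpret finite_measure \<mu> by fact
  show "continuous_on UNIV (charfun \<mu>)"
    unfolding continuous_on_sequentially
  proof safe
    fix X and z :: 'a assume X: "X \<longlonglongrightarrow> z"
    show "(charfun \<mu> \<circ> X) \<longlonglongrightarrow> charfun \<mu> z"
      unfolding comp_def charfun_def
      by (rule integral_dominated_convergence[where w="\<lambda>_. 1"]) (auto intro!: tendsto_intros X)
  qed
qed simp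

lemma charfun_add_exists:
  fixes \<mu> \<nu> :: "'a::euclidean_space measure"
  assumes "prob_space \<mu>" "prob_space \<nu>"
    and [simp, measurable_cong]: "sets \<mu> = sets borel" "sets \<nu> = sets borel"
  obtains \<rho> :: "'a measure" where "prob_space \<rho>" "sets \<rho> = sets borel"
    "\<And>z. charfun \<rho> z = charfun \<mu> z * charfun \<nu> z"
proof -
  interpret \<mu>: prob_space \<mu> by fact
  interpret \<nu>: prob_space \<nu> by fact
  interpret P: pair_prob_space \<mu> \<nu> ..
  let ?\<rho> = "distr (\<mu> \<Otimes>\<^sub>M \<nu>) borel (\<lambda>(x, y). x + y)"
  have "charfun ?\<rho> z = charfun \<mu> z * charfun \<nu> z" for z
  proof -
    have "charfun ?\<rho> z = (CLINT p|\<mu> \<Otimes>\<^sub>M \<nu>. iexp (fst p \<bullet> z) * iexp (snd p \<bullet> z))"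
      by (subst charfun_distr) (auto simp: case_prod_unfold inner_add_left distrib_left exp_add)
    also have "\<dots> = (CLINT x|\<mu>. CLINT y|\<nu>. iexp (x \<bullet> z) * iexp (y \<bullet> z))"
      by (subst P.integral_fst'[symmetric])
         (auto intro!: P.integrable_const_bound[of _ 1] simp: norm_mult)
    also have "\<dots> = charfun \<mu> z * charfun \<nu> z"
      by (simp add: charfun_def)
    finally show ?thesis .
  qed
  moreover have "prob_space ?\<rho>" by (rule P.prob_space_distr) simp
  ultimately show ?thesis
    using that[of ?\<rho>] by simp
qed

lemma charfun_shift_exists:
  fixes \<mu> :: "'a::euclidean_space measure"
  assumes "prob_space \<mu>" and [simp, measurable_cong]: "sets \<mu> = sets borel"
  obtains \<rho> :: "'a measure" where "prob_space \<rho>" "sets \<rho> = sets borel"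
    "\<And>z. charfun \<rho> z = iexp (c \<bullet> z) * charfun \<mu> z"
proof -
  interpret \<mu>: prob_space \<mu> by fact
  have "charfun (distr \<mu> borel ((+) c)) z = iexp (c \<bullet> z) * charfun \<mu> z" for z
    by (subst charfun_distr) (auto simp: charfun_def inner_add_left distrib_left exp_add)
  moreover have "prob_space (distr \<mu> borel ((+) c))" by (rule \<mu>.prob_space_distr) simp
  ultimately show ?thesis
    using that[of "distr \<mu> borel ((+) c)"] by simp
qed

subsection \<open>Riemann sums\<close>

lemma has_integral_partition_sum:
  fixes g :: "real \<Rightarrow> 'a::banach" and t :: "nat \<Rightarrow> real"
  assumes "mono t" and "\<And>k. k < N \<Longrightarrow> (g has_integral I k) {t k..t (Suc k)}"
  shows "(g has_integral (\<Sum>k<N. I k)) {t 0..t N}"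
  using assms(2)
proof (induction N)
  case (Suc N)
  have "(g has_integral (\<Sum>k<N. I k) + I N) {t 0..t (Suc N)}"
    using Suc assms(1) by (intro has_integral_combine[of _ "t N"]) (auto simp: monoD)
  then show ?case by simp
qed (simp add: has_integral_refl)

text \<open>There are \<open>Suc n\<close> equal cells, so the mesh is also meaningful for
  \<open>n = 0\<close>.\<close>

definition grid :: "real \<Rightarrow> real \<Rightarrow> nat \<Rightarrow> nat \<Rightarrow> real" where
  "grid S T n k = S + (T - S) * real k / real (Suc n)"

lemma grid_0 [simp]: "grid S T n 0 = S"
  by (simp add: grid_def)

lemma grid_Suc_n [simp]: "grid S T n (Suc n) = T"
  by (simp add: grid_def del: of_nat_Suc)

lemma grid_mono: "S \<le> T \<Longrightarrow> mono (grid S T n)"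
  unfolding grid_def by (intro monoI add_left_mono divide_right_mono mult_left_mono) auto

lemma grid_diff: "grid S T n (Suc k) - grid S T n k = (T - S) / real (Suc n)"
proof -
  have "(T - S) * real (Suc k) / real (Suc n) - (T - S) * real k / real (Suc n) = (T - S) / real (Suc n)"
    unfolding diff_divide_distrib[symmetric] right_diff_distrib[symmetric] by simp
  then show ?thesis by (simp add: grid_def del: of_nat_Suc)
qed

text \<open>The integrands on the cells, which depend on the end points of their cell, are glued to
  one function on [S, T], and dominated convergence is applied to it. The hypothesis on limits
  concerns left end points below u and right end points above u only, so one-sided continuity of a
  path suffices to verify it.\<close>

lemma riemann_sum_tendsto:
  fixes G :: "real \<Rightarrow> real \<Rightarrow> real \<Rightarrow> 'a::euclidean_space"
  assumes ST: "S < T"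
    and int: "\<And>a b. \<lbrakk>S \<le> a; a \<le> b; b \<le> T\<rbrakk> \<Longrightarrow> G a b integrable_on {a..b}"
    and bound: "\<And>a b u. \<lbrakk>S \<le> a; a \<le> u; u \<le> b; b \<le> T\<rbrakk> \<Longrightarrow> norm (G a b u) \<le> B"
    and lim: "\<And>a b u. \<lbrakk>\<And>n::nat. S \<le> a n; \<And>n. a n \<le> u; \<And>n. u \<le> b n; \<And>n. b n \<le> T; a \<longlonglongrightarrow> u; b \<longlonglongrightarrow> u\<rbrakk>
       \<Longrightarrow> (\<lambda>n. G (a n) (b n) u) \<longlonglongrightarrow> g u"
  shows "(\<lambda>n. \<Sum>k<Suc n. integral {grid S T n k..grid S T n (Suc k)} (G (grid S T n k) (grid S T n (Suc k))))
    \<longlonglongrightarrow> integral {S..T} g"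
proof -
  define \<delta> where "\<delta> n = (T - S) / real (Suc n)" for n
  have \<delta>: "\<delta> n > 0" for n using ST by (simp add: \<delta>_def del: of_nat_Suc)
  have g\<delta>: "grid S T n k = S + \<delta> n * real k" for n k by (simp add: grid_def \<delta>_def)
  have \<delta>N: "\<delta> n * real (Suc n) = T - S" for n by (simp add: \<delta>_def del: of_nat_Suc)
  have \<delta>0: "\<delta> \<longlonglongrightarrow> 0" unfolding \<delta>_def by real_asymp
  \<comment> \<open>The functions \<open>f n\<close> and \<open>c n\<close> send u to the left and
    right end point of its grid cell.\<close>
  define f where "f n u = S + \<delta> n * of_int \<lfloor>(u - S) / \<delta> n\<rfloor>" for n u
  define c where "c n u = S + \<delta> n * of_int \<lceil>(u - S) / \<delta> n\<rceil>" for n u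
  define F where "F n u = G (f n u) (c n u) u" for n u
  have fc: "S \<le> f n u" "f n u \<le> u" "u \<le> c n u" "c n u \<le> T" "u - \<delta> n \<le> f n u" "c n u \<le> u + \<delta> n"
    if u: "u \<in> {S..T}" for n u
  proof -
    let ?x = "(u - S) / \<delta> n"
    have x: "\<delta> n * ?x = u - S" using \<delta>[of n] by simp
    have x0: "0 \<le> ?x" "?x \<le> real (Suc n)"
      using u \<delta>[of n] \<delta>N[of n] by (auto simp: pos_divide_le_eq mult.commute simp del: of_nat_Suc)
    have fl: "0 \<le> \<lfloor>?x\<rfloor>" "of_int \<lfloor>?x\<rfloor> \<le> ?x" "?x - 1 \<le> of_int \<lfloor>?x\<rfloor>" using x0 by linarith+
    have ce: "\<lceil>?x\<rceil> \<le> int (Suc n)" "?x \<le> of_int \<lceil>?x\<rceil>" "of_int \<lceil>?x\<rceil> \<le> ?x + 1" using x0 by linarith+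
    have ce': "real_of_int \<lceil>?x\<rceil> \<le> real (Suc n)" using ce(1) by linarith
    show "S \<le> f n u" using fl(1) \<delta>[of n] by (simp add: f_def)
    show "f n u \<le> u" using mult_left_mono[OF fl(2), of "\<delta> n"] \<delta>[of n] unfolding x f_def by simp
    show "u \<le> c n u" using mult_left_mono[OF ce(2), of "\<delta> n"] \<delta>[of n] unfolding x c_def by simp
    show "c n u \<le> T" using mult_left_mono[OF ce', of "\<delta> n"] \<delta>[of n] unfolding \<delta>N c_def by simp
    show "u - \<delta> n \<le> f n u" using mult_left_mono[OF fl(3), of "\<delta> n"] \<delta>[of n]
      unfolding x f_def right_diff_distrib by simp
    show "c n u \<le> u + \<delta> n" using mult_left_mono[OF ce(3), of "\<delta> n"] \<delta>[of n]
      unfolding x c_def distrib_left by simp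
  qed
  have hi: "(F n has_integral (\<Sum>k<Suc n. integral {grid S T n k..grid S T n (Suc k)} (G (grid S T n k) (grid S T n (Suc k))))) {S..T}"
    for n
  proof -
    have "(F n has_integral integral {grid S T n k..grid S T n (Suc k)} (G (grid S T n k) (grid S T n (Suc k))))
        {grid S T n k..grid S T n (Suc k)}" if k: "k < Suc n" for k
    \<comment> \<open>At a grid point floor and ceiling coincide and the cell degenerates, so the
      two end points are excluded from the comparison.\<close>
    proof (rule has_integral_spike_finite[of "{grid S T n k, grid S T n (Suc k)}"])
      have m: "mono (grid S T n)" using ST by (intro grid_mono) simp
      have "S \<le> grid S T n k" "grid S T n k \<le> grid S T n (Suc k)" "grid S T n (Suc k) \<le> T"
        using monoD[OF m, of 0 k] monoD[OF m, of k "Suc k"] monoD[OF m, of "Suc k" "Suc n"] k by auto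
      then show "(G (grid S T n k) (grid S T n (Suc k)) has_integral
          integral {grid S T n k..grid S T n (Suc k)} (G (grid S T n k) (grid S T n (Suc k))))
        {grid S T n k..grid S T n (Suc k)}"
        by (intro integrable_integral int)
      fix u assume "u \<in> {grid S T n k..grid S T n (Suc k)} - {grid S T n k, grid S T n (Suc k)}"
      then have "\<delta> n * real k < u - S" "u - S < \<delta> n * real (Suc k)" by (auto simp: g\<delta>)
      then have x: "real k < (u - S) / \<delta> n" "(u - S) / \<delta> n < real (Suc k)"
        using \<delta>[of n] by (simp_all add: pos_less_divide_eq pos_divide_less_eq mult.commute)
      have "\<lfloor>(u - S) / \<delta> n\<rfloor> = int k" "\<lceil>(u - S) / \<delta> n\<rceil> = int (Suc k)"
        using x by (auto intro!: floor_unique ceiling_unique)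
      then have "f n u = grid S T n k" "c n u = grid S T n (Suc k)"
        by (simp_all add: f_def c_def g\<delta>)
      then show "F n u = G (grid S T n k) (grid S T n (Suc k)) u" by (simp add: F_def)
    qed simp
    from has_integral_partition_sum[of "grid S T n" "Suc n" "F n", OF _ this] show ?thesis
      using grid_mono[of S T n] ST by simp
  qed
  have "(\<lambda>n. integral {S..T} (F n)) \<longlonglongrightarrow> integral {S..T} g"
  proof (rule dominated_convergence)
    show "F n integrable_on {S..T}" for n using hi by blast
    show "(\<lambda>_. B) integrable_on {S..T}" by (rule integrable_const_ivl)
    show "norm (F n u) \<le> B" if "u \<in> {S..T}" for n u
      unfolding F_def using fc[OF that] by (intro bound)
    show "(\<lambda>n. F n u) \<longlonglongrightarrow> g u" if "u \<in> {S..T}" for u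
      unfolding F_def
    proof (rule lim)
      show "(\<lambda>n. f n u) \<longlonglongrightarrow> u"
        by (rule tendsto_sandwich[of "\<lambda>n. u - \<delta> n" _ _ "\<lambda>n. u"])
           (use fc[OF that] \<delta>0 in \<open>auto intro!: always_eventually tendsto_eq_intros\<close>)
      show "(\<lambda>n. c n u) \<longlonglongrightarrow> u"
        by (rule tendsto_sandwich[of "\<lambda>n. u" _ _ "\<lambda>n. u + \<delta> n"])
           (use fc[OF that] \<delta>0 in \<open>auto intro!: always_eventually tendsto_eq_intros\<close>)
    qed (use fc[OF that] in auto)
  qed
  then show ?thesis
    unfolding hi[THEN integral_unique] .
qed

lemma riemann_sum_continuous_tendsto:
  fixes f :: "real \<Rightarrow> 'a::euclidean_space"
  assumes "S < T" and f: "continuous_on {S..T} f"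
  shows "(\<lambda>n. \<Sum>k<Suc n. ((T - S) / real (Suc n)) *\<^sub>R f (grid S T n k)) \<longlonglongrightarrow> integral {S..T} f"
proof -
  have "bounded (f ` {S..T})"
    using f by (intro compact_imp_bounded compact_continuous_image) auto
  then obtain B where B: "\<forall>u\<in>{S..T}. norm (f u) \<le> B" by (auto simp: bounded_iff)
  have "(\<lambda>n. \<Sum>k<Suc n. integral {grid S T n k..grid S T n (Suc k)} ((\<lambda>a b u. f a) (grid S T n k) (grid S T n (Suc k))))
    \<longlonglongrightarrow> integral {S..T} f"
  proof (rule riemann_sum_tendsto[OF \<open>S < T\<close>])
    fix a b :: "nat \<Rightarrow> real" and u :: real assume *: "\<And>n::nat. S \<le> a n" "\<And>n. a n \<le> u" "\<And>n. u \<le> b n" "\<And>n. b n \<le> T" "a \<longlonglongrightarrow> u"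
    have u: "u \<in> {S..T}" using *(1-4)[of 0] by auto
    have "a n \<in> {S..T}" for n using *(1,2)[of n] u by auto
    then show "(\<lambda>n. f (a n)) \<longlonglongrightarrow> f u"
      using u by (intro continuous_on_tendsto_compose[OF f *(5)]) auto
  qed (use B in auto)
  moreover have "integral {grid S T n k..grid S T n (Suc k)} (\<lambda>u. f (grid S T n k)) =
      ((T - S) / real (Suc n)) *\<^sub>R f (grid S T n k)" for n k
    using grid_diff[of S T n k] monoD[OF grid_mono, of S T k "Suc k" n] \<open>S < T\<close> by (simp del: of_nat_Suc)
  ultimately show ?thesis by (simp only:)
qed

subsection \<open>Right-continuous paths with left limits\<close>

text \<open>The filter \<open>at_right t\<close> ignores \<open>t\<close>, whereas the sequence may
  hit it. Passing to the closed half line covers both.\<close>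

lemma tendsto_right_sequence:
  fixes f :: "real \<Rightarrow> 'a::metric_space"
  assumes "continuous (at_right t) f" "X \<longlonglongrightarrow> t" "\<And>n. t \<le> X n"
  shows "(\<lambda>n. f (X n)) \<longlonglongrightarrow> f t"
proof -
  have "at_right t = at t within {t..}"
  proof -
    have "{t<..} - {t} = {t..} - {t}" by auto
    then show ?thesis by (simp add: at_within_def)
  qed
  then have "continuous (at t within {t..}) f" using assms(1) by simp
  then show ?thesis
    using assms(2,3) unfolding continuous_within_sequentially by (auto simp: comp_def)
qed

text \<open>The one-sided limits bound the path near every point of [0, T], and compactness leaves
  finitely many of these local bounds.\<close>

lemma cadlag_bounded:
  fixes f :: "real \<Rightarrow> 'a::real_normed_vector"
  assumes "cadlag f"
  obtains B where "0 \<le> B" "\<And>t. \<lbrakk>0 \<le> t; t \<le> T\<rbrakk> \<Longrightarrow> norm (f t) \<le> B"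
proof -
  have "\<exists>d>0. \<exists>B\<ge>0. \<forall>u\<in>ball x d \<inter> {0..}. norm (f u) \<le> B" if "0 \<le> x" for x
  proof -
    have "(f \<longlongrightarrow> f x) (at_right x)"
      using assms that by (simp add: cadlag_def continuous_within)
    then have "\<forall>\<^sub>F u in at_right x. dist (f u) (f x) < 1" by (rule tendstoD) simp
    then obtain b where b: "b > x" "\<And>u. x < u \<Longrightarrow> u < b \<Longrightarrow> dist (f u) (f x) < 1"
      unfolding eventually_at_right_field by auto
    have "\<exists>a<x. \<exists>C\<ge>0. \<forall>u. a < u \<longrightarrow> u < x \<longrightarrow> 0 \<le> u \<longrightarrow> norm (f u) \<le> C"
    proof (cases "x = 0")
      case True
      \<comment> \<open>No nonnegative time lies to the left of 0, so any negative number and the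
        bound 0 will do.\<close>
      then show ?thesis by (intro exI[of _ "-1"] conjI exI[of _ 0]) auto
    next
      case False
      then have "0 < x" using that by simp
      then obtain m where "(f \<longlongrightarrow> m) (at_left x)" using assms unfolding cadlag_def by blast
      then have "\<forall>\<^sub>F u in at_left x. dist (f u) m < 1" by (rule tendstoD) simp
      then obtain a where a: "a < x" "\<And>u. a < u \<Longrightarrow> u < x \<Longrightarrow> dist (f u) m < 1"
        unfolding eventually_at_left_field by auto
      have "norm (f u) \<le> norm m + 1" if "a < u" "u < x" for u
        using a(2)[OF that] norm_triangle_ineq2[of "f u" m] by (simp add: dist_norm)
      with a(1) show ?thesis by (intro exI[of _ a] conjI exI[of _ "norm m + 1"]) auto
    qed
    then obtain a C where a: "a < x" "C \<ge> 0" "\<And>u. a < u \<Longrightarrow> u < x \<Longrightarrow> 0 \<le> u \<Longrightarrow> norm (f u) \<le> C" by blast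
    let ?d = "min (x - a) (b - x)"
    have "norm (f u) \<le> max C (norm (f x) + 1)" if "u \<in> ball x ?d \<inter> {0..}" for u
    proof -
      have u: "a < u" "u < b" "0 \<le> u" using that by (auto simp: dist_real_def)
      consider "u < x" | "u = x" | "u > x" by linarith
      then show ?thesis
      proof cases
        case 3
        then show ?thesis
          using b(2)[of u] u norm_triangle_ineq2[of "f u" "f x"] by (simp add: dist_norm)
      qed (use a u in \<open>auto simp: le_max_iff_disj\<close>)
    qed
    then show ?thesis using a(1,2) b(1) by (intro exI[of _ ?d] conjI exI[of _ "max C (norm (f x) + 1)"]) auto
  qed
  then obtain d where d: "\<And>x. 0 \<le> x \<Longrightarrow> d x > 0 \<and> (\<exists>B\<ge>0. \<forall>u\<in>ball x (d x) \<inter> {0..}. norm (f u) \<le> B)"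
    by metis
  then obtain C where C: "\<And>x. 0 \<le> x \<Longrightarrow> C x \<ge> 0 \<and> (\<forall>u\<in>ball x (d x) \<inter> {0..}. norm (f u) \<le> C x)"
    by metis
  obtain D where D: "D \<subseteq> {0..T}" "finite D" "{0..T} \<subseteq> (\<Union>x\<in>D. ball x (d x))"
    by (rule compactE_image[of "{0..T}" "{0..T}" "\<lambda>x. ball x (d x)"]) (use d in auto)
  \<comment> \<open>The sum replaces the maximum of the local bounds, because \<open>D\<close> is
    empty when \<open>T < 0\<close>.\<close>
  have "norm (f t) \<le> (\<Sum>x\<in>D. C x)" if "0 \<le> t" "t \<le> T" for t
  proof -
    have "t \<in> (\<Union>x\<in>D. ball x (d x))" using D(3) that by (meson atLeastAtMost_iff subsetD)
    then obtain x where x: "x \<in> D" "t \<in> ball x (d x)" by blast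
    then have "norm (f t) \<le> C x" using C[of x] D(1) that by auto
    also have "\<dots> \<le> (\<Sum>x\<in>D. C x)"
      using D C x by (intro member_le_sum) auto
    finally show ?thesis .
  qed
  moreover have "0 \<le> (\<Sum>x\<in>D. C x)" using D C by (intro sum_nonneg) auto
  ultimately show ?thesis using that by blast
qed

subsection \<open>The solution of the Ornstein-Uhlenbeck equation\<close>

text \<open>Summation by parts with the values of \<open>y\<close> at right end points: the error terms then converge
  pointwise by right continuity alone.\<close>

lemma OU_path_sum_tendsto:
  fixes y L :: "real \<Rightarrow> 'a::euclidean_space"
  assumes L: "cadlag L" and l: "l > 0"
    and eq: "\<And>t. 0 \<le> t \<Longrightarrow> set_integrable lborel {0..t} y \<and> y t = y 0 - l *\<^sub>R (LBINT s:{0..t}. y s) + L t"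
    and S: "0 \<le> S" "S \<le> T"
  shows "(\<lambda>n. \<Sum>k<Suc n. exp (l * grid S T n k) *\<^sub>R (L (grid S T n (Suc k)) - L (grid S T n k)))
    \<longlonglongrightarrow> exp (l * T) *\<^sub>R y T - exp (l * S) *\<^sub>R y S"
proof (cases "S = T")
  case True
  then show ?thesis by (simp add: grid_def)
next
  case False
  then have ST: "S < T" using S by simp
  have int: "y integrable_on {0..t}" and yt: "y t = y 0 - l *\<^sub>R integral {0..t} y + L t" if "0 \<le> t" for t
    using eq[OF that] set_borel_integral_eq_integral[of "{0..t}" y] by auto
  have inti: "y integrable_on {a..b}" if "0 \<le> a" for a b
    using int[of b] that by (cases "0 \<le> b") (auto intro: integrable_on_subinterval)
  have cont: "continuous_on {0..t} (\<lambda>t. integral {0..t} y)" if "0 \<le> t" for t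
    by (rule indefinite_integral_continuous_1[OF int[OF that]])
  obtain B1 where B1: "0 \<le> B1" "\<And>t. \<lbrakk>0 \<le> t; t \<le> T\<rbrakk> \<Longrightarrow> norm (L t) \<le> B1" by (rule cadlag_bounded[OF L, of T]) blast
  have "bounded ((\<lambda>t. integral {0..t} y) ` {0..T})"
    using S by (intro compact_imp_bounded compact_continuous_image cont) auto
  then obtain B2 where "\<forall>t\<in>{0..T}. norm (integral {0..t} y) \<le> B2"
    by (auto simp: bounded_iff)
  then have B2: "\<And>t. \<lbrakk>0 \<le> t; t \<le> T\<rbrakk> \<Longrightarrow> norm (integral {0..t} y) \<le> B2" by simp
  define B where "B = norm (y 0) + l * B2 + B1"
  have B: "norm (y t) \<le> B" if "0 \<le> t" "t \<le> T" for t
  proof -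
    have "norm (y t) \<le> norm (y 0) + norm (l *\<^sub>R integral {0..t} y) + norm (L t)"
      by (subst yt[OF that(1)]) (smt (verit) norm_triangle_ineq norm_triangle_ineq4)
    also have "norm (l *\<^sub>R integral {0..t} y) \<le> l * B2" using B2[OF that] l by simp
    finally show ?thesis using B1(2)[OF that] by (simp add: B_def)
  qed
  have B0: "0 \<le> B" using B[of S] S norm_ge_zero order_trans by blast
  \<comment> \<open>The path \<open>y\<close> inherits right continuity from \<open>L\<close>, since
    the integral term of the equation is continuous.\<close>
  have rc: "(\<lambda>n. y (b n)) \<longlonglongrightarrow> y u" if "0 \<le> u" "\<And>n. u \<le> b n" "\<And>n. b n \<le> T" "b \<longlonglongrightarrow> u" for u and b :: "nat \<Rightarrow> real"
  proof -
    have u: "u \<le> T" using that order_trans by blast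
    have "(\<lambda>n. integral {0..b n} y) \<longlonglongrightarrow> integral {0..u} y"
    proof -
      have "\<forall>n. b n \<in> {0..T}" using that(1-3) order_trans by (metis atLeastAtMost_iff)
      moreover have "u \<in> {0..T}" using that u by simp
      ultimately show ?thesis
        using u that(1) by (intro continuous_on_tendsto_compose[OF cont[of T] that(4)]) auto
    qed
    moreover have "(\<lambda>n. L (b n)) \<longlonglongrightarrow> L u"
    proof (rule tendsto_right_sequence[OF _ that(4,2)])
      show "continuous (at_right u) L" using L that(1) unfolding cadlag_def by blast
    qed
    ultimately have "(\<lambda>n. y 0 - l *\<^sub>R integral {0..b n} y + L (b n)) \<longlonglongrightarrow> y 0 - l *\<^sub>R integral {0..u} y + L u"
      by (intro tendsto_intros)
    then show ?thesis
      using yt[OF that(1)] yt[OF order_trans[OF that(1,2)]] by simp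
  qed
  \<comment> \<open>The integral of \<open>G a b\<close> over a cell is the error of the summation
    by parts: the first term comes from the increment of exp (l u) times \<open>y b\<close>, the
    second from the drift of the equation. As both end points tend to u the two terms
    cancel.\<close>
  define G where "G a b u = (l * exp (l * u)) *\<^sub>R y b - (l * exp (l * a)) *\<^sub>R y u" for a b u
  have expint: "((\<lambda>u. l * exp (l * u)) has_integral exp (l * b) - exp (l * a)) {a..b}" if "a \<le> b" for a b
    using that by (intro fundamental_theorem_of_calculus)
      (auto intro!: derivative_eq_intros simp: has_real_derivative_iff_has_vector_derivative[symmetric])
  have Gint: "(G a b has_integral (exp (l * b) - exp (l * a)) *\<^sub>R y b - (l * exp (l * a)) *\<^sub>R integral {a..b} y) {a..b}"
    if "0 \<le> a" "a \<le> b" for a b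
    unfolding G_def
    by (intro has_integral_diff has_integral_scaleR_left expint has_integral_cmul integrable_integral inti that)
  have "(\<lambda>n. \<Sum>k<Suc n. integral {grid S T n k..grid S T n (Suc k)} (G (grid S T n k) (grid S T n (Suc k))))
    \<longlonglongrightarrow> integral {S..T} (\<lambda>_. 0)"
  proof (rule riemann_sum_tendsto[OF ST, where B="2 * (l * exp (l * T) * B)"])
    fix a b assume "S \<le> a" "a \<le> b" "b \<le> T"
    then show "G a b integrable_on {a..b}" using Gint[of a b] S by auto
  next
    fix a b u assume *: "S \<le> a" "a \<le> u" "u \<le> b" "b \<le> T"
    have "norm (G a b u) \<le> norm ((l * exp (l * u)) *\<^sub>R y b) + norm ((l * exp (l * a)) *\<^sub>R y u)"
      unfolding G_def by (rule norm_triangle_ineq4)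
    also have "\<dots> \<le> l * exp (l * T) * B + l * exp (l * T) * B"
    proof (rule add_mono)
      show "norm ((l * exp (l * u)) *\<^sub>R y b) \<le> l * exp (l * T) * B"
        using * l S B[of b] by (simp add: abs_mult) (intro mult_mono, auto)
      show "norm ((l * exp (l * a)) *\<^sub>R y u) \<le> l * exp (l * T) * B"
        using * l S B[of u] by (simp add: abs_mult) (intro mult_mono, auto)
    qed
    finally show "norm (G a b u) \<le> 2 * (l * exp (l * T) * B)" unfolding mult_2 .
  next
    fix a b and u :: real
    assume *: "\<And>n::nat. S \<le> a n" "\<And>n. a n \<le> u" "\<And>n. u \<le> b n" "\<And>n. b n \<le> T" "a \<longlonglongrightarrow> u" "b \<longlonglongrightarrow> u"
    have "0 \<le> u" using *(1)[of 0] *(2)[of 0] S(1) by linarith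
    have "(\<lambda>n. G (a n) (b n) u) \<longlonglongrightarrow> (l * exp (l * u)) *\<^sub>R y u - (l * exp (l * u)) *\<^sub>R y u"
      unfolding G_def using \<open>0 \<le> u\<close> *(3-6) by (intro tendsto_intros rc) auto
    then show "(\<lambda>n. G (a n) (b n) u) \<longlonglongrightarrow> 0" by simp
  qed
  then have lim: "(\<lambda>n. \<Sum>k<Suc n. integral {grid S T n k..grid S T n (Suc k)} (G (grid S T n k) (grid S T n (Suc k)))) \<longlonglongrightarrow> 0"
    by simp
  have step: "exp (l * b) *\<^sub>R y b - exp (l * a) *\<^sub>R y a = exp (l * a) *\<^sub>R (L b - L a) + integral {a..b} (G a b)"
    if ab: "0 \<le> a" "a \<le> b" for a b
  proof -
    have "integral {0..b} y = integral {0..a} y + integral {a..b} y"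
      using ab int[of b] by (intro Henstock_Kurzweil_Integration.integral_combine[symmetric]) auto
    moreover have "y b - y a = (y 0 - l *\<^sub>R integral {0..b} y + L b) - (y 0 - l *\<^sub>R integral {0..a} y + L a)"
      using yt[OF ab(1)] yt[OF order_trans[OF ab]] by (rule arg_cong2[of _ _ _ _ minus, rotated])
    ultimately have "y b - y a = L b - L a - l *\<^sub>R integral {a..b} y"
      by (simp add: algebra_simps)
    then have "L b - L a = (y b - y a) + l *\<^sub>R integral {a..b} y"
      by (simp add: algebra_simps)
    then have e: "exp (l * a) *\<^sub>R (L b - L a) = exp (l * a) *\<^sub>R (y b - y a) + (l * exp (l * a)) *\<^sub>R integral {a..b} y"
      by (simp only: scaleR_add_right scaleR_scaleR mult.commute)
    show ?thesis
      unfolding Gint[OF ab, THEN integral_unique] e by (simp add: algebra_simps)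
  qed
  have m: "mono (grid S T n)" for n using S by (intro grid_mono)
  have "(\<Sum>k<Suc n. exp (l * grid S T n k) *\<^sub>R (L (grid S T n (Suc k)) - L (grid S T n k))) =
    (exp (l * T) *\<^sub>R y T - exp (l * S) *\<^sub>R y S) -
      (\<Sum>k<Suc n. integral {grid S T n k..grid S T n (Suc k)} (G (grid S T n k) (grid S T n (Suc k))))" for n
  proof -
    have "(\<Sum>k<Suc n. exp (l * grid S T n (Suc k)) *\<^sub>R y (grid S T n (Suc k)) - exp (l * grid S T n k) *\<^sub>R y (grid S T n k))
       = exp (l * T) *\<^sub>R y T - exp (l * S) *\<^sub>R y S"
      by (subst sum_lessThan_telescope) simp
    moreover have "0 \<le> grid S T n k" "grid S T n k \<le> grid S T n (Suc k)" for k
      using monoD[OF m, of 0 k n] monoD[OF m, of k "Suc k" n] S by auto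
    ultimately show ?thesis
      by (simp add: step sum.distrib eq_diff_eq del: sum.lessThan_Suc)
  qed
  then show ?thesis
    using tendsto_diff[OF tendsto_const lim, of "exp (l * T) *\<^sub>R y T - exp (l * S) *\<^sub>R y S"] by simp
qed

subsection \<open>Characteristic functions of Levy and Ornstein-Uhlenbeck processes\<close>

text \<open>Continuity of \<open>\<psi>\<close> and \<open>\<psi> 0 = 0\<close> make it the
  distinguished logarithm of the characteristic function of L_1, which determines the right branch
  for all fractional times.\<close>

locale levy_exponent =
  fixes M :: "'w measure" and L :: "real \<Rightarrow> 'w \<Rightarrow> 'a::euclidean_space" and \<psi> :: "'a \<Rightarrow> complex"
  assumes levy: "levy_process M L" and cont: "continuous_on UNIV \<psi>" and zero: "\<psi> 0 = 0"
    and one: "\<And>z. charfun (distr M borel (L 1)) z = exp (\<psi> z)"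
begin

sublocale prob_space M
  using levy by (simp add: levy_process_def)

lemma rv [measurable]: "0 \<le> t \<Longrightarrow> L t \<in> borel_measurable M"
  using levy by (simp add: levy_process_def)

lemma increments_charfun:
  fixes \<tau> :: "nat \<Rightarrow> real" and w :: "nat \<Rightarrow> 'a"
  assumes \<tau>: "0 \<le> \<tau> 0" "mono \<tau>"
  shows "(CLINT \<omega>|M. (\<Prod>i<n. iexp ((L (\<tau> (Suc i)) \<omega> - L (\<tau> i) \<omega>) \<bullet> w i))) =
    (\<Prod>i<n. charfun (distr M borel (L (\<tau> (Suc i) - \<tau> i))) (w i))"
proof -
  have \<tau>0: "0 \<le> \<tau> i" "\<tau> i \<le> \<tau> (Suc i)" for i
    using \<tau> monoD[OF \<tau>(2), of 0 i] monoD[OF \<tau>(2), of i "Suc i"] by auto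
  have ind: "indep_vars (\<lambda>_. borel) (\<lambda>i \<omega>. L (\<tau> (Suc i)) \<omega> - L (\<tau> i) \<omega>) {..<n}"
    using levy \<tau> by (simp add: levy_process_def)
  have m: "(\<lambda>\<omega>. L (\<tau> (Suc i)) \<omega> - L (\<tau> i) \<omega>) \<in> borel_measurable M" for i
    using \<tau>0(1)[of i] \<tau>0(1)[of "Suc i"] by measurable
  have "(CLINT \<omega>|M. (\<Prod>i<n. iexp ((L (\<tau> (Suc i)) \<omega> - L (\<tau> i) \<omega>) \<bullet> w i))) =
    (\<Prod>i<n. CLINT \<omega>|M. iexp ((L (\<tau> (Suc i)) \<omega> - L (\<tau> i) \<omega>) \<bullet> w i))"
  proof (rule indep_vars_lebesgue_integral)
    show "indep_vars (\<lambda>_. borel) (\<lambda>i \<omega>. iexp ((L (\<tau> (Suc i)) \<omega> - L (\<tau> i) \<omega>) \<bullet> w i)) {..<n}"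
      by (rule indep_vars_compose2[OF ind]) measurable
  qed (use m in \<open>auto intro!: integrable_iexp_real\<close>)
  also have "\<dots> = (\<Prod>i<n. charfun (distr M borel (L (\<tau> (Suc i) - \<tau> i))) (w i))"
  proof (intro prod.cong refl)
    fix i
    have "distr M borel (\<lambda>\<omega>. L (\<tau> i + (\<tau> (Suc i) - \<tau> i)) \<omega> - L (\<tau> i) \<omega>) = distr M borel (L (\<tau> (Suc i) - \<tau> i))"
      using levy \<tau>0[of i] unfolding levy_process_def by (meson diff_ge_0_iff_ge)
    then have "charfun (distr M borel (\<lambda>\<omega>. L (\<tau> (Suc i)) \<omega> - L (\<tau> i) \<omega>)) (w i) =
        charfun (distr M borel (L (\<tau> (Suc i) - \<tau> i))) (w i)" by simp
    then show "(CLINT \<omega>|M. iexp ((L (\<tau> (Suc i)) \<omega> - L (\<tau> i) \<omega>) \<bullet> w i)) =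
        charfun (distr M borel (L (\<tau> (Suc i) - \<tau> i))) (w i)"
      using m by (simp add: charfun_distr)
  qed
  finally show ?thesis .
qed

lemma charfun_multiple:
  assumes "0 \<le> h"
  shows "charfun (distr M borel (L (real k * h))) z = charfun (distr M borel (L h)) z ^ k"
proof -
  have "charfun (distr M borel (L (real k * h))) z =
     (CLINT \<omega>|M. (\<Prod>i<k. iexp ((L (real (Suc i) * h) \<omega> - L (real i * h) \<omega>) \<bullet> z)))"
  proof -
    have "AE \<omega> in M. L 0 \<omega> = 0" using levy by (simp add: levy_process_def)
    then have "AE \<omega> in M. iexp (L (real k * h) \<omega> \<bullet> z) =
        (\<Prod>i<k. iexp ((L (real (Suc i) * h) \<omega> - L (real i * h) \<omega>) \<bullet> z))"
    proof eventually_elim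
      case (elim \<omega>)
      have "(\<Prod>i<k. iexp ((L (real (Suc i) * h) \<omega> - L (real i * h) \<omega>) \<bullet> z)) =
          iexp (\<Sum>i<k. (L (real (Suc i) * h) \<omega> - L (real i * h) \<omega>) \<bullet> z)"
        by (simp only: of_real_sum sum_distrib_left exp_sum finite_lessThan)
      also have "(\<Sum>i<k. (L (real (Suc i) * h) \<omega> - L (real i * h) \<omega>) \<bullet> z) = (L (real k * h) \<omega> - L (real 0 * h) \<omega>) \<bullet> z"
        unfolding inner_sum_left[symmetric] sum_lessThan_telescope[of "\<lambda>i. L (real i * h) \<omega>"] ..
      finally show ?case using elim by simp
    qed
    then show ?thesis
      using assms by (subst charfun_distr) (auto intro!: integral_cong_AE)
  qed
  also have "\<dots> = charfun (distr M borel (L h)) z ^ k"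
    using assms by (subst increments_charfun[of "\<lambda>i. real i * h"])
      (auto intro!: monoI mult_left_mono simp: algebra_simps)
  finally show ?thesis .
qed

text \<open>The quotient of two continuous \<open>n\<close>-th roots of the same function is a continuous map into
  a finite set, so the two roots agree as soon as they agree at \<open>0\<close>.\<close>

lemma charfun_root: "charfun (distr M borel (L (1 / real (Suc n)))) z = exp (\<psi> z / of_nat (Suc n))"
proof -
  let ?\<phi> = "charfun (distr M borel (L (1 / real (Suc n))))"
  define f where "f z = ?\<phi> z / exp (\<psi> z / of_nat (Suc n))" for z
  have ps: "prob_space (distr M borel (L (1 / real (Suc n))))" by (rule prob_space_distr) simp
  have root: "f z ^ Suc n = 1" for z
  proof -
    have "?\<phi> z ^ Suc n = exp (\<psi> z)"
      using charfun_multiple[of "1 / real (Suc n)" "Suc n" z] one[of z] by (simp del: of_nat_Suc power_Suc)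
    moreover have "exp (\<psi> z / of_nat (Suc n)) ^ Suc n = exp (\<psi> z)"
      by (simp del: of_nat_Suc power_Suc flip: exp_of_nat_mult)
    ultimately show ?thesis by (simp add: f_def power_divide del: power_Suc)
  qed
  have "f constant_on UNIV"
  proof (rule continuous_finite_range_constant)
    show "continuous_on UNIV f"
      unfolding f_def using ps
      by (intro continuous_intros continuous_charfun cont prob_space.finite_measure) (auto simp del: of_nat_Suc)
    show "finite (range f)"
      by (rule finite_subset[of _ "{x. x ^ Suc n = 1}"])
         (use root in \<open>auto intro!: finite_roots_unity simp del: power_Suc\<close>)
  qed (rule connected_UNIV)
  moreover have "f 0 = 1"
    using ps by (simp add: f_def charfun_0 zero)
  ultimately have "f z = 1" by (metis UNIV_I constant_on_def)
  then show ?thesis by (simp add: f_def)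
qed

text \<open>Multiples of 1 / \<open>Suc n\<close> are settled by powers of the roots. A general time
  h is approached by the least such multiple that is not below h, because the paths are only known
  to be continuous from the right.\<close>

lemma charfun_time:
  assumes "0 \<le> h"
  shows "charfun (distr M borel (L h)) z = exp (of_real h * \<psi> z)"
proof -
  define X where "X n = real (nat \<lceil>h * real (Suc n)\<rceil>) * (1 / real (Suc n))" for n
  have X0: "0 \<le> h * real (Suc n)" for n using assms by simp
  have Xh: "h \<le> X n" "X n \<le> h + 1 / real (Suc n)" for n
  proof -
    have "h * real (Suc n) \<le> real (nat \<lceil>h * real (Suc n)\<rceil>)"
      "real (nat \<lceil>h * real (Suc n)\<rceil>) \<le> h * real (Suc n) + 1" using X0[of n] by linarith+
    then show "h \<le> X n" "X n \<le> h + 1 / real (Suc n)"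
      using divide_right_mono[of "real (nat \<lceil>h * real (Suc n)\<rceil>)" "h * real (Suc n) + 1" "real (Suc n)"]
      unfolding X_def by (simp_all add: pos_le_divide_eq add_divide_distrib del: of_nat_Suc)
  qed
  have Xlim: "X \<longlonglongrightarrow> h"
  proof (rule tendsto_sandwich[of "\<lambda>_. h" _ _ "\<lambda>n. h + 1 / real (Suc n)"])
    show "(\<lambda>n. h + 1 / real (Suc n)) \<longlonglongrightarrow> h" by real_asymp
  qed (use Xh in \<open>auto intro!: always_eventually\<close>)
  have "charfun (distr M borel (L (X n))) z = exp (of_real (X n) * \<psi> z)" for n
    unfolding X_def by (subst charfun_multiple) (simp_all add: charfun_root exp_of_nat_mult[symmetric] del: of_nat_Suc)
  then have 1: "(\<lambda>n. charfun (distr M borel (L (X n))) z) \<longlonglongrightarrow> exp (of_real h * \<psi> z)"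
    by (simp, intro tendsto_intros Xlim)
  have "(\<lambda>n. CLINT \<omega>|M. iexp (L (X n) \<omega> \<bullet> z)) \<longlonglongrightarrow> (CLINT \<omega>|M. iexp (L h \<omega> \<bullet> z))"
  proof (rule integral_dominated_convergence[where w="\<lambda>_. 1"])
    have "AE \<omega> in M. cadlag (\<lambda>t. L t \<omega>)" using levy by (simp add: levy_process_def)
    then show "AE \<omega> in M. (\<lambda>n. iexp (L (X n) \<omega> \<bullet> z)) \<longlonglongrightarrow> iexp (L h \<omega> \<bullet> z)"
    proof eventually_elim
      case (elim \<omega>)
      then have "(\<lambda>n. L (X n) \<omega>) \<longlonglongrightarrow> L h \<omega>"
        using assms Xlim Xh by (intro tendsto_right_sequence[of h "\<lambda>t. L t \<omega>"]) (auto simp: cadlag_def)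
      then show ?case by (intro tendsto_intros)
    qed
  qed (use assms Xh order_trans[OF assms Xh(1)] in auto)
  then have "(\<lambda>n. charfun (distr M borel (L (X n))) z) \<longlonglongrightarrow> charfun (distr M borel (L h)) z"
    using assms order_trans[OF assms Xh(1)] by (simp add: charfun_distr)
  with 1 show ?thesis by (rule LIMSEQ_unique[symmetric])
qed

text \<open>The product form of the joint characteristic function says that the innovation over
  [s, s + t] is independent of Y_s. It is inherited from approximations by finite sums: those of Y_s
  involve Y_0 and increments up to time s, those of the innovation only increments after s.\<close>

lemma OU_transition_charfun:
  assumes OU: "OU_process M l L Y" and s: "0 \<le> s" and t: "0 < t"
  shows "(CLINT \<omega>|M. iexp (Y s \<omega> \<bullet> u + (Y (s + t) \<omega> - exp (- l * t) *\<^sub>R Y s \<omega>) \<bullet> v)) =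
    (CLINT \<omega>|M. iexp (Y s \<omega> \<bullet> u)) * exp (integral {0..t} (\<lambda>r. \<psi> (exp (- l * (t - r)) *\<^sub>R v)))"
proof -
  have l: "l > 0" and Ym [measurable]: "\<And>t. 0 \<le> t \<Longrightarrow> Y t \<in> borel_measurable M"
    and ind: "indep_set (sets (vimage_algebra (space M) (Y 0) borel))
       (sets (vimage_algebra (space M) (\<lambda>\<omega>. \<lambda>t\<in>{0..}. L t \<omega>) (PiM {0..} (\<lambda>_. borel))))"
    and path: "AE \<omega> in M. \<forall>t\<ge>0. set_integrable lborel {0..t} (\<lambda>s. Y s \<omega>) \<and>
        Y t \<omega> = Y 0 \<omega> - l *\<^sub>R (LBINT s:{0..t}. Y s \<omega>) + L t \<omega>"
    using OU by (auto simp: OU_process_def)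
  let ?D = "\<lambda>S T n k \<omega>. L (grid S T n (Suc k)) \<omega> - L (grid S T n k) \<omega>"
  define P where "P n \<omega> = exp (- l * s) *\<^sub>R (Y 0 \<omega> + (\<Sum>k<Suc n. exp (l * grid 0 s n k) *\<^sub>R ?D 0 s n k \<omega>))" for n \<omega>
  define Q where "Q n \<omega> = exp (- l * (s + t)) *\<^sub>R (\<Sum>k<Suc n. exp (l * grid s (s + t) n k) *\<^sub>R ?D s (s + t) n k \<omega>)" for n \<omega>
  have cad: "AE \<omega> in M. cadlag (\<lambda>t. L t \<omega>)" using levy by (simp add: levy_process_def)
  have PQ: "AE \<omega> in M. (\<lambda>n. P n \<omega>) \<longlonglongrightarrow> Y s \<omega> \<and> (\<lambda>n. Q n \<omega>) \<longlonglongrightarrow> Y (s + t) \<omega> - exp (- l * t) *\<^sub>R Y s \<omega>"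
    using path cad
  proof eventually_elim
    case (elim \<omega>)
    note lim = OU_path_sum_tendsto[OF elim(2) l elim(1)[rule_format]]
    have "(\<lambda>n. P n \<omega>) \<longlonglongrightarrow> exp (- l * s) *\<^sub>R (Y 0 \<omega> + (exp (l * s) *\<^sub>R Y s \<omega> - exp (l * 0) *\<^sub>R Y 0 \<omega>))"
      unfolding P_def using s by (intro tendsto_intros lim) auto
    moreover have "(\<lambda>n. Q n \<omega>) \<longlonglongrightarrow> exp (- l * (s + t)) *\<^sub>R (exp (l * (s + t)) *\<^sub>R Y (s + t) \<omega> - exp (l * s) *\<^sub>R Y s \<omega>)"
      unfolding Q_def using s t by (intro tendsto_intros lim) auto
    ultimately show ?case
      by (simp add: scaleR_diff_right mult_exp_exp distrib_left)
  qed
  have g0: "0 \<le> grid 0 s n k" "0 \<le> grid s (s + t) n k" for n k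
    using s t by (auto simp: grid_def)
  have [measurable]: "L (grid 0 s n k) \<in> borel_measurable M" "L (grid s (s + t) n k) \<in> borel_measurable M" for n k
    by (intro rv g0)+
  have [measurable]: "P n \<in> borel_measurable M" "Q n \<in> borel_measurable M" for n
    unfolding P_def[abs_def] Q_def[abs_def] by measurable
  define pr where "pr n v = (\<Prod>k<Suc n. exp (of_real (t / real (Suc n)) * \<psi> (exp (- l * (t - grid 0 t n k)) *\<^sub>R v)))" for n v
  have fac: "(CLINT \<omega>|M. iexp (P n \<omega> \<bullet> u + Q n \<omega> \<bullet> v)) =
      (CLINT \<omega>|M. iexp (Y 0 \<omega> \<bullet> (exp (- l * s) *\<^sub>R u))) *
      (\<Prod>k<Suc n. exp (of_real (s / real (Suc n)) * \<psi> ((exp (- l * s) * exp (l * grid 0 s n k)) *\<^sub>R u))) * pr n v" for n v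
  proof -
    define m where "m = Suc n"
    \<comment> \<open>The two grids are joined at time s into one increasing sequence, so that
      independence of increments is applied once to all 2 m increments.\<close>
    define \<tau> where "\<tau> i = (if i \<le> m then grid 0 s n i else grid s (s + t) n (i - m))" for i
    define w where "w i = (if i < m then (exp (- l * s) * exp (l * grid 0 s n i)) *\<^sub>R u
      else (exp (- l * (s + t)) * exp (l * grid s (s + t) n (i - m))) *\<^sub>R v)" for i
    have \<tau>m: "mono \<tau>"
      unfolding mono_iff_le_Suc
    proof
      fix i
      consider "Suc i \<le> m" | "i = m" | "i > m" by linarith
      then show "\<tau> i \<le> \<tau> (Suc i)"
      proof cases
        case 1 then show ?thesis using monoD[OF grid_mono[OF s], of i "Suc i" n] by (simp add: \<tau>_def)
      next
        case 2 then show ?thesis using monoD[OF grid_mono[of s "s + t"], of 0 "Suc 0" n] t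
          by (simp add: \<tau>_def m_def)
      next
        case 3 then show ?thesis using monoD[OF grid_mono[of s "s + t"], of "i - m" "Suc i - m" n] t
          by (simp add: \<tau>_def)
      qed
    qed
    have \<tau>0: "0 \<le> \<tau> i" for i using g0 by (simp add: \<tau>_def)
    have \<tau>1: "\<tau> i = grid 0 s n i" "\<tau> (Suc i) = grid 0 s n (Suc i)" if "i < m" for i
      using that by (auto simp: \<tau>_def)
    have \<tau>2: "\<tau> (m + i) = grid s (s + t) n i" "\<tau> (Suc (m + i)) = grid s (s + t) n (Suc i)" for i
      by (auto simp: \<tau>_def m_def)
    have split: "(\<Sum>i<m + m. f i) = (\<Sum>i<m. f i) + (\<Sum>i<m. f (m + i))" for f :: "nat \<Rightarrow> real"
      by (simp add: lessThan_atLeast0 sum.atLeastLessThan_concat[of 0 m "m + m", symmetric]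
          sum.shift_bounds_nat_ivl[of f 0 m m, simplified] add.commute)
    have splitp: "(\<Prod>i<m + m. f i) = (\<Prod>i<m. f i) * (\<Prod>i<m. f (m + i))" for f :: "nat \<Rightarrow> complex"
      by (simp add: lessThan_atLeast0 prod.atLeastLessThan_concat[of 0 m "m + m", symmetric]
          prod.shift_bounds_nat_ivl[of f 0 m m, simplified] add.commute)
    have e: "P n \<omega> \<bullet> u + Q n \<omega> \<bullet> v = Y 0 \<omega> \<bullet> (exp (- l * s) *\<^sub>R u) +
       (\<Sum>i<m + m. (L (\<tau> (Suc i)) \<omega> - L (\<tau> i) \<omega>) \<bullet> w i)" for \<omega>
      unfolding split P_def Q_def m_def[symmetric]
      by (simp add: \<tau>1 \<tau>2 w_def inner_add_left inner_sum_left sum_distrib_left mult.assoc distrib_left)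
    let ?X1 = "\<lambda>\<omega>. iexp (Y 0 \<omega> \<bullet> (exp (- l * s) *\<^sub>R u))"
    let ?X2 = "\<lambda>\<omega>. \<Prod>i<m + m. iexp ((L (\<tau> (Suc i)) \<omega> - L (\<tau> i) \<omega>) \<bullet> w i)"
    have [measurable]: "L (\<tau> i) \<in> borel_measurable M" for i by (rule rv) (rule \<tau>0)
    have X2: "integrable M ?X2"
      by (rule integrable_const_bound[of _ 1]) (auto simp: prod_norm[symmetric])
    have X1: "integrable M ?X1" by (rule integrable_iexp_real) simp
    \<comment> \<open>\<open>?X1\<close> is a function of Y_0 and \<open>?X2\<close> of finitely
      many values of \<open>L\<close>, so their sigma-algebras lie inside the two that are
      independent in \<open>OU_process\<close>.\<close>
    have iv: "indep_var borel ?X1 borel ?X2"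
      unfolding indep_var_eq
    proof (intro conjI)
      have "sigma_sets (space M) {?X1 -` A \<inter> space M |A. A \<in> sets borel}
          \<subseteq> sets (vimage_algebra (space M) (Y 0) borel)"
      proof -
        let ?V = "vimage_algebra (space M) (Y 0) borel"
        have "?X1 -` A \<inter> space M \<in> sets ?V" if "A \<in> sets borel" for A
        proof -
          have "(\<lambda>y. iexp (y \<bullet> (exp (- l * s) *\<^sub>R u))) -` A \<inter> space borel \<in> sets borel"
            by (rule measurable_sets[OF _ that]) simp
          from in_vimage_algebra[OF this, of "Y 0" "space M"] show ?thesis
            by (simp add: vimage_def Int_def conj_commute)
        qed
        then show ?thesis
          using sets.sigma_sets_subset[of "{?X1 -` A \<inter> space M |A. A \<in> sets borel}" ?V] by auto
      qed
      moreover have "sigma_sets (space M) {?X2 -` A \<inter> space M |A. A \<in> sets borel}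
          \<subseteq> sets (vimage_algebra (space M) (\<lambda>\<omega>. \<lambda>t\<in>{0..}. L t \<omega>) (PiM {0..} (\<lambda>_. borel)))"
      proof -
        let ?V = "vimage_algebra (space M) (\<lambda>\<omega>. \<lambda>t\<in>{0..}. L t \<omega>) (PiM {0..} (\<lambda>_. borel))"
        have "?X2 -` A \<inter> space M \<in> sets ?V" if "A \<in> sets borel" for A
        proof -
          have "(\<lambda>f. \<Prod>i<m + m. iexp ((f (\<tau> (Suc i)) - f (\<tau> i)) \<bullet> w i)) -` A \<inter> space (PiM {0..} (\<lambda>_. borel))
            \<in> sets (PiM {0..} (\<lambda>_. borel))"
            using \<tau>0 by (intro measurable_sets[OF _ that]) measurable
          from in_vimage_algebra[OF this, of "\<lambda>\<omega>. \<lambda>t\<in>{0..}. L t \<omega>" "space M"] show ?thesis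
            using \<tau>0 by (simp add: vimage_def Int_def conj_commute space_PiM)
        qed
        then show ?thesis
          using sets.sigma_sets_subset[of "{?X2 -` A \<inter> space M |A. A \<in> sets borel}" ?V] by auto
      qed
      ultimately show "indep_set (sigma_sets (space M) {?X1 -` A \<inter> space M |A. A \<in> sets borel})
          (sigma_sets (space M) {?X2 -` A \<inter> space M |A. A \<in> sets borel})"
        using ind unfolding indep_set_def
        by (elim indep_sets_mono_sets) (auto split: bool.split)
    qed (use X1 X2 in auto)
    have "(CLINT \<omega>|M. iexp (P n \<omega> \<bullet> u + Q n \<omega> \<bullet> v)) = (CLINT \<omega>|M. ?X1 \<omega> * ?X2 \<omega>)"
      unfolding e of_real_add distrib_left exp_add of_real_sum sum_distrib_left
      by (simp only: exp_sum finite_lessThan)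
    also have "\<dots> = (CLINT \<omega>|M. ?X1 \<omega>) * (CLINT \<omega>|M. ?X2 \<omega>)"
      by (rule indep_var_lebesgue_integral[OF iv X1 X2])
    also have "(CLINT \<omega>|M. ?X2 \<omega>) = (\<Prod>i<m + m. exp (of_real (\<tau> (Suc i) - \<tau> i) * \<psi> (w i)))"
      using \<tau>0 \<tau>m by (subst increments_charfun) (auto simp: charfun_time mono_iff_le_Suc)
    also have "\<dots> = (\<Prod>k<m. exp (of_real (s / real m) * \<psi> ((exp (- l * s) * exp (l * grid 0 s n k)) *\<^sub>R u))) * pr n v"
    proof -
      have "(\<Prod>i<m. exp (of_real (\<tau> (Suc i) - \<tau> i) * \<psi> (w i))) =
          (\<Prod>k<m. exp (of_real (s / real m) * \<psi> ((exp (- l * s) * exp (l * grid 0 s n k)) *\<^sub>R u)))"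
        by (intro prod.cong refl) (simp add: \<tau>1 w_def grid_diff m_def del: of_nat_Suc)
      moreover have "(\<Prod>i<m. exp (of_real (\<tau> (Suc (m + i)) - \<tau> (m + i)) * \<psi> (w (m + i)))) = pr n v"
      proof -
        have "exp (- l * (s + t)) * exp (l * grid s (s + t) n i) = exp (- l * (t - grid 0 t n i))" for i
          by (simp add: grid_def mult_exp_exp algebra_simps)
        then show ?thesis
          unfolding pr_def m_def[symmetric] \<tau>2 grid_diff by (simp add: w_def m_def del: of_nat_Suc)
      qed
      ultimately show ?thesis unfolding splitp by simp
    qed
    finally show ?thesis by (simp add: m_def mult.assoc del: of_nat_Suc prod.lessThan_Suc)
  qed
  \<comment> \<open>Setting v = 0 identifies the factors in front of \<open>pr n v\<close> with the
    characteristic function of \<open>P n\<close>, so their limit need not be computed.\<close>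
  have pr0: "pr n 0 = 1" for n by (simp add: pr_def zero)
  have fac': "(CLINT \<omega>|M. iexp (P n \<omega> \<bullet> u + Q n \<omega> \<bullet> v)) = (CLINT \<omega>|M. iexp (P n \<omega> \<bullet> u)) * pr n v" for n
    using fac[of n v] fac[of n 0] pr0[of n] by (simp del: of_nat_Suc prod.lessThan_Suc)
  have "(\<lambda>n. CLINT \<omega>|M. iexp (P n \<omega> \<bullet> u + Q n \<omega> \<bullet> v)) \<longlonglongrightarrow>
      (CLINT \<omega>|M. iexp (Y s \<omega> \<bullet> u + (Y (s + t) \<omega> - exp (- l * t) *\<^sub>R Y s \<omega>) \<bullet> v))"
  proof (rule integral_dominated_convergence[where w="\<lambda>_. 1"])
    show "AE \<omega> in M. (\<lambda>n. iexp (P n \<omega> \<bullet> u + Q n \<omega> \<bullet> v)) \<longlonglongrightarrow>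
        iexp (Y s \<omega> \<bullet> u + (Y (s + t) \<omega> - exp (- l * t) *\<^sub>R Y s \<omega>) \<bullet> v)"
      using PQ by eventually_elim (intro tendsto_intros, auto)
  qed (use s t in auto)
  moreover have "(\<lambda>n. (CLINT \<omega>|M. iexp (P n \<omega> \<bullet> u)) * pr n v) \<longlonglongrightarrow>
     (CLINT \<omega>|M. iexp (Y s \<omega> \<bullet> u)) * exp (integral {0..t} (\<lambda>r. \<psi> (exp (- l * (t - r)) *\<^sub>R v)))"
  proof (rule tendsto_mult)
    show "(\<lambda>n. CLINT \<omega>|M. iexp (P n \<omega> \<bullet> u)) \<longlonglongrightarrow> (CLINT \<omega>|M. iexp (Y s \<omega> \<bullet> u))"
    proof (rule integral_dominated_convergence[where w="\<lambda>_. 1"])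
      show "AE \<omega> in M. (\<lambda>n. iexp (P n \<omega> \<bullet> u)) \<longlonglongrightarrow> iexp (Y s \<omega> \<bullet> u)"
        using PQ by eventually_elim (intro tendsto_intros, auto)
    qed (use s t in auto)
    have "continuous_on {0..t} (\<lambda>r. \<psi> (exp (- l * (t - r)) *\<^sub>R v))"
      by (rule continuous_on_compose2[OF cont]) (auto intro!: continuous_intros)
    from riemann_sum_continuous_tendsto[OF t this]
    have "(\<lambda>n. exp (\<Sum>k<Suc n. (t / real (Suc n)) *\<^sub>R \<psi> (exp (- l * (t - grid 0 t n k)) *\<^sub>R v)))
      \<longlonglongrightarrow> exp (integral {0..t} (\<lambda>r. \<psi> (exp (- l * (t - r)) *\<^sub>R v)))"
      by (intro tendsto_exp) (simp del: of_nat_Suc sum.lessThan_Suc)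
    then show "(\<lambda>n. pr n v) \<longlonglongrightarrow> exp (integral {0..t} (\<lambda>r. \<psi> (exp (- l * (t - r)) *\<^sub>R v)))"
      unfolding pr_def exp_sum[OF finite_lessThan] scaleR_conv_of_real .
  qed
  ultimately show ?thesis
    unfolding fac' by (rule LIMSEQ_unique)
qed

end

subsection \<open>Poisson sums\<close>

text \<open>Only the coordinates in the finite set \<open>J\<close> enter, so the projection to
  \<open>J\<close> reduces the claim to a finite product.\<close>

lemma (in product_prob_space) integral_PiM_prod:
  fixes f :: "'i \<Rightarrow> 'a \<Rightarrow> 'b::{real_normed_field, banach, second_countable_topology}"
  assumes J: "finite J" "J \<subseteq> I" and f: "\<And>i. i \<in> J \<Longrightarrow> integrable (M i) (f i)"
  shows "(\<integral>\<omega>. (\<Prod>i\<in>J. f i (\<omega> i)) \<partial>PiM I M) = (\<Prod>i\<in>J. \<integral>x. f i x \<partial>M i)"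
proof -
  have [measurable]: "i \<in> J \<Longrightarrow> f i \<in> borel_measurable (M i)" for i
    using f by auto
  have "(\<Prod>i\<in>J. \<integral>x. f i x \<partial>M i) = (\<integral>\<omega>. (\<Prod>i\<in>J. f i (\<omega> i)) \<partial>PiM J M)"
    using J f by (intro product_integral_prod[symmetric]) auto
  also have "PiM J M = distr (PiM I M) (PiM J M) (\<lambda>x. restrict x J)"
    using J by (rule distr_PiM_restrict_finite[symmetric])
  also have "(\<integral>\<omega>. (\<Prod>i\<in>J. f i (\<omega> i)) \<partial>\<dots>) = (\<integral>\<omega>. (\<Prod>i\<in>J. f i (restrict \<omega> J i)) \<partial>PiM I M)"
    using J by (intro integral_distr measurable_restrict_subset) auto
  also have "\<dots> = (\<integral>\<omega>. (\<Prod>i\<in>J. f i (\<omega> i)) \<partial>PiM I M)"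
    by (intro Bochner_Integration.integral_cong prod.cong) auto
  finally show ?thesis ..
qed

lemma integral_poisson_power:
  fixes \<phi> :: complex
  assumes "r > 0"
  shows "(CLINT n|measure_pmf (poisson_pmf r). \<phi> ^ n) = exp (complex_of_real r * (\<phi> - 1))"
proof -
  have eq: "pmf (poisson_pmf r) n *\<^sub>R \<phi> ^ n = exp (- complex_of_real r) * ((complex_of_real r * \<phi>) ^ n /\<^sub>R fact n)" for n
    using assms by (simp add: scaleR_conv_of_real exp_of_real[symmetric] power_mult_distrib field_simps)
  have sm: "(\<lambda>n. pmf (poisson_pmf r) n *\<^sub>R \<phi> ^ n) sums (exp (- complex_of_real r) * exp (complex_of_real r * \<phi>))"
    unfolding eq by (intro sums_mult exp_converges)
  have "summable (\<lambda>n. norm (pmf (poisson_pmf r) n *\<^sub>R \<phi> ^ n))"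
    unfolding eq norm_mult by (intro summable_mult summable_norm_exp)
  then have "integrable (count_space UNIV) (\<lambda>n. pmf (poisson_pmf r) n *\<^sub>R \<phi> ^ n)"
    by (simp only: integrable_count_space_nat_iff)
  from sums_integral_count_space_nat[OF this] sm
  have "(\<integral>n. pmf (poisson_pmf r) n *\<^sub>R \<phi> ^ n \<partial>count_space UNIV) = exp (- complex_of_real r) * exp (complex_of_real r * \<phi>)"
    by (rule sums_unique2)
  then show ?thesis
    unfolding measure_pmf_eq_density
    by (subst integral_density) (auto simp: exp_add[symmetric] algebra_simps)
qed

text \<open>Integrating first for a fixed number of summands leaves a power of \<phi>, and the
  generating function of the Poisson law does the rest. The weight \<open>g\<close> makes room for
  the variables X_n; a plain compound Poisson law has \<open>g\<close> = 1.\<close>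

lemma integral_random_sum:
  fixes \<xi> :: "nat \<Rightarrow> 's \<Rightarrow> 'a::euclidean_space" and g :: "'s \<Rightarrow> complex"
  assumes r: "r > 0" and "prob_space S"
    and [measurable]: "\<And>k. \<xi> k \<in> borel_measurable S" "g \<in> borel_measurable S"
    and g: "\<And>s. cmod (g s) \<le> 1"
    and prod: "\<And>n. (CLINT s|S. g s * (\<Prod>k=1..n. iexp (\<xi> k s \<bullet> z))) = A * \<phi> ^ n"
  shows "(CLINT p|measure_pmf (poisson_pmf r) \<Otimes>\<^sub>M S. g (snd p) * iexp ((\<Sum>k=1..fst p. \<xi> k (snd p)) \<bullet> z))
    = A * exp (complex_of_real r * (\<phi> - 1))"
proof -
  interpret S: prob_space S by fact
  interpret N: prob_space "measure_pmf (poisson_pmf r)" by (rule measure_pmf.prob_space_axioms)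
  interpret P: pair_prob_space "measure_pmf (poisson_pmf r)" S ..
  have iexp_sum: "iexp ((\<Sum>k=1..n. \<xi> k s) \<bullet> z) = (\<Prod>k=1..n. iexp (\<xi> k s \<bullet> z))" for n s
    by (simp add: inner_sum_left sum_distrib_left exp_sum)
  have [measurable]: "(\<lambda>p. \<Sum>k=1..fst p. \<xi> k (snd p)) \<in> borel_measurable (measure_pmf (poisson_pmf r) \<Otimes>\<^sub>M S)"
  proof -
    have "(\<lambda>p. \<Sum>k=1..fst p. \<xi> k (snd p)) \<in> borel_measurable (count_space UNIV \<Otimes>\<^sub>M S)"
      by (rule measurable_pair_measure_countable1) auto
    moreover have "sets (measure_pmf (poisson_pmf r) \<Otimes>\<^sub>M S) = sets (count_space UNIV \<Otimes>\<^sub>M S)"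
      by (rule sets_pair_measure_cong) auto
    ultimately show ?thesis by (simp cong: measurable_cong_sets)
  qed
  have "(CLINT p|measure_pmf (poisson_pmf r) \<Otimes>\<^sub>M S. g (snd p) * iexp ((\<Sum>k=1..fst p. \<xi> k (snd p)) \<bullet> z)) =
    (CLINT n|measure_pmf (poisson_pmf r). CLINT s|S. g s * iexp ((\<Sum>k=1..n. \<xi> k s) \<bullet> z))"
    using g by (subst P.integral_fst'[symmetric])
       (auto intro!: P.integrable_const_bound[of _ 1] simp: norm_mult)
  also have "\<dots> = (CLINT n|measure_pmf (poisson_pmf r). A * \<phi> ^ n)"
    unfolding iexp_sum prod ..
  finally show ?thesis
    using r by (simp add: integral_poisson_power)
qed

text \<open>The number of jumps has the mass of \<open>Q\<close> as its mean, and the jumps have the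
  normalised image of \<open>Q\<close> under \<open>J\<close> as their law. Keeping \<open>Q\<close>
  and \<open>J\<close> apart suits the later use, where \<open>Q\<close> is a product measure and
  \<open>J\<close> multiplies a direction by a size.\<close>

lemma compound_poisson_exists:
  fixes J :: "'b \<Rightarrow> 'a::euclidean_space"
  assumes "finite_measure Q" and [measurable]: "J \<in> borel_measurable Q"
  obtains \<mu> :: "'a measure" where "prob_space \<mu>" "sets \<mu> = sets borel"
    "\<And>z. charfun \<mu> z = exp (CLINT x|Q. (iexp (J x \<bullet> z) - 1))"
proof -
  interpret Q: finite_measure Q by fact
  define r where "r = measure Q (space Q)"
  consider "r = 0" | "r > 0" unfolding r_def by (metis measure_nonneg order_le_less)
  then show ?thesis
  proof cases
    \<comment> \<open>Zero mass cannot be normalised, and the law is then the point mass at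
      0.\<close>
    case 1
    then have "emeasure Q (space Q) = 0" by (simp add: r_def Q.emeasure_eq_measure)
    then have "AE x in Q. iexp (J x \<bullet> z) - 1 = 0" for z
      using AE_iff_measurable[of "space Q" Q] by (auto intro: AE_I[of _ _ "space Q"])
    then have "(CLINT x|Q. (iexp (J x \<bullet> z) - 1)) = 0" for z
      by (intro integral_eq_zero_AE) auto
    then show ?thesis
      using that[of "return borel 0"]
      by (simp add: prob_space_return charfun_def integral_return)
  next
    case 2
    define \<rho> where "\<rho> = distr (scale_measure (ennreal (1 / r)) Q) borel J"
    have "emeasure (scale_measure (ennreal (1 / r)) Q) (space Q) = 1"
      using 2 by (simp add: r_def Q.emeasure_eq_measure flip: ennreal_mult)
    then have ps: "prob_space (scale_measure (ennreal (1 / r)) Q)"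
      by (intro prob_spaceI) (simp add: space_scale_measure)
    have [measurable]: "J \<in> scale_measure (ennreal (1 / r)) Q \<rightarrow>\<^sub>M borel"
      by (simp cong: measurable_cong_sets)
    interpret \<rho>: prob_space \<rho>
      unfolding \<rho>_def by (rule prob_space.prob_space_distr[OF ps]) simp
    have s\<rho> [simp, measurable_cong]: "sets \<rho> = sets borel" by (simp add: \<rho>_def)
    interpret PP: product_prob_space "\<lambda>_::nat. \<rho>" UNIV ..
    let ?S = "PiM (UNIV::nat set) (\<lambda>_. \<rho>)"
    let ?P = "measure_pmf (poisson_pmf r) \<Otimes>\<^sub>M ?S"
    let ?f = "\<lambda>p. \<Sum>k=1..fst p. snd p k :: 'a"
    have S: "prob_space ?S" by (rule prob_space_PiM) (rule \<rho>.prob_space_axioms)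
    then interpret S: prob_space ?S .
    interpret N: prob_space "measure_pmf (poisson_pmf r)" by (rule measure_pmf.prob_space_axioms)
    interpret P: pair_prob_space "measure_pmf (poisson_pmf r)" ?S ..
    have m [measurable]: "?f \<in> borel_measurable ?P"
    proof -
      have "?f \<in> borel_measurable (count_space UNIV \<Otimes>\<^sub>M ?S)"
        by (rule measurable_pair_measure_countable1) auto
      moreover have "sets ?P = sets (count_space UNIV \<Otimes>\<^sub>M ?S)"
        by (rule sets_pair_measure_cong) auto
      ultimately show ?thesis by (simp cong: measurable_cong_sets)
    qed
    have "charfun (distr ?P borel ?f) z = exp (CLINT x|Q. (iexp (J x \<bullet> z) - 1))" for z
    proof -
      have "(CLINT s|?S. (1::complex) * (\<Prod>k=1..n. iexp (s k \<bullet> z))) = 1 * charfun \<rho> z ^ n" for n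
        unfolding charfun_def mult_1
        by (subst PP.integral_PiM_prod) (auto intro!: \<rho>.integrable_iexp_real)
      then have "(CLINT p|?P. 1 * iexp (?f p \<bullet> z)) = 1 * exp (complex_of_real r * (charfun \<rho> z - 1))"
        using 2 by (intro integral_random_sum) (auto intro: S)
      moreover have "complex_of_real r * (charfun \<rho> z - 1) = (CLINT x|Q. (iexp (J x \<bullet> z) - 1))"
      proof -
        have "charfun \<rho> z = (1 / r) *\<^sub>R (CLINT x|Q. iexp (J x \<bullet> z))"
          using 2 by (simp add: \<rho>_def charfun_distr integral_scale_measure)
        then show ?thesis
          using 2 by (subst Bochner_Integration.integral_diff)
            (auto intro!: Q.integrable_iexp_real simp: scaleR_conv_of_real r_def right_diff_distrib)
      qed
      ultimately show ?thesis
        by (simp add: charfun_distr)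
    qed
    moreover have "prob_space (distr ?P borel ?f)" by (rule P.prob_space_distr) simp
    ultimately show ?thesis
      using that by simp
  qed
qed

subsection \<open>Existence of infinitely divisible laws\<close>

definition levy_khintchine_integrand :: "'a::euclidean_space \<Rightarrow> 'a \<Rightarrow> complex" where
  "levy_khintchine_integrand z y =
     iexp (y \<bullet> z) - 1 - (if norm y \<le> 1 then \<i> * complex_of_real (y \<bullet> z) else 0)"

lemma levy_khintchine_integrand_measurable [measurable]:
  "levy_khintchine_integrand z \<in> borel_measurable borel"
  unfolding levy_khintchine_integrand_def[abs_def] by measurable

lemma norm_iexp_minus_linear_le: "cmod (iexp y - 1 - \<i> * complex_of_real y) \<le> min (y\<^sup>2 / 2) (2 * \<bar>y\<bar>)"
  using iexp_approx1[of y 1] iexp_approx2[of y 1] by (simp add: diff_diff_eq numeral_2_eq_2)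

lemma levy_khintchine_integrand_0 [simp]: "levy_khintchine_integrand z 0 = 0"
  by (simp add: levy_khintchine_integrand_def)

lemma norm_levy_khintchine_integrand_le:
  "cmod (levy_khintchine_integrand z y) \<le> (2 + (norm z)\<^sup>2) * min 1 ((norm y)\<^sup>2)"
proof (cases "norm y \<le> 1")
  case True
  then have "(norm y)\<^sup>2 \<le> 1" by (simp add: power_le_one)
  have "cmod (levy_khintchine_integrand z y) \<le> (y \<bullet> z)\<^sup>2 / 2"
    using norm_iexp_minus_linear_le[of "y \<bullet> z"] True by (simp add: levy_khintchine_integrand_def)
  also have "(y \<bullet> z)\<^sup>2 \<le> (norm y * norm z)\<^sup>2"
    using Cauchy_Schwarz_ineq2[of y z] by (metis abs_le_square_iff abs_mult abs_norm_cancel)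
  also have "(norm y * norm z)\<^sup>2 / 2 \<le> (2 + (norm z)\<^sup>2) * (norm y)\<^sup>2"
    by (simp add: power_mult_distrib ring_distribs mult.commute)
  finally show ?thesis using \<open>(norm y)\<^sup>2 \<le> 1\<close> by simp
next
  case False
  then have "1 \<le> (norm y)\<^sup>2" by simp
  moreover have "cmod (levy_khintchine_integrand z y) \<le> 2"
    using False norm_iexp_diff_one_le[of "y \<bullet> z"] by (simp add: levy_khintchine_integrand_def)
  ultimately show ?thesis by (simp add: add_increasing2)
qed

text \<open>For w = a + i b the real part of exp w is exp a cos b, which is at least (1 + a) (1 -
  b^2 / 2). The hypotheses make both factors nonnegative and bound b^2 by the modulus of w, so the
  estimate becomes linear.\<close>

lemma one_minus_Re_exp_le:
  fixes w :: complex
  assumes "Re w \<le> 0" "cmod w \<le> 1"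
  shows "1 - Re (exp w) \<le> 2 * cmod w"
proof -
  define a b where "a = Re w" "b = Im w"
  have ab: "a \<le> 0" "\<bar>a\<bar> \<le> cmod w" "\<bar>b\<bar> \<le> cmod w"
    using assms abs_Re_le_cmod[of w] abs_Im_le_cmod[of w] by (auto simp: a_b_def)
  have "\<bar>sin (b / 2)\<bar> \<le> \<bar>b / 2\<bar>" by (rule abs_sin_x_le_abs_x)
  then have "(sin (b / 2))\<^sup>2 \<le> (b / 2)\<^sup>2" by (simp only: abs_le_square_iff)
  then have cos: "1 - b\<^sup>2 / 2 \<le> cos b"
    using cos_double_sin[of "b / 2"] by (simp add: power_divide)
  have b2: "b\<^sup>2 \<le> cmod w"
  proof -
    have "b\<^sup>2 = \<bar>b\<bar> * \<bar>b\<bar>" by (metis power2_abs power2_eq_square)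
    also have "\<dots> \<le> cmod w * 1" using ab assms by (intro mult_mono) auto
    finally show ?thesis by simp
  qed
  have "(1 + a) * (1 - b\<^sup>2 / 2) \<le> exp a * cos b"
    using cos ab assms b2 exp_ge_add_one_self[of a] by (intro mult_mono) (auto simp: add.commute)
  moreover have "1 + a - b\<^sup>2 / 2 \<le> (1 + a) * (1 - b\<^sup>2 / 2)"
    using ab(1) by (simp add: algebra_simps mult_nonpos_nonneg)
  ultimately have "1 - Re (exp w) \<le> - a + b\<^sup>2 / 2"
    by (simp add: Re_exp a_b_def)
  also have "\<dots> \<le> 2 * cmod w" using ab b2 by linarith
  finally show ?thesis .
qed

text \<open>For a finite jump measure the compensator of the small jumps is an ordinary integral, so
  it amounts to a translation of the compound Poisson law.\<close>

lemma levy_khintchine_finite_exists: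
  fixes J :: "'b \<Rightarrow> 'a::euclidean_space"
  assumes "finite_measure Q" and [measurable]: "J \<in> borel_measurable Q"
  obtains \<mu> :: "'a measure" where "prob_space \<mu>" "sets \<mu> = sets borel"
    "\<And>z. charfun \<mu> z = exp (CLINT x|Q. levy_khintchine_integrand z (J x))"
proof -
  interpret Q: finite_measure Q by fact
  let ?T = "\<lambda>x. if norm (J x) \<le> 1 then J x else 0"
  have T: "integrable Q ?T"
    by (intro Q.integrable_const_bound[of _ 1]) auto
  obtain \<mu> :: "'a measure" where \<mu>: "prob_space \<mu>" "sets \<mu> = sets borel"
    "\<And>z. charfun \<mu> z = exp (CLINT x|Q. (iexp (J x \<bullet> z) - 1))"
    using compound_poisson_exists[OF assms] by blast
  obtain \<nu> :: "'a measure" where \<nu>: "prob_space \<nu>" "sets \<nu> = sets borel"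
    "\<And>z. charfun \<nu> z = iexp (- (\<integral>x. ?T x \<partial>Q) \<bullet> z) * charfun \<mu> z"
    using charfun_shift_exists[OF \<mu>(1,2), of "- (\<integral>x. ?T x \<partial>Q)"] by blast
  have "charfun \<nu> z = exp (CLINT x|Q. levy_khintchine_integrand z (J x))" for z
  proof -
    have eq: "levy_khintchine_integrand z (J x) =
        (iexp (J x \<bullet> z) - 1) - \<i> * complex_of_real (?T x \<bullet> z)" for x
      by (simp add: levy_khintchine_integrand_def)
    have "(CLINT x|Q. levy_khintchine_integrand z (J x)) =
        (CLINT x|Q. (iexp (J x \<bullet> z) - 1)) - (CLINT x|Q. \<i> * complex_of_real (?T x \<bullet> z))"
      unfolding eq
      by (intro Bochner_Integration.integral_diff integrable_mult_right integrable_of_real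
            integrable_inner_left Bochner_Integration.integrable_diff Q.integrable_iexp_real T) auto
    also have "(CLINT x|Q. \<i> * complex_of_real (?T x \<bullet> z)) = \<i> * complex_of_real ((\<integral>x. ?T x \<partial>Q) \<bullet> z)"
      using T by (subst integral_inner_left[symmetric]) (auto simp del: integral_inner_left)
    finally show ?thesis
      by (simp add: \<nu>(3) \<mu>(3) exp_add[symmetric] exp_diff[symmetric])
  qed
  with \<nu> show ?thesis using that by blast
qed

text \<open>Fatou's lemma applied to \<open>2 n\<^sup>2 (1 - cos ((x \<bullet> e) / n)) \<longlonglongrightarrow> (x \<bullet> e)\<^sup>2\<close> replaces a computation of moments.\<close>

lemma levy_khintchine_second_moment_le:
  fixes J :: "'b \<Rightarrow> 'a::euclidean_space" and e :: 'a
  assumes "finite_measure Q" and [measurable]: "J \<in> borel_measurable Q" and J: "AE x in Q. norm (J x) \<le> 1"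
    and V: "(\<integral>\<^sup>+x. ennreal ((norm (J x))\<^sup>2) \<partial>Q) \<le> ennreal V" "0 \<le> V"
    and "prob_space \<mu>" and [measurable_cong]: "sets \<mu> = sets borel"
    and char: "\<And>z. charfun \<mu> z = exp (CLINT x|Q. levy_khintchine_integrand z (J x))"
    and e: "norm e \<le> 1"
  shows "(\<integral>\<^sup>+x. ennreal ((x \<bullet> e)\<^sup>2) \<partial>\<mu>) \<le> ennreal (2 * V)"
proof -
  interpret Q: finite_measure Q by fact
  interpret \<mu>: prob_space \<mu> by fact
  define f where "f n x = 2 * (real n)\<^sup>2 * (1 - cos ((x \<bullet> e) / real n))" for n and x :: 'a
  have f0: "0 \<le> f n x" for n x by (simp add: f_def)
  have [measurable]: "f n \<in> borel_measurable borel" for n unfolding f_def[abs_def] by measurable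
  have lim: "(\<lambda>n. f n x) \<longlonglongrightarrow> (x \<bullet> e)\<^sup>2" for x
  proof -
    have "(\<lambda>n. 2 * (real n)\<^sup>2 * (1 - cos (y / real n))) \<longlonglongrightarrow> y * y" for y :: real
      by real_asymp
    then show ?thesis unfolding f_def power2_eq_square[of "x \<bullet> e"] .
  qed
  \<comment> \<open>The real part of the integrand is cos - 1, and jumps of norm at most 1 are all
    compensated, so the second-order Taylor bound holds almost everywhere.\<close>
  have psi: "Re (CLINT x|Q. levy_khintchine_integrand z (J x)) \<le> 0 \<and>
     cmod (CLINT x|Q. levy_khintchine_integrand z (J x)) \<le> (norm z)\<^sup>2 / 2 * V" for z
  proof
    have int: "integrable Q (\<lambda>x. levy_khintchine_integrand z (J x))"
    proof (rule Q.integrable_const_bound[of _ "2 + (norm z)\<^sup>2"])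
      show "AE x in Q. cmod (levy_khintchine_integrand z (J x)) \<le> 2 + (norm z)\<^sup>2"
        by (rule AE_I2, rule order_trans[OF norm_levy_khintchine_integrand_le])
           (auto intro!: mult_left_le)
    qed simp
    then have "Re (CLINT x|Q. levy_khintchine_integrand z (J x)) = (\<integral>x. Re (levy_khintchine_integrand z (J x)) \<partial>Q)"
      by simp
    also have "\<dots> = (\<integral>x. cos (J x \<bullet> z) - 1 \<partial>Q)"
      by (rule Bochner_Integration.integral_cong) (simp_all add: levy_khintchine_integrand_def Re_exp)
    also have "\<dots> \<le> 0" using integral_nonneg_AE[where M=Q and f="\<lambda>x. 1 - cos (J x \<bullet> z)"]
      by (subst minus_diff_eq[symmetric], subst integral_minus) simp
    finally show "Re (CLINT x|Q. levy_khintchine_integrand z (J x)) \<le> 0" .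
    have b: "AE x in Q. cmod (levy_khintchine_integrand z (J x)) \<le> (norm z)\<^sup>2 / 2 * (norm (J x))\<^sup>2"
      using J
    proof eventually_elim
      fix x assume x: "norm (J x) \<le> 1"
      have "cmod (levy_khintchine_integrand z (J x)) \<le> (J x \<bullet> z)\<^sup>2 / 2"
        using norm_iexp_minus_linear_le[of "J x \<bullet> z"] x by (simp add: levy_khintchine_integrand_def)
      also have "(J x \<bullet> z)\<^sup>2 \<le> (norm (J x) * norm z)\<^sup>2"
        using Cauchy_Schwarz_ineq2[of "J x" z] by (metis abs_le_square_iff abs_mult abs_norm_cancel)
      finally show "cmod (levy_khintchine_integrand z (J x)) \<le> (norm z)\<^sup>2 / 2 * (norm (J x))\<^sup>2"
        by (simp add: power_mult_distrib mult.commute)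
    qed
    have "ennreal (cmod (CLINT x|Q. levy_khintchine_integrand z (J x)))
        \<le> (\<integral>\<^sup>+x. ennreal (cmod (levy_khintchine_integrand z (J x))) \<partial>Q)"
      by (rule integral_norm_bound_ennreal[OF int])
    also have "\<dots> \<le> (\<integral>\<^sup>+x. ennreal ((norm z)\<^sup>2 / 2) * ennreal ((norm (J x))\<^sup>2) \<partial>Q)"
      using b by (intro nn_integral_mono_AE) (auto simp: ennreal_mult[symmetric] intro: ennreal_leI)
    also have "\<dots> \<le> ennreal ((norm z)\<^sup>2 / 2) * ennreal V"
      using V by (subst nn_integral_cmult) (auto intro: mult_left_mono)
    finally show "cmod (CLINT x|Q. levy_khintchine_integrand z (J x)) \<le> (norm z)\<^sup>2 / 2 * V"
      using V by (simp add: ennreal_mult[symmetric])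
  qed
  have bound: "\<forall>\<^sub>F n in sequentially. (\<integral>\<^sup>+x. ennreal (f n x) \<partial>\<mu>) \<le> ennreal (2 * V)"
  proof -
    \<comment> \<open>From this n on, the exponent at e / n is at most V / (2 n^2) \<le> 1 in
      modulus, which is the range of \<open>one_minus_Re_exp_le\<close>.\<close>
    obtain n0 where n0: "real n0 \<ge> max 1 V" using real_arch_simple by blast
    show ?thesis unfolding eventually_sequentially
    proof (intro exI[of _ n0] allI impI)
      fix n assume "n0 \<le> n"
      then have n: "real n \<ge> 1" "real n \<ge> V" using n0 by linarith+
      let ?w = "CLINT x|Q. levy_khintchine_integrand (e /\<^sub>R real n) (J x)"
      have e2: "(norm (e /\<^sub>R real n))\<^sup>2 / 2 \<le> 1 / (2 * (real n)\<^sup>2)"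
        using e n by (simp add: power_mult_distrib power_inverse divide_simps power_le_one)
      have w: "cmod ?w \<le> V / (2 * (real n)\<^sup>2)"
        using psi[of "e /\<^sub>R real n"] mult_right_mono[OF e2 V(2)] by simp
      have "V \<le> (real n)\<^sup>2"
        using n(2) mult_left_mono[of 1 "real n" "real n"] n(1) unfolding power2_eq_square by linarith
      then have "V / (2 * (real n)\<^sup>2) \<le> 1" using n V(2) by (simp add: divide_simps)
      with w have w1: "cmod ?w \<le> 1" by linarith
      have "Re (charfun \<mu> (e /\<^sub>R real n)) = (\<integral>x. cos ((x \<bullet> e) / real n) \<partial>\<mu>)"
      proof -
        have "integrable \<mu> (\<lambda>x. iexp (x \<bullet> (e /\<^sub>R real n)))"
          by (rule \<mu>.integrable_iexp_real) simp
        then have "Re (charfun \<mu> (e /\<^sub>R real n)) = (\<integral>x. Re (iexp (x \<bullet> (e /\<^sub>R real n))) \<partial>\<mu>)"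
          unfolding charfun_def by (rule integral_Re[symmetric])
        also have "\<dots> = (\<integral>x. cos ((x \<bullet> e) / real n) \<partial>\<mu>)"
          by (intro Bochner_Integration.integral_cong) (simp_all add: Re_exp inner_scaleR_right divide_inverse mult.commute del: of_real_mult)
        finally show ?thesis .
      qed
      then have "(\<integral>x. f n x \<partial>\<mu>) = 2 * (real n)\<^sup>2 * (1 - Re (charfun \<mu> (e /\<^sub>R real n)))"
        unfolding f_def by (subst integral_mult_right_zero, subst Bochner_Integration.integral_diff)
          (auto intro!: \<mu>.integrable_const_bound[of _ 1] simp: \<mu>.prob_space)
      also have "\<dots> \<le> 2 * (real n)\<^sup>2 * (2 * cmod ?w)"
        unfolding char using psi w1 by (intro mult_left_mono one_minus_Re_exp_le) auto
      also have "\<dots> \<le> 2 * (real n)\<^sup>2 * (2 * (V / (2 * (real n)\<^sup>2)))"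
        using w by (intro mult_left_mono) auto
      also have "\<dots> = 2 * V" using n by (simp add: field_simps)
      finally have *: "(\<integral>x. f n x \<partial>\<mu>) \<le> 2 * V" .
      have "integrable \<mu> (f n)"
        unfolding f_def by (intro integrable_mult_right Bochner_Integration.integrable_diff \<mu>.integrable_const_bound[of _ 1]) auto
      then have "(\<integral>\<^sup>+x. ennreal (f n x) \<partial>\<mu>) = ennreal (\<integral>x. f n x \<partial>\<mu>)"
        using f0 by (intro nn_integral_eq_integral) auto
      with * show "(\<integral>\<^sup>+x. ennreal (f n x) \<partial>\<mu>) \<le> ennreal (2 * V)" by (simp add: ennreal_leI)
    qed
  qed
  have "(\<integral>\<^sup>+x. ennreal ((x \<bullet> e)\<^sup>2) \<partial>\<mu>) = (\<integral>\<^sup>+x. liminf (\<lambda>n. ennreal (f n x)) \<partial>\<mu>)"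
    by (intro nn_integral_cong lim_imp_Liminf[symmetric] tendsto_ennrealI lim) simp
  also have "\<dots> \<le> liminf (\<lambda>n. \<integral>\<^sup>+x. ennreal (f n x) \<partial>\<mu>)"
    by (rule nn_integral_liminf) simp
  also have "\<dots> \<le> ennreal (2 * V)"
    using bound by (intro Liminf_le) auto
  finally show ?thesis .
qed

text \<open>The inequality \<bar>y\<bar> \<le> \<delta> + y^2 / \<delta> trades the second moment
  for the first one. With second moments at most 2 \<delta>^2 every coordinate contributes \<delta>
  + 2 \<delta>.\<close>

lemma levy_khintchine_first_moment_le:
  fixes J :: "'b \<Rightarrow> 'a::euclidean_space" and \<delta> :: real
  assumes Q: "finite_measure Q" and [measurable]: "J \<in> borel_measurable Q" and J: "AE x in Q. norm (J x) \<le> 1"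
    and V: "(\<integral>\<^sup>+x. ennreal ((norm (J x))\<^sup>2) \<partial>Q) \<le> ennreal (\<delta>\<^sup>2)" "0 < \<delta>"
    and "prob_space \<mu>" and [measurable_cong]: "sets \<mu> = sets borel"
    and char: "\<And>z. charfun \<mu> z = exp (CLINT x|Q. levy_khintchine_integrand z (J x))"
  shows "(\<integral>\<^sup>+x. ennreal (norm x) \<partial>\<mu>) \<le> ennreal (3 * DIM('a) * \<delta>)"
proof -
  interpret \<mu>: prob_space \<mu> by fact
  have b: "(\<integral>\<^sup>+x. ennreal \<bar>x \<bullet> i\<bar> \<partial>\<mu>) \<le> ennreal (3 * \<delta>)" if i: "i \<in> Basis" for i :: 'a
  proof -
    have "\<bar>y\<bar> \<le> \<delta> + y\<^sup>2 / \<delta>" for y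
    proof (cases "\<bar>y\<bar> \<le> \<delta>")
      case False
      then have "\<bar>y\<bar> * \<delta> \<le> \<bar>y\<bar> * \<bar>y\<bar>" using V by (intro mult_left_mono) auto
      then have "\<bar>y\<bar> \<le> y\<^sup>2 / \<delta>" using V by (simp add: field_simps power2_eq_square)
      then show ?thesis using V by linarith
    qed (use V in \<open>simp add: add_increasing2\<close>)
    then have "(\<integral>\<^sup>+x. ennreal \<bar>x \<bullet> i\<bar> \<partial>\<mu>) \<le> (\<integral>\<^sup>+x. ennreal \<delta> + ennreal (1 / \<delta>) * ennreal ((x \<bullet> i)\<^sup>2) \<partial>\<mu>)"
      using V by (intro nn_integral_mono) (simp add: ennreal_mult[symmetric] ennreal_plus[symmetric] ennreal_leI del: ennreal_plus)
    also have "\<dots> = ennreal \<delta> + ennreal (1 / \<delta>) * (\<integral>\<^sup>+x. ennreal ((x \<bullet> i)\<^sup>2) \<partial>\<mu>)"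
      by (subst nn_integral_add) (auto simp: nn_integral_cmult \<mu>.emeasure_space_1)
    also have "\<dots> \<le> ennreal \<delta> + ennreal (1 / \<delta>) * ennreal (2 * \<delta>\<^sup>2)"
      using i by (intro add_left_mono mult_left_mono levy_khintchine_second_moment_le[OF Q _ J V(1)] assms) auto
    also have "\<dots> = ennreal (3 * \<delta>)"
      using V by (simp add: ennreal_mult[symmetric] ennreal_plus[symmetric] power2_eq_square del: ennreal_plus)
    finally show ?thesis .
  qed
  have "(\<integral>\<^sup>+x. ennreal (norm x) \<partial>\<mu>) \<le> (\<integral>\<^sup>+x. (\<Sum>i\<in>Basis. ennreal \<bar>x \<bullet> i\<bar>) \<partial>\<mu>)"
    by (intro nn_integral_mono) (auto simp: norm_le_l1 intro!: ennreal_leI)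
  also have "\<dots> = (\<Sum>i\<in>Basis. \<integral>\<^sup>+x. ennreal \<bar>x \<bullet> i\<bar> \<partial>\<mu>)"
    by (rule nn_integral_sum) simp
  also have "\<dots> \<le> (\<Sum>i\<in>(Basis::'a set). ennreal (3 * \<delta>))"
    by (intro sum_mono b)
  also have "\<dots> = ennreal (3 * DIM('a) * \<delta>)"
    using V by (simp add: ennreal_of_nat_eq_real_of_nat ennreal_mult[symmetric] mult_ac)
  finally show ?thesis .
qed

text \<open>On the product space of the given laws, the summable first moments make the series of
  coordinates converge absolutely almost surely. The law of its sum is the limit, and no tightness
  argument is needed.\<close>

lemma convergent_series_law_exists:
  fixes \<mu> :: "nat \<Rightarrow> 'a::euclidean_space measure"
  assumes p: "\<And>k. prob_space (\<mu> k)" and [simp, measurable_cong]: "\<And>k. sets (\<mu> k) = sets borel"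
    and c: "\<And>k. (\<integral>\<^sup>+x. ennreal (norm x) \<partial>\<mu> k) \<le> ennreal (c k)" "\<And>k. 0 \<le> c k" "summable c"
  obtains \<rho> :: "'a measure" where "prob_space \<rho>" "sets \<rho> = sets borel"
    "\<And>z. (\<lambda>n. \<Prod>k<n. charfun (\<mu> k) z) \<longlonglongrightarrow> charfun \<rho> z"
proof -
  interpret p: prob_space "\<mu> k" for k by (rule p)
  interpret PP: product_prob_space \<mu> UNIV ..
  let ?P = "PiM UNIV \<mu>"
  have P: "prob_space ?P" by (rule prob_space_PiM) (rule p)
  then interpret P: prob_space ?P .
  have "(\<integral>\<^sup>+\<omega>. (\<Sum>k. ennreal (norm (\<omega> k))) \<partial>?P) = (\<Sum>k. \<integral>\<^sup>+\<omega>. ennreal (norm (\<omega> k)) \<partial>?P)"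
    by (rule nn_integral_suminf) simp
  also have "\<dots> = (\<Sum>k. \<integral>\<^sup>+x. ennreal (norm x) \<partial>\<mu> k)"
  proof (rule arg_cong[where f=suminf], rule ext)
    fix k
    have "(\<integral>\<^sup>+x. ennreal (norm x) \<partial>\<mu> k) = (\<integral>\<^sup>+x. ennreal (norm x) \<partial>distr ?P (\<mu> k) (\<lambda>\<omega>. \<omega> k))"
      by (subst PP.PiM_component) auto
    also have "\<dots> = (\<integral>\<^sup>+\<omega>. ennreal (norm (\<omega> k)) \<partial>?P)"
      by (rule nn_integral_distr) auto
    finally show "(\<integral>\<^sup>+\<omega>. ennreal (norm (\<omega> k)) \<partial>?P) = (\<integral>\<^sup>+x. ennreal (norm x) \<partial>\<mu> k)" ..
  qed
  also have "\<dots> \<le> (\<Sum>k. ennreal (c k))"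
    using c by (intro suminf_le) auto
  also have "\<dots> < \<infinity>"
    using c by (simp add: suminf_ennreal2 less_top[symmetric])
  finally have "AE \<omega> in ?P. (\<Sum>k. ennreal (norm (\<omega> k))) \<noteq> \<infinity>"
    by (intro nn_integral_PInf_AE) (auto simp: less_top)
  then have sm: "AE \<omega> in ?P. summable (\<lambda>k. \<omega> k)"
    by eventually_elim (auto intro!: summable_norm_cancel[OF summable_suminf_not_top] simp: top_ennreal_def)
  let ?\<rho> = "distr ?P borel (\<lambda>\<omega>. \<Sum>k. \<omega> k)"
  have "(\<lambda>n. \<Prod>k<n. charfun (\<mu> k) z) \<longlonglongrightarrow> charfun ?\<rho> z" for z
  proof -
    have "(\<lambda>n. CLINT \<omega>|?P. iexp ((\<Sum>k<n. \<omega> k) \<bullet> z)) \<longlonglongrightarrow> (CLINT \<omega>|?P. iexp ((\<Sum>k. \<omega> k) \<bullet> z))"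
    proof (rule integral_dominated_convergence[where w="\<lambda>_. 1"])
      show "AE \<omega> in ?P. (\<lambda>n. iexp ((\<Sum>k<n. \<omega> k) \<bullet> z)) \<longlonglongrightarrow> iexp ((\<Sum>k. \<omega> k) \<bullet> z)"
        using sm by eventually_elim (auto intro!: tendsto_intros summable_LIMSEQ)
    qed auto
    moreover have "(CLINT \<omega>|?P. iexp ((\<Sum>k<n. \<omega> k) \<bullet> z)) = (\<Prod>k<n. charfun (\<mu> k) z)" for n
    proof -
      have "(CLINT \<omega>|?P. iexp ((\<Sum>k<n. \<omega> k) \<bullet> z)) = (CLINT \<omega>|?P. (\<Prod>k<n. iexp (\<omega> k \<bullet> z)))"
        by (simp add: inner_sum_left sum_distrib_left exp_sum)
      then show ?thesis
        unfolding charfun_def by (subst (asm) PP.integral_PiM_prod) (auto intro!: p.integrable_iexp_real)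
    qed
    ultimately show ?thesis by (simp add: charfun_distr)
  qed
  moreover have "prob_space ?\<rho>" by (rule prob_space.prob_space_distr[OF P]) simp
  ultimately show ?thesis using that[of ?\<rho>] by simp
qed

text \<open>Away from jump size 0 the measure is finite and the compound Poisson construction
  applies. The rest is cut into shells whose radii decrease so fast that the k-th shell has second
  moment at most 4^(- k); the first moments of the corresponding laws are then bounded by a multiple
  of 2^(- k), hence summable.\<close>

theorem levy_khintchine_exists:
  fixes J :: "'b \<Rightarrow> 'a::euclidean_space"
  assumes [measurable]: "J \<in> borel_measurable Q"
    and fin: "(\<integral>\<^sup>+x. ennreal (min 1 ((norm (J x))\<^sup>2)) \<partial>Q) < \<infinity>"
  obtains \<mu> :: "'a measure" where "prob_space \<mu>" "sets \<mu> = sets borel"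
    "\<And>z. charfun \<mu> z = exp (CLINT x|Q. levy_khintchine_integrand z (J x))"
proof -
  let ?m = "\<lambda>x. min 1 ((norm (J x))\<^sup>2)"
  have im: "integrable Q ?m"
    using fin by (intro integrableI_nonneg) auto
  have intF: "integrable Q (\<lambda>x. levy_khintchine_integrand z (J x))" for z
    by (rule Bochner_Integration.integrable_bound[OF integrable_mult_right[OF im, of "2 + (norm z)\<^sup>2"]])
       (auto intro!: AE_I2 norm_levy_khintchine_integrand_le simp del: of_nat_add)
  have small: "\<exists>\<epsilon>>0. (\<integral>x. ?m x * indicator {x. norm (J x) \<le> \<epsilon>} x \<partial>Q) < d" if "d > 0" for d
  proof -
    have "(\<lambda>n. \<integral>x. ?m x * indicator {x. norm (J x) \<le> 1 / Suc n} x \<partial>Q) \<longlonglongrightarrow> (\<integral>x. 0 \<partial>Q)"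
    proof (rule integral_dominated_convergence[OF _ _ im])
      show "AE x in Q. (\<lambda>n. ?m x * indicator {x. norm (J x) \<le> 1 / Suc n} x) \<longlonglongrightarrow> 0"
      proof (rule AE_I2)
        fix x
        show "(\<lambda>n. ?m x * indicator {x. norm (J x) \<le> 1 / Suc n} x) \<longlonglongrightarrow> 0"
        proof (cases "J x = 0")
          case False
          have "(\<lambda>n. 1 / real (Suc n)) \<longlonglongrightarrow> 0" by real_asymp
          then have "\<forall>\<^sub>F n in sequentially. 1 / real (Suc n) < norm (J x)"
            using False by (intro order_tendstoD) auto
          then have "\<forall>\<^sub>F n in sequentially. ?m x * indicator {x. norm (J x) \<le> 1 / Suc n} x = 0"
            by eventually_elim auto
          then show ?thesis by (rule tendsto_eventually)
        qed simp
      qed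
    qed (auto simp: indicator_def)
    then have "\<forall>\<^sub>F n in sequentially. (\<integral>x. ?m x * indicator {x. norm (J x) \<le> 1 / Suc n} x \<partial>Q) < d"
      using that by (intro order_tendstoD) auto
    then obtain n where "(\<integral>x. ?m x * indicator {x. norm (J x) \<le> 1 / Suc n} x \<partial>Q) < d"
      by (auto simp: eventually_sequentially)
    then show ?thesis by (intro exI[of _ "1 / Suc n"]) auto
  qed
  have "\<exists>\<epsilon>. \<forall>k. \<epsilon> k > 0 \<and> (\<integral>x. ?m x * indicator {x. norm (J x) \<le> \<epsilon> k} x \<partial>Q) < ((1/2) ^ k)\<^sup>2"
    by (rule choice) (use small in auto)
  then obtain \<epsilon> where \<epsilon>: "\<And>k. \<epsilon> k > 0"
    "\<And>k. (\<integral>x. ?m x * indicator {x. norm (J x) \<le> \<epsilon> k} x \<partial>Q) < ((1/2) ^ k)\<^sup>2" by blast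
  \<comment> \<open>The running minimum makes the radii decreasing, and the bound 1 /
    \<open>Suc k\<close> forces them to 0 and keeps them at most 1.\<close>
  define \<eta> where "\<eta> k = min (1 / Suc k) (Min (\<epsilon> ` {..k}))" for k
  have \<eta>: "0 < \<eta> k" "\<eta> k \<le> 1 / Suc k" "\<eta> k \<le> \<epsilon> k" "\<eta> k \<le> 1" for k
    using \<epsilon>(1) by (auto simp: \<eta>_def min_le_iff_disj)
  have dec: "\<eta> (Suc k) \<le> \<eta> k" for k
    unfolding \<eta>_def by (intro min.mono Min_antimono) (auto simp: frac_le)
  have \<eta>0: "\<eta> \<longlonglongrightarrow> 0"
  proof (rule tendsto_sandwich[of "\<lambda>_. 0" _ _ "\<lambda>k. 1 / real (Suc k)"])
    show "(\<lambda>k. 1 / real (Suc k)) \<longlonglongrightarrow> 0" by real_asymp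
    show "(\<lambda>_. 0) \<longlonglongrightarrow> (0::real)" by simp
    show "\<forall>\<^sub>F k in sequentially. \<eta> k \<le> 1 / real (Suc k)"
      using \<eta>(2) by (intro always_eventually allI)
    show "\<forall>\<^sub>F k in sequentially. 0 \<le> \<eta> k"
      using \<eta>(1) by (intro always_eventually allI less_imp_le)
  qed
  define E where "E k = {x \<in> space Q. norm (J x) > \<eta> k}" for k
  define D where "D k = E (Suc k) - E k" for k
  have [measurable]: "E k \<in> sets Q" "D k \<in> sets Q" for k by (simp_all add: E_def D_def)
  have restr: "\<exists>\<mu>. prob_space \<mu> \<and> sets \<mu> = sets borel \<and>
      (\<forall>z. charfun \<mu> z = exp (CLINT x|density Q (indicator A). levy_khintchine_integrand z (J x)))"
    and finA: "finite_measure (density Q (indicator A))"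
    if [measurable]: "A \<in> sets Q" and A: "A \<subseteq> E k" for A k
  proof -
    \<comment> \<open>On jumps larger than \<open>\<eta> k\<close> the integrable function min 1
      (norm^2) is at least the square of \<open>\<eta> k\<close>, so such jumps have finite
      measure.\<close>
    have "ennreal ((\<eta> k)\<^sup>2) * indicator A x \<le> ennreal (?m x)" for x
      using A \<eta>(1,4)[of k] by (auto simp: indicator_def E_def intro!: ennreal_leI power_mono power_le_one)
    then have "(\<integral>\<^sup>+x. ennreal ((\<eta> k)\<^sup>2) * indicator A x \<partial>Q) < \<infinity>"
      using fin by (intro le_less_trans[OF nn_integral_mono fin]) auto
    then have "emeasure Q A < \<infinity>"
      using \<eta>(1)[of k] by (auto simp: nn_integral_cmult ennreal_mult_less_top)
    then show f: "finite_measure (density Q (indicator A))"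
      by (intro finite_measureI) (auto simp: emeasure_density less_top)
    show "\<exists>\<mu>. prob_space \<mu> \<and> sets \<mu> = sets borel \<and>
      (\<forall>z. charfun \<mu> z = exp (CLINT x|density Q (indicator A). levy_khintchine_integrand z (J x)))"
      by (rule levy_khintchine_finite_exists[OF f, of J]) auto
  qed
  have dens: "(CLINT x|density Q (indicator A). levy_khintchine_integrand z (J x)) =
      (CLINT x:A|Q. levy_khintchine_integrand z (J x))" if [measurable]: "A \<in> sets Q" for A z
  proof -
    have "density Q (indicator A) = density Q (\<lambda>x. ennreal (indicator A x))"
      by (simp add: ennreal_indicator)
    then show ?thesis
      unfolding set_lebesgue_integral_def by (simp add: integral_density)
  qed
  obtain \<mu>0 :: "'a measure" where \<mu>0: "prob_space \<mu>0" "sets \<mu>0 = sets borel"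
    "\<And>z. charfun \<mu>0 z = exp (CLINT x:E 0|Q. levy_khintchine_integrand z (J x))"
    using restr[of "E 0" 0] by (auto simp: dens)
  have "\<exists>\<mu>. \<forall>k. prob_space (\<mu> k) \<and> sets (\<mu> k) = sets borel \<and>
      (\<forall>z. charfun (\<mu> k) z = exp (CLINT x|density Q (indicator (D k)). levy_khintchine_integrand z (J x)))"
    by (rule choice) (use restr[OF _ Diff_subset] in \<open>auto simp: D_def\<close>)
  then obtain \<mu> :: "nat \<Rightarrow> 'a measure" where \<mu>: "\<And>k. prob_space (\<mu> k)" "\<And>k. sets (\<mu> k) = sets borel"
      "\<And>k z. charfun (\<mu> k) z = exp (CLINT x|density Q (indicator (D k)). levy_khintchine_integrand z (J x))"
    by blast
  have mom: "(\<integral>\<^sup>+x. ennreal (norm x) \<partial>\<mu> k) \<le> ennreal (3 * DIM('a) * (1/2) ^ k)" for k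
  proof (rule levy_khintchine_first_moment_le[OF _ _ _ _ _ \<mu>])
    show "finite_measure (density Q (indicator (D k)))"
      by (rule finA[of _ "Suc k"]) (auto simp: D_def)
    show "AE x in density Q (indicator (D k)). norm (J x) \<le> 1"
      using \<eta>(4)[of k] by (subst AE_density) (auto simp: D_def E_def indicator_def intro!: AE_I2)
    have "(\<integral>\<^sup>+x. ennreal ((norm (J x))\<^sup>2) \<partial>density Q (indicator (D k))) =
        (\<integral>\<^sup>+x. indicator (D k) x * ennreal ((norm (J x))\<^sup>2) \<partial>Q)"
      by (rule nn_integral_density) auto
    also have "\<dots> \<le> (\<integral>\<^sup>+x. ennreal (?m x * indicator {x. norm (J x) \<le> \<epsilon> k} x) \<partial>Q)"
      using \<eta>(3,4)[of k] by (intro nn_integral_mono) (auto simp: indicator_def D_def E_def power_le_one_iff min_def)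
    also have "\<dots> = ennreal (\<integral>x. ?m x * indicator {x. norm (J x) \<le> \<epsilon> k} x \<partial>Q)"
      by (intro nn_integral_eq_integral Bochner_Integration.integrable_bound[OF im]) (auto simp: indicator_def)
    also have "\<dots> \<le> ennreal (((1/2) ^ k)\<^sup>2)"
      using \<epsilon>(2)[of k] by (intro ennreal_leI) simp
    finally show "(\<integral>\<^sup>+x. ennreal ((norm (J x))\<^sup>2) \<partial>density Q (indicator (D k))) \<le> ennreal (((1/2) ^ k)\<^sup>2)" .
  qed auto
  obtain \<rho> :: "'a measure" where \<rho>: "prob_space \<rho>" "sets \<rho> = sets borel"
    "\<And>z. (\<lambda>n. \<Prod>k<n. charfun (\<mu> k) z) \<longlonglongrightarrow> charfun \<rho> z"
    using convergent_series_law_exists[of \<mu> "\<lambda>k. 3 * DIM('a) * (1/2) ^ k", OF \<mu>(1,2) mom]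
    by (auto intro!: summable_mult)
  obtain \<nu> :: "'a measure" where \<nu>: "prob_space \<nu>" "sets \<nu> = sets borel"
    "\<And>z. charfun \<nu> z = charfun \<mu>0 z * charfun \<rho> z"
    using charfun_add_exists[OF \<mu>0(1) \<rho>(1) \<mu>0(2) \<rho>(2)] by blast
  have "charfun \<nu> z = exp (CLINT x|Q. levy_khintchine_integrand z (J x))" for z
  proof -
    let ?F = "\<lambda>x. levy_khintchine_integrand z (J x)"
    have si: "set_integrable Q A ?F" if "A \<in> sets Q" for A
      using that intF unfolding set_integrable_def by (rule integrable_mult_indicator)
    \<comment> \<open>The shells are disjoint and fill up \<open>E n\<close>, so the exponents add
      up. In the limit only the points with J x = 0 are missed, where the integrand
      vanishes.\<close>
    have "charfun \<mu>0 z * (\<Prod>k<n. charfun (\<mu> k) z) = exp (CLINT x:E n|Q. ?F x)" for n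
    proof (induction n)
      case (Suc n)
      have "E (Suc n) = E n \<union> D n" using dec[of n] by (auto simp: D_def E_def)
      then have "(CLINT x:E (Suc n)|Q. ?F x) = (CLINT x:E n|Q. ?F x) + (CLINT x:D n|Q. ?F x)"
        using set_integral_Un[of "E n" "D n" Q ?F] si by (auto simp: D_def)
      with Suc show ?case
        by (simp add: exp_add dens \<mu>(3) mult.assoc[symmetric])
    qed (simp add: \<mu>0)
    then have 1: "(\<lambda>n. exp (CLINT x:E n|Q. ?F x)) \<longlonglongrightarrow> charfun \<nu> z"
      using tendsto_mult_left[OF \<rho>(3), of "charfun \<mu>0 z" z] by (simp add: \<nu>(3))
    have "(\<lambda>n. CLINT x:E n|Q. ?F x) \<longlonglongrightarrow> (CLINT x|Q. ?F x)"
      unfolding set_lebesgue_integral_def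
    proof (rule integral_dominated_convergence[where w="\<lambda>x. cmod (?F x)"])
      show "AE x in Q. (\<lambda>n. indicator (E n) x *\<^sub>R ?F x) \<longlonglongrightarrow> ?F x"
      proof (rule AE_I2)
        fix x assume x: "x \<in> space Q"
        show "(\<lambda>n. indicator (E n) x *\<^sub>R ?F x) \<longlonglongrightarrow> ?F x"
        proof (cases "J x = 0")
          case False
          have "\<forall>\<^sub>F n in sequentially. \<eta> n < norm (J x)"
            using False by (intro order_tendstoD[OF \<eta>0]) auto
          then have "\<forall>\<^sub>F n in sequentially. indicator (E n) x *\<^sub>R ?F x = ?F x"
            by eventually_elim (auto simp: E_def x)
          then show ?thesis by (rule tendsto_eventually)
        qed simp
      qed
    qed (use intF in \<open>auto simp: indicator_def\<close>)
    then have "(\<lambda>n. exp (CLINT x:E n|Q. ?F x)) \<longlonglongrightarrow> exp (CLINT x|Q. ?F x)"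
      by (rule tendsto_exp)
    with 1 show ?thesis by (rule LIMSEQ_unique)
  qed
  with \<nu> show ?thesis using that by blast
qed

subsection \<open>Integrals on the half line\<close>

text \<open>For nonnegative integrands the gauge integral, for which the fundamental theorem and
  Euler's integral are stated, agrees with the Lebesgue integral.\<close>

lemma nonneg_has_integral_imp_set_integrable:
  fixes f :: "real \<Rightarrow> real"
  assumes [measurable]: "A \<in> sets borel" "f \<in> borel_measurable borel"
    and nn: "\<And>x. x \<in> A \<Longrightarrow> 0 \<le> f x" and I: "(f has_integral I) A"
  shows "set_integrable lborel A f" "(LBINT x:A. f x) = I"
proof -
  have "(\<integral>\<^sup>+x. ennreal (indicator A x * f x) \<partial>lborel) = ennreal I"
    using nn_integral_has_integral_lebesgue[OF nn I] by simp
  moreover have "AE x in lborel. 0 \<le> indicator A x * f x"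
    using nn by (auto simp: indicator_def)
  ultimately show "set_integrable lborel A f"
    unfolding set_integrable_def by (intro integrableI_nonneg) auto
  then show "(LBINT x:A. f x) = I"
    using set_borel_integral_eq_integral(2) I by (metis integral_unique)
qed

text \<open>Substitute t = u^p in Euler's integral for the argument s / p.\<close>

lemma gamma_powr_integral:
  fixes p s :: real
  assumes p: "p > 0" and s: "s > 0"
  shows "set_integrable lborel {0<..} (\<lambda>u. u powr (s - 1) * exp (- (u powr p)))"
    and "(LBINT u:{0<..}. u powr (s - 1) * exp (- (u powr p))) = Gamma (s / p) / p"
proof -
  let ?f = "\<lambda>t::real. t powr (s / p - 1) / exp t"
  have img: "(\<lambda>u. u powr p) ` {0<..} = {0<..}"
  proof (intro equalityI subsetI)
    fix t :: real assume "t \<in> {0<..}"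
    then show "t \<in> (\<lambda>u. u powr p) ` {0<..}"
      using p by (intro image_eqI[of _ _ "t powr (1 / p)"]) (auto simp: powr_powr)
  qed auto
  have I0: "(?f has_integral Gamma (s / p)) {0..}"
    using p s by (intro Gamma_integral_real) simp
  have neg: "negligible {x \<in> {0..} - {0<..}. ?f x \<noteq> 0}" "negligible {x \<in> {0<..} - {0..}. ?f x \<noteq> 0}"
    by (rule negligible_subset[of "{0}"]; auto)+
  have f: "(?f has_integral Gamma (s / p)) {0<..}"
    using I0 unfolding has_integral_spike_set_eq[OF neg] .
  then have "?f absolutely_integrable_on {0<..}"
    by (intro nonnegative_absolutely_integrable_1) auto
  then have "(\<lambda>u. \<bar>p * u powr (p - 1)\<bar> * ?f (u powr p)) absolutely_integrable_on {0<..} \<and>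
      integral {0<..} (\<lambda>u. \<bar>p * u powr (p - 1)\<bar> * ?f (u powr p)) = Gamma (s / p)"
    using f p
  proof (subst has_absolute_integral_change_of_variables_1'[where g="\<lambda>u. u powr p"])
    show "inj_on (\<lambda>u. u powr p) {0<..}"
    proof (rule inj_onI)
      fix x y :: real assume "x \<in> {0<..}" "y \<in> {0<..}" "x powr p = y powr p"
      then show "x = y"
        using p powr_less_mono2[of p x y] powr_less_mono2[of p y x] by (cases x y rule: linorder_cases) auto
    qed
    fix u :: real assume "u \<in> {0<..}"
    then show "((\<lambda>u. u powr p) has_real_derivative p * u powr (p - 1)) (at u within {0<..})"
      by (auto intro!: derivative_eq_intros)
  qed (auto simp: img integral_unique)
  then have "((\<lambda>u. \<bar>p * u powr (p - 1)\<bar> * ?f (u powr p)) has_integral Gamma (s / p)) {0<..}"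
    by (auto simp: has_integral_iff absolutely_integrable_on_def)
  moreover have "\<bar>p * u powr (p - 1)\<bar> * ?f (u powr p) = p * (u powr (s - 1) * exp (- (u powr p)))" if "u > 0" for u
  proof -
    have "p - 1 + p * (s / p - 1) = s - 1" using p by (simp add: field_simps)
    then have "u powr (p - 1) * (u powr p) powr (s / p - 1) = u powr (s - 1)"
      by (simp only: powr_powr powr_add[symmetric])
    then show ?thesis using p by (simp add: exp_minus divide_inverse mult_ac)
  qed
  ultimately have "((\<lambda>u. p * (u powr (s - 1) * exp (- (u powr p)))) has_integral Gamma (s / p)) {0<..}"
    by (rule has_integral_eq[rotated]) simp
  from has_integral_mult_right[OF this, of "1 / p"]
  have I: "((\<lambda>u. u powr (s - 1) * exp (- (u powr p))) has_integral Gamma (s / p) / p) {0<..}"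
    using p by simp
  show "set_integrable lborel {0<..} (\<lambda>u. u powr (s - 1) * exp (- (u powr p)))"
    "(LBINT u:{0<..}. u powr (s - 1) * exp (- (u powr p))) = Gamma (s / p) / p"
    by (rule nonneg_has_integral_imp_set_integrable[OF _ _ _ I]; simp)+
qed

subsection \<open>The tempering kernel\<close>

text \<open>This is the degree of the compensator: after it is removed, \<open>ts_jump\<close> is of
  order \<open>ts_order \<alpha> + 1\<close> at 0 and at most of order
  \<open>ts_order \<alpha>\<close> at infinity. It is real because it is used as an
  exponent.\<close>

definition ts_order :: "real \<Rightarrow> real" where
  "ts_order \<alpha> = (if \<alpha> \<ge> 1 then 1 else 0)"

definition ts_kernel :: "real \<Rightarrow> real \<Rightarrow> real \<Rightarrow> real" where
  "ts_kernel p \<alpha> u = u powr (- 1 - \<alpha>) * exp (- (u powr p))"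

definition ts_jump :: "real \<Rightarrow> real \<Rightarrow> complex" where
  "ts_jump \<alpha> y = iexp y - 1 - (if \<alpha> \<ge> 1 then \<i> * complex_of_real y else 0)"

text \<open>This bound for \<open>ts_jump\<close> has the correct growth at 0 and at infinity.
  Unlike the jump function itself it is monotone and compatible with scaling.\<close>

definition ts_bound :: "real \<Rightarrow> real \<Rightarrow> real" where
  "ts_bound \<alpha> y = 2 * min (\<bar>y\<bar> powr ts_order \<alpha>) (\<bar>y\<bar> powr (ts_order \<alpha> + 1))"

lemma ts_measurable [measurable]:
  "ts_kernel p \<alpha> \<in> borel_measurable borel" "ts_jump \<alpha> \<in> borel_measurable borel"
  "ts_bound \<alpha> \<in> borel_measurable borel"
  unfolding ts_kernel_def[abs_def] ts_jump_def[abs_def] ts_bound_def[abs_def] by measurable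

lemma ts_order_cases: "ts_order \<alpha> = 0 \<or> ts_order \<alpha> = 1"
  by (simp add: ts_order_def)

lemma ts_order_nonneg [simp]: "0 \<le> ts_order \<alpha>"
  by (simp add: ts_order_def)

lemma ts_kernel_nonneg [simp]: "0 \<le> ts_kernel p \<alpha> u"
  by (simp add: ts_kernel_def)

lemma ts_bound_nonneg [simp]: "0 \<le> ts_bound \<alpha> y"
  by (simp add: ts_bound_def)

lemma norm_ts_jump_le: "cmod (ts_jump \<alpha> y) \<le> ts_bound \<alpha> y"
proof (cases "\<alpha> \<ge> 1")
  case True
  have y: "\<bar>y\<bar> powr 2 = y\<^sup>2" by (simp add: powr_numeral)
  have "cmod (ts_jump \<alpha> y) \<le> min (y\<^sup>2 / 2) (2 * \<bar>y\<bar>)"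
    using norm_iexp_minus_linear_le[of y] True by (simp add: ts_jump_def)
  also have "\<dots> \<le> min (2 * \<bar>y\<bar>) (2 * y\<^sup>2)"
    using zero_le_power2[of y] by linarith
  also have "\<dots> = ts_bound \<alpha> y"
    using True by (simp add: ts_bound_def ts_order_def y mult_min_right)
  finally show ?thesis .
next
  case False
  show ?thesis
  proof (cases "y = 0")
    case False
    then show ?thesis
      using norm_iexp_diff_one_le[of y] \<open>\<not> \<alpha> \<ge> 1\<close>
      by (auto simp: ts_jump_def ts_bound_def ts_order_def min_def split: if_splits)
  qed (simp add: ts_jump_def)
qed

lemma ts_bound_mono: "\<bar>y\<bar> \<le> \<bar>y'\<bar> \<Longrightarrow> ts_bound \<alpha> y \<le> ts_bound \<alpha> y'"
  unfolding ts_bound_def by (intro mult_left_mono min.mono powr_mono2) auto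

text \<open>For the degrees q = 0 and q = 1 the single constant (1 + \<bar>c\<bar>)^2 dominates both
  \<bar>c\<bar>^q and \<bar>c\<bar>^(q + 1).\<close>

lemma ts_bound_scale: "ts_bound \<alpha> (c * y) \<le> (1 + \<bar>c\<bar>)\<^sup>2 * ts_bound \<alpha> y"
proof -
  have c: "\<bar>c\<bar> powr ts_order \<alpha> \<le> (1 + \<bar>c\<bar>)\<^sup>2" "\<bar>c\<bar> powr (ts_order \<alpha> + 1) \<le> (1 + \<bar>c\<bar>)\<^sup>2"
    using ts_order_cases[of \<alpha>] by (auto simp: powr_numeral power2_eq_square algebra_simps)
  have "min (\<bar>c * y\<bar> powr ts_order \<alpha>) (\<bar>c * y\<bar> powr (ts_order \<alpha> + 1)) \<le>
    min ((1 + \<bar>c\<bar>)\<^sup>2 * \<bar>y\<bar> powr ts_order \<alpha>) ((1 + \<bar>c\<bar>)\<^sup>2 * \<bar>y\<bar> powr (ts_order \<alpha> + 1))"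
    unfolding abs_mult powr_mult using c by (intro min.mono mult_right_mono) auto
  then show ?thesis unfolding ts_bound_def by (simp add: mult_min_right[symmetric] mult.left_commute)
qed

text \<open>With this comparison, integrability of \<open>ts_bound\<close> implies the integrability
  condition on jumps in \<open>levy_khintchine_exists\<close>.\<close>

lemma powr_min_le_ts_bound:
  "0 \<le> y \<Longrightarrow> ts_bound \<alpha> y \<ge> min 1 (y\<^sup>2)"
proof (cases "y = 0")
  case False
  assume "0 \<le> y"
  then have "y > 0" using False by simp
  have "1 \<le> y \<Longrightarrow> 1 \<le> y\<^sup>2" "y \<le> 1 \<Longrightarrow> y\<^sup>2 \<le> y" "1 \<le> y \<Longrightarrow> y \<le> y\<^sup>2"
    using \<open>y > 0\<close> mult_mono[of 1 y 1 y] mult_left_mono[of y 1 y] mult_left_mono[of 1 y y]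
    by (simp_all add: power2_eq_square)
  then show ?thesis
    using ts_order_cases[of \<alpha>] \<open>y > 0\<close> linear[of y 1]
    by (auto simp: ts_bound_def powr_numeral min_def)
qed simp

text \<open>Near 0 the integrand is at most a multiple of u^(q - \<alpha>) for the degree q, and q -
  \<alpha> > -1: either \<alpha> < 1 and q = 0, or 1 \<le> \<alpha> < 2 and q = 1. At infinity the
  tempering wins.\<close>

lemma ts_kernel_bound_integrable_1:
  assumes p: "p > 0" and \<alpha>: "\<alpha> < 2"
  shows "set_integrable lborel {0<..} (\<lambda>u. ts_bound \<alpha> u * ts_kernel p \<alpha> u)"
proof -
  define q where "q = ts_order \<alpha>"
  have q: "q - \<alpha> > -1" using \<alpha> by (simp add: q_def ts_order_def)
  \<comment> \<open>The exponent q - \<alpha> may fail to be positive; enlarging it is harmless for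
    u > 1 and makes the comparison integral converge at 0 as well.\<close>
  define s where "s = max 1 (q - \<alpha>)"
  have "set_integrable lborel {0..1} (\<lambda>u. u powr (q - \<alpha>))"
    by (rule nonneg_has_integral_imp_set_integrable(1)[OF _ _ _ has_integral_powr_from_0[OF q]]) auto
  moreover have "set_integrable lborel {0<..} (\<lambda>u. u powr (s - 1) * exp (- (u powr p)))"
    by (rule gamma_powr_integral) (use p in \<open>auto simp: s_def\<close>)
  ultimately have "integrable lborel (\<lambda>u. 2 * (indicator {0..1} u *\<^sub>R u powr (q - \<alpha>)) +
      2 * (indicator {0<..} u *\<^sub>R (u powr (s - 1) * exp (- (u powr p)))))"
    unfolding set_integrable_def by (intro Bochner_Integration.integrable_add integrable_mult_right)
  then show ?thesis
    unfolding set_integrable_def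
  proof (rule Bochner_Integration.integrable_bound)
    show "AE u in lborel. norm (indicator {0<..} u *\<^sub>R (ts_bound \<alpha> u * ts_kernel p \<alpha> u)) \<le>
        norm (2 * (indicator {0..1} u *\<^sub>R u powr (q - \<alpha>)) +
      2 * (indicator {0<..} u *\<^sub>R (u powr (s - 1) * exp (- (u powr p)))))"
    proof (rule AE_I2)
      fix u :: real
      consider "u \<le> 0" | "0 < u" "u \<le> 1" | "u > 1" by linarith
      then show "norm (indicator {0<..} u *\<^sub>R (ts_bound \<alpha> u * ts_kernel p \<alpha> u)) \<le>
        norm (2 * (indicator {0..1} u *\<^sub>R u powr (q - \<alpha>)) +
          2 * (indicator {0<..} u *\<^sub>R (u powr (s - 1) * exp (- (u powr p)))))"
      proof cases
        case 2
        have "ts_bound \<alpha> u * ts_kernel p \<alpha> u \<le> 2 * u powr (q + 1) * (u powr (- 1 - \<alpha>) * 1)"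
          unfolding ts_bound_def ts_kernel_def q_def[symmetric] using 2 by (intro mult_mono) auto
        also have "\<dots> = 2 * u powr (q - \<alpha>)" using 2 by (simp add: powr_add[symmetric])
        finally show ?thesis using 2 by (simp add: abs_mult add_increasing2)
      next
        case 3
        have "ts_bound \<alpha> u * ts_kernel p \<alpha> u \<le> 2 * u powr q * (u powr (- 1 - \<alpha>) * exp (- (u powr p)))"
          unfolding ts_bound_def ts_kernel_def q_def[symmetric] using 3 by (intro mult_mono) auto
        also have "\<dots> = 2 * (u powr (q - \<alpha> - 1) * exp (- (u powr p)))"
          using 3 by (simp add: powr_add[symmetric] mult.assoc[symmetric]) (simp add: algebra_simps)
        also have "\<dots> \<le> 2 * (u powr (s - 1) * exp (- (u powr p)))"
          using 3 by (intro mult_left_mono mult_right_mono powr_mono) (auto simp: s_def)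
        finally show ?thesis using 3 by (simp add: abs_mult add_increasing)
      qed auto
    qed
  qed measurable
qed

lemma ts_kernel_bound_integrable:
  assumes "p > 0" "\<alpha> < 2"
  shows "set_integrable lborel {0<..} (\<lambda>u. ts_bound \<alpha> (u * S) * ts_kernel p \<alpha> u)"
proof (rule set_integrable_bound)
  show "set_integrable lborel {0<..} (\<lambda>u. (1 + \<bar>S\<bar>)\<^sup>2 * (ts_bound \<alpha> u * ts_kernel p \<alpha> u))"
    by (intro set_integrable_mult_right) (rule ts_kernel_bound_integrable_1[OF assms])
  show "AE u in lborel. u \<in> {0<..} \<longrightarrow> norm (ts_bound \<alpha> (u * S) * ts_kernel p \<alpha> u) \<le>
      norm ((1 + \<bar>S\<bar>)\<^sup>2 * (ts_bound \<alpha> u * ts_kernel p \<alpha> u))"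
  proof (rule AE_I2, rule impI)
    fix u :: real
    have "ts_bound \<alpha> (u * S) * ts_kernel p \<alpha> u \<le> ((1 + \<bar>S\<bar>)\<^sup>2 * ts_bound \<alpha> u) * ts_kernel p \<alpha> u"
      using ts_bound_scale[of \<alpha> S u] by (intro mult_right_mono) (auto simp: mult.commute)
    then show "norm (ts_bound \<alpha> (u * S) * ts_kernel p \<alpha> u) \<le> norm ((1 + \<bar>S\<bar>)\<^sup>2 * (ts_bound \<alpha> u * ts_kernel p \<alpha> u))"
      by (simp add: abs_mult mult.assoc)
  qed
qed (simp add: set_borel_measurable_def)

text \<open>It dominates the inner integral of the exponent when x \<bullet> z = S. Its growth in S
  decides which moments of the Rosinski measure are required.\<close>

definition ts_majorant :: "real \<Rightarrow> real \<Rightarrow> real \<Rightarrow> real" where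
  "ts_majorant p \<alpha> S = (LBINT u:{0<..}. ts_bound \<alpha> (u * S) * ts_kernel p \<alpha> u)"

lemma ts_majorant_measurable [measurable]: "ts_majorant p \<alpha> \<in> borel_measurable borel"
  unfolding ts_majorant_def[abs_def] set_lebesgue_integral_def by measurable

lemma ts_majorant_nonneg [simp]: "0 \<le> ts_majorant p \<alpha> S"
  unfolding ts_majorant_def set_lebesgue_integral_def by (intro integral_nonneg_AE) auto

lemma ts_majorant_mono:
  assumes "p > 0" "\<alpha> < 2" "\<bar>S\<bar> \<le> \<bar>S'\<bar>"
  shows "ts_majorant p \<alpha> S \<le> ts_majorant p \<alpha> S'"
  unfolding ts_majorant_def
  using assms(3) by (intro set_integral_mono ts_kernel_bound_integrable assms(1,2) mult_right_mono ts_bound_mono)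
    (auto simp: abs_mult mult_left_mono)

lemma ts_majorant_scale:
  assumes "p > 0" "\<alpha> < 2"
  shows "ts_majorant p \<alpha> (c * S) \<le> (1 + \<bar>c\<bar>)\<^sup>2 * ts_majorant p \<alpha> S"
proof -
  have "ts_majorant p \<alpha> (c * S) \<le> (LBINT u:{0<..}. (1 + \<bar>c\<bar>)\<^sup>2 * (ts_bound \<alpha> (u * S) * ts_kernel p \<alpha> u))"
    unfolding ts_majorant_def
  proof (intro set_integral_mono ts_kernel_bound_integrable assms(1,2) set_integrable_mult_right)
    fix u
    have "ts_bound \<alpha> (u * (c * S)) * ts_kernel p \<alpha> u \<le> ((1 + \<bar>c\<bar>)\<^sup>2 * ts_bound \<alpha> (u * S)) * ts_kernel p \<alpha> u"
      using ts_bound_scale[of \<alpha> c "u * S"] by (intro mult_right_mono) (auto simp: mult.left_commute)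
    then show "ts_bound \<alpha> (u * (c * S)) * ts_kernel p \<alpha> u \<le> (1 + \<bar>c\<bar>)\<^sup>2 * (ts_bound \<alpha> (u * S) * ts_kernel p \<alpha> u)"
      by (simp add: mult.assoc)
  qed
  then show ?thesis by (simp add: ts_majorant_def)
qed

text \<open>The case distinction of admissibility becomes one weight. For \<alpha> < 0 the constant
  1 is correct because R is finite.\<close>

definition ts_weight :: "real \<Rightarrow> real \<Rightarrow> real" where
  "ts_weight \<alpha> S = (if \<alpha> < 0 then 1 else if \<alpha> = 0 then ln S else if \<alpha> = 1 then S * ln S else S powr \<alpha>)"

text \<open>The integral is split at u = 1 / S and u = 1. The higher power in
  \<open>ts_bound\<close> is used below 1 / S, the lower one between 1 / S and 1, and the tempering
  factor above 1. For the degree q the middle range gives S^q times an integral of u^(q - \<alpha> -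
  1), which is logarithmic for \<alpha> = q; this is where the logarithms in admissibility for
  \<alpha> = 0 and \<alpha> = 1 come from.\<close>

lemma ts_majorant_le_weight:
  assumes p: "p > 0" and \<alpha>: "\<alpha> < 2"
  obtains C where "\<And>S. 2 \<le> S \<Longrightarrow> ts_majorant p \<alpha> S \<le> C * ts_weight \<alpha> S"
proof -
  define q where "q = ts_order \<alpha>"
  have q: "q - \<alpha> > -1" "q = 0 \<or> q = 1" using \<alpha> by (auto simp: q_def ts_order_def)
  define s where "s = max 1 (q - \<alpha>)"
  define K where "K = Gamma (s / p) / p"
  have s: "s > 0" by (simp add: s_def)
  have K: "K \<ge> 0" using p s by (auto simp: K_def intro!: divide_nonneg_pos Gamma_real_nonneg)
  \<comment> \<open>This is the integral of u^(q - \<alpha> - 1) over [1 / S, 1], with the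
    logarithmic case separated.\<close>
  define A where "A S = (if \<alpha> = q then ln S else (1 - (1 / S) powr (q - \<alpha>)) / (q - \<alpha>))" for S
  have main: "ts_majorant p \<alpha> S \<le> 2 * S powr \<alpha> / (q - \<alpha> + 1) + 2 * S powr q * A S + 2 * S powr q * K"
    if S: "2 \<le> S" for S
  proof -
    have i1: "((\<lambda>u. u powr (q - \<alpha>)) has_integral (1 / S) powr (q - \<alpha> + 1) / (q - \<alpha> + 1)) {0..1 / S}"
      using S by (intro has_integral_powr_from_0[OF q(1)]) simp
    have i2: "((\<lambda>u. u powr (q - \<alpha> - 1)) has_integral A S) {1 / S..1}"
    proof (cases "\<alpha> = q")
      case True
      have "((\<lambda>u. u powr -1) has_integral ln 1 - ln (1 / S)) {1 / S..1}"
      proof (rule fundamental_theorem_of_calculus)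
        fix u assume "u \<in> {1 / S..1}"
        then have "u > 0" using S by (auto intro: less_le_trans[of 0 "1 / S"])
        then show "(ln has_vector_derivative u powr - 1) (at u within {1 / S..1})"
          by (auto intro!: derivative_eq_intros simp: powr_minus_divide divide_inverse
              simp flip: has_real_derivative_iff_has_vector_derivative)
      qed (use S in simp)
      then show ?thesis using True S by (simp add: A_def ln_div)
    next
      case False
      have "((\<lambda>u. u powr (q - \<alpha> - 1)) has_integral 1 powr (q - \<alpha>) / (q - \<alpha>) - (1 / S) powr (q - \<alpha>) / (q - \<alpha>)) {1 / S..1}"
      proof (rule fundamental_theorem_of_calculus)
        fix u assume "u \<in> {1 / S..1}"
        then have "u > 0" using S by (auto intro: less_le_trans[of 0 "1 / S"])
        then show "((\<lambda>u. u powr (q - \<alpha>) / (q - \<alpha>)) has_vector_derivative u powr (q - \<alpha> - 1)) (at u within {1 / S..1})"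
          using False by (auto intro!: derivative_eq_intros
              simp flip: has_real_derivative_iff_has_vector_derivative)
      qed (use S in simp)
      then show ?thesis using False by (simp add: A_def diff_divide_distrib)
    qed
    note si1 = nonneg_has_integral_imp_set_integrable[OF _ _ _ i1]
    note si2 = nonneg_has_integral_imp_set_integrable[OF _ _ _ i2]
    note si3 = gamma_powr_integral[OF p s]
    let ?g = "\<lambda>u. 2 * S powr (q + 1) * (indicator {0..1 / S} u *\<^sub>R u powr (q - \<alpha>)) +
       (2 * S powr q * (indicator {1 / S..1} u *\<^sub>R u powr (q - \<alpha> - 1)) +
       2 * S powr q * (indicator {0<..} u *\<^sub>R (u powr (s - 1) * exp (- (u powr p)))))"
    have int: "integrable lborel (\<lambda>u. indicator {0..1 / S} u *\<^sub>R u powr (q - \<alpha>))"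
      "integrable lborel (\<lambda>u. indicator {1 / S..1} u *\<^sub>R u powr (q - \<alpha> - 1))"
      "integrable lborel (\<lambda>u. indicator {0<..} u *\<^sub>R (u powr (s - 1) * exp (- (u powr p))))"
      using si1(1) si2(1) si3(1) unfolding set_integrable_def by auto
    have "ts_majorant p \<alpha> S \<le> (\<integral>u. ?g u \<partial>lborel)"
      unfolding ts_majorant_def set_lebesgue_integral_def
    proof (rule integral_mono)
      show "integrable lborel (\<lambda>u. indicator {0<..} u *\<^sub>R (ts_bound \<alpha> (u * S) * ts_kernel p \<alpha> u))"
        using ts_kernel_bound_integrable[OF p \<alpha>] by (simp add: set_integrable_def)
      show "integrable lborel ?g"
        by (intro Bochner_Integration.integrable_add integrable_mult_right int)
      fix u :: real
      have g0: "0 \<le> 2 * S powr (q + 1) * (indicator {0..1 / S} u *\<^sub>R u powr (q - \<alpha>))"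
        "0 \<le> 2 * S powr q * (indicator {1 / S..1} u *\<^sub>R u powr (q - \<alpha> - 1))"
        "0 \<le> 2 * S powr q * (indicator {0<..} u *\<^sub>R (u powr (s - 1) * exp (- (u powr p))))"
        by auto
      consider "u \<le> 0" | "0 < u" "u \<le> 1 / S" | "1 / S < u" "u \<le> 1" | "1 < u" by linarith
      then show "indicator {0<..} u *\<^sub>R (ts_bound \<alpha> (u * S) * ts_kernel p \<alpha> u) \<le> ?g u"
      proof cases
        case 1 then show ?thesis using g0 by simp
      next
        case 2
        have "ts_bound \<alpha> (u * S) * ts_kernel p \<alpha> u \<le> 2 * (u * S) powr (q + 1) * (u powr (- 1 - \<alpha>) * 1)"
          unfolding ts_bound_def ts_kernel_def q_def[symmetric] using 2 S by (intro mult_mono) auto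
        also have "\<dots> = 2 * S powr (q + 1) * u powr (q - \<alpha>)"
          using 2 S by (simp add: powr_mult powr_add[symmetric])
        finally have le: "ts_bound \<alpha> (u * S) * ts_kernel p \<alpha> u \<le> 2 * S powr (q + 1) * u powr (q - \<alpha>)" .
        have ind: "indicator {0..1 / S} u *\<^sub>R u powr (q - \<alpha>) = u powr (q - \<alpha>)"
          "indicator {0<..} u *\<^sub>R (ts_bound \<alpha> (u * S) * ts_kernel p \<alpha> u) = ts_bound \<alpha> (u * S) * ts_kernel p \<alpha> u"
          using 2 by simp_all
        show ?thesis unfolding ind(1) ind(2) using le g0(2,3) by linarith
      next
        case 3
        then have u: "u > 0" using S by (auto intro: less_trans[of 0 "1 / S"])
        have "ts_bound \<alpha> (u * S) * ts_kernel p \<alpha> u \<le> 2 * (u * S) powr q * (u powr (- 1 - \<alpha>) * 1)"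
          unfolding ts_bound_def ts_kernel_def q_def[symmetric] using u S by (intro mult_mono) auto
        also have "\<dots> = 2 * S powr q * (u powr q * u powr (- 1 - \<alpha>))"
          using u S by (simp add: powr_mult)
        also have "u powr q * u powr (- 1 - \<alpha>) = u powr (q - \<alpha> - 1)"
          by (simp add: powr_add[symmetric] algebra_simps)
        finally have le: "ts_bound \<alpha> (u * S) * ts_kernel p \<alpha> u \<le> 2 * S powr q * u powr (q - \<alpha> - 1)" .
        have ind: "indicator {1 / S..1} u *\<^sub>R u powr (q - \<alpha> - 1) = u powr (q - \<alpha> - 1)"
          "indicator {0<..} u *\<^sub>R (ts_bound \<alpha> (u * S) * ts_kernel p \<alpha> u) = ts_bound \<alpha> (u * S) * ts_kernel p \<alpha> u"
          using 3 u by simp_all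
        show ?thesis unfolding ind(1) ind(2) using le g0(1,3) by linarith
      next
        case 4
        have "ts_bound \<alpha> (u * S) * ts_kernel p \<alpha> u \<le> 2 * (u * S) powr q * (u powr (- 1 - \<alpha>) * exp (- (u powr p)))"
          unfolding ts_bound_def ts_kernel_def q_def[symmetric] using 4 S by (intro mult_mono) auto
        also have "\<dots> = 2 * S powr q * ((u powr q * u powr (- 1 - \<alpha>)) * exp (- (u powr p)))"
          using 4 S by (simp add: powr_mult)
        also have "u powr q * u powr (- 1 - \<alpha>) = u powr (q - \<alpha> - 1)"
          by (simp add: powr_add[symmetric] algebra_simps)
        also have "2 * S powr q * (u powr (q - \<alpha> - 1) * exp (- (u powr p))) \<le> 2 * S powr q * (u powr (s - 1) * exp (- (u powr p)))"
          using 4 by (intro mult_left_mono mult_right_mono powr_mono) (auto simp: s_def)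
        finally have le: "ts_bound \<alpha> (u * S) * ts_kernel p \<alpha> u \<le> 2 * S powr q * (u powr (s - 1) * exp (- (u powr p)))" .
        have ind: "indicator {0<..} u *\<^sub>R (u powr (s - 1) * exp (- (u powr p))) = u powr (s - 1) * exp (- (u powr p))"
          "indicator {0<..} u *\<^sub>R (ts_bound \<alpha> (u * S) * ts_kernel p \<alpha> u) = ts_bound \<alpha> (u * S) * ts_kernel p \<alpha> u"
          using 4 by simp_all
        show ?thesis unfolding ind(1) ind(2) using le g0(1,2) by linarith
      qed
    qed
    also have "\<dots> = 2 * S powr (q + 1) * ((1 / S) powr (q - \<alpha> + 1) / (q - \<alpha> + 1)) + (2 * S powr q * A S + 2 * S powr q * K)"
      using int si1(2) si2(2) si3(2) unfolding set_lebesgue_integral_def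
      by (simp add: K_def)
    also have "2 * S powr (q + 1) * ((1 / S) powr (q - \<alpha> + 1) / (q - \<alpha> + 1)) = 2 * S powr \<alpha> / (q - \<alpha> + 1)"
    proof -
      have "S powr (q + 1) = S powr \<alpha> * S powr (q - \<alpha> + 1)" by (simp add: powr_add[symmetric])
      then show ?thesis using S by (simp add: powr_divide)
    qed
    finally show ?thesis by simp
  qed
  have ln2: "ln 2 \<le> ln S" if "2 \<le> S" for S :: real using that by simp
  have ln2p: "(0::real) < ln 2" by simp
  \<comment> \<open>The degree 1 occurs only for 1 \<le> \<alpha>, so \<alpha> < q leaves nothing
    but negative \<alpha>.\<close>
  have "q = 0 \<or> q = 1 \<and> 1 \<le> \<alpha>" by (simp add: q_def ts_order_def)
  then consider "\<alpha> < 0" | "\<alpha> = q" | "q < \<alpha>" by linarith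
  then show ?thesis
  proof cases
    case 1
    then have q0: "q = 0" by (simp add: q_def ts_order_def)
    have "ts_majorant p \<alpha> S \<le> (2 / (q - \<alpha> + 1) + 2 / (- \<alpha>) + 2 * K) * ts_weight \<alpha> S" if S: "2 \<le> S" for S
    proof -
      have "S powr \<alpha> \<le> 1" using S 1 powr_mono[of \<alpha> 0 S] by simp
      then have "2 * S powr \<alpha> / (q - \<alpha> + 1) \<le> 2 / (q - \<alpha> + 1)"
        using q by (intro divide_right_mono) auto
      moreover have "A S \<le> 1 / (- \<alpha>)"
      proof -
        have "A S = (1 - (1 / S) powr (- \<alpha>)) / (- \<alpha>)" using 1 q0 by (simp add: A_def)
        also have "\<dots> \<le> 1 / (- \<alpha>)" by (rule divide_right_mono) (use 1 in simp_all)
        finally show ?thesis .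
      qed
      ultimately show ?thesis using main[OF S] 1 q0 S by (simp add: ts_weight_def)
    qed
    then show ?thesis by (rule that)
  next
    case 2
    have "ts_majorant p \<alpha> S \<le> (2 / ln 2 + 2 + 2 * K / ln 2) * ts_weight \<alpha> S" if S: "2 \<le> S" for S
    proof -
      have w: "ts_weight \<alpha> S = S powr q * ln S" using 2 q S by (auto simp: ts_weight_def)
      have "1 \<le> ln S / ln 2" using ln2[OF S] ln2p by (simp add: pos_le_divide_eq)
      then have "1 * (2 * S powr q + 2 * S powr q * K) \<le> ln S / ln 2 * (2 * S powr q + 2 * S powr q * K)"
        using K by (intro mult_right_mono) auto
      then show ?thesis using main[OF S] 2 unfolding w by (simp add: A_def algebra_simps)
    qed
    then show ?thesis by (rule that)
  next
    case 3
    have "ts_majorant p \<alpha> S \<le> (2 / (q - \<alpha> + 1) + 2 / (\<alpha> - q) + 2 * K) * ts_weight \<alpha> S" if S: "2 \<le> S" for S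
    proof -
      have w: "ts_weight \<alpha> S = S powr \<alpha>"
        using 3 q \<alpha> by (auto simp: ts_weight_def q_def ts_order_def split: if_splits)
      have "A S \<le> S powr (\<alpha> - q) / (\<alpha> - q)"
      proof -
        have e: "(1 / S) powr (q - \<alpha>) = S powr (\<alpha> - q)"
          using S by (simp add: powr_divide powr_minus_divide[symmetric])
        have "(1 - S powr (\<alpha> - q)) / (q - \<alpha>) = (S powr (\<alpha> - q) - 1) / (\<alpha> - q)"
          using 3 by (simp add: field_simps)
        also have "\<dots> \<le> S powr (\<alpha> - q) / (\<alpha> - q)" using 3 by (intro divide_right_mono) auto
        finally show ?thesis using 3 e by (simp add: A_def)
      qed
      then have "2 * S powr q * A S \<le> 2 * S powr q * (S powr (\<alpha> - q) / (\<alpha> - q))"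
        by (intro mult_left_mono) auto
      also have "\<dots> = 2 / (\<alpha> - q) * S powr \<alpha>" using S by (simp add: powr_diff)
      finally have a: "2 * S powr q * A S \<le> 2 / (\<alpha> - q) * S powr \<alpha>" .
      have "S powr q \<le> S powr \<alpha>" using S 3 by (intro powr_mono) auto
      then have "2 * S powr q * K \<le> 2 * S powr \<alpha> * K" using K by (intro mult_right_mono) auto
      then show ?thesis using main[OF S] a unfolding w by (simp add: algebra_simps)
    qed
    then show ?thesis by (rule that)
  qed
qed

subsection \<open>Rosinski measures\<close>

lemma rosinski_measure_iff_weight:
  assumes "\<alpha> < 2"
  shows "rosinski_measure \<alpha> R \<longleftrightarrow> sets R = sets borel \<and> finite_measure R \<and> emeasure R {0} = 0 \<and>
    set_integrable R {x. norm x > 2} (\<lambda>x. ts_weight \<alpha> (norm x))"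
proof -
  have "set_integrable R {x. norm x > 2} (\<lambda>x. 1::real)" if "finite_measure R" "sets R = sets borel"
  proof -
    interpret finite_measure R by fact
    note [measurable_cong] = that(2)
    show ?thesis unfolding set_integrable_def
      by (intro integrable_const_bound[of _ 1]) (auto simp: indicator_def)
  qed
  note one = this
  consider "\<alpha> < 0" | "\<alpha> = 0" | "\<alpha> = 1" | "0 < \<alpha>" "\<alpha> \<noteq> 1" by linarith
  then show ?thesis
    by cases (use assms one in \<open>auto simp: rosinski_measure_def ts_weight_def\<close>)
qed

lemma rosinski_measureD:
  assumes "rosinski_measure \<alpha> R"
  shows "sets R = sets borel" "finite_measure R" "emeasure R {0} = 0"
  using assms by (auto simp: rosinski_measure_def)

lemma ts_majorant_integrable:
  fixes R :: "'a::euclidean_space measure"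
  assumes R: "rosinski_measure \<alpha> R" and p: "p > 0" and \<alpha>: "\<alpha> < 2"
  shows "integrable R (\<lambda>x. ts_majorant p \<alpha> (norm x))"
proof -
  note [measurable_cong] = rosinski_measureD(1)[OF R]
  interpret finite_measure R by (rule rosinski_measureD(2)[OF R])
  obtain C where C: "\<And>S. 2 \<le> S \<Longrightarrow> ts_majorant p \<alpha> S \<le> C * ts_weight \<alpha> S"
    using ts_majorant_le_weight[OF p \<alpha>] by blast
  have w: "set_integrable R {x. norm x > 2} (\<lambda>x. ts_weight \<alpha> (norm x))"
    using R rosinski_measure_iff_weight[OF \<alpha>] by blast
  have "integrable R (\<lambda>x. ts_majorant p \<alpha> 2 + C * (indicator {x. norm x > 2} x *\<^sub>R ts_weight \<alpha> (norm x)))"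
    using w unfolding set_integrable_def by (intro Bochner_Integration.integrable_add integrable_mult_right) auto
  then show ?thesis
  proof (rule Bochner_Integration.integrable_bound)
    show "AE x in R. norm (ts_majorant p \<alpha> (norm x)) \<le>
        norm (ts_majorant p \<alpha> 2 + C * (indicator {x. norm x > 2} x *\<^sub>R ts_weight \<alpha> (norm x)))"
    proof (rule AE_I2)
      fix x :: 'a
      show "norm (ts_majorant p \<alpha> (norm x)) \<le>
        norm (ts_majorant p \<alpha> 2 + C * (indicator {x. norm x > 2} x *\<^sub>R ts_weight \<alpha> (norm x)))"
      proof (cases "norm x > 2")
        case True
        then have "ts_majorant p \<alpha> (norm x) \<le> C * ts_weight \<alpha> (norm x)" using C[of "norm x"] by simp
        then have "ts_majorant p \<alpha> (norm x) \<le> ts_majorant p \<alpha> 2 + C * ts_weight \<alpha> (norm x)"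
          using ts_majorant_nonneg[of p \<alpha> 2] by linarith
        then show ?thesis using True by simp
      next
        case False
        then show ?thesis using ts_majorant_mono[OF p \<alpha>, of "norm x" 2] by simp
      qed
    qed
  qed measurable
qed

lemma rosinski_measure_scale:
  assumes R: "rosinski_measure \<alpha> R" and "\<alpha> < 2" "0 \<le> c"
  shows "rosinski_measure \<alpha> (scale_measure (ennreal c) R)"
proof -
  have "finite_measure (scale_measure (ennreal c) R)"
    using rosinski_measureD(2)[OF R]
    by (intro finite_measureI) (simp add: space_scale_measure ennreal_mult_eq_top_iff finite_measure.emeasure_finite)
  then show ?thesis
    using R assms unfolding rosinski_measure_iff_weight[OF \<open>\<alpha> < 2\<close>] set_integrable_def
    by (auto intro!: integrable_scale_measure)
qed

text \<open>The variables X_n have the smaller orders \<alpha> - n p, but their Rosinski measures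
  are multiples of the same \<open>R\<close>. The weights are comparable beyond norm 2, a cutoff
  that keeps the logarithm away from 0.\<close>

lemma rosinski_measure_mono:
  assumes R: "rosinski_measure \<alpha> R" and "\<beta> \<le> \<alpha>" "\<alpha> < 2"
  shows "rosinski_measure \<beta> R"
proof -
  note [measurable_cong] = rosinski_measureD(1)[OF R]
  have *: "\<exists>C. \<forall>S\<ge>2. ts_weight \<beta> S \<le> C * ts_weight \<alpha> S" if "\<beta> < \<alpha>"
  proof -
    have ln2: "(0::real) < ln 2" by simp
    have ln1: "1 \<le> ln S / ln 2" if "2 \<le> S" for S :: real
      using that ln2 by (simp add: pos_le_divide_eq)
    have lnp: "ln S \<le> S powr \<delta> / \<delta>" if "2 \<le> S" "0 < \<delta>" for S \<delta> :: real
      by (rule ln_powr_bound) (use that in auto)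
    have ge1: "1 \<le> S powr a" if "2 \<le> S" "0 \<le> a" for S a :: real
      using that by (simp add: ge_one_powr_ge_zero)
    consider "\<alpha> < 0" | "\<alpha> = 0" | "\<alpha> = 1" | "0 < \<alpha>" "\<alpha> \<noteq> 1" by linarith
    then show ?thesis
    proof cases
      case 1
      then show ?thesis using \<open>\<beta> < \<alpha>\<close> by (intro exI[of _ 1]) (simp add: ts_weight_def)
    next
      case 2
      then show ?thesis using \<open>\<beta> < \<alpha>\<close> ln1 by (intro exI[of _ "1 / ln 2"]) (simp add: ts_weight_def)
    next
      case 3
      have "ts_weight \<beta> S \<le> (1 / ln 2 + 1) * ts_weight \<alpha> S" if S: "2 \<le> S" for S
      proof -
        have "ts_weight \<beta> S \<le> max S (ln S)"
          using S ge1[OF S, of 1] powr_mono[of \<beta> 1 S] ln_le_minus_one[of S] \<open>\<beta> < \<alpha>\<close> 3 by (auto simp: ts_weight_def le_max_iff_disj)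
        also have "\<dots> \<le> S * (ln S / ln 2) + S * ln S"
        proof (rule max.boundedI)
          have "0 \<le> ln S" using S by simp
          have "S * 1 \<le> S * (ln S / ln 2)" using S ln1[OF S] by (intro mult_left_mono) auto
          then show "S \<le> S * (ln S / ln 2) + S * ln S" using S \<open>0 \<le> ln S\<close> by (simp add: add_increasing2)
          have "1 * ln S \<le> S * ln S" using S \<open>0 \<le> ln S\<close> by (intro mult_right_mono) auto
          then show "ln S \<le> S * (ln S / ln 2) + S * ln S" using S \<open>0 \<le> ln S\<close> by (simp add: add_increasing)
        qed
        finally show ?thesis using 3 by (simp add: ts_weight_def algebra_simps)
      qed
      then show ?thesis by blast
    next
      case 4
      have "ts_weight \<beta> S \<le> (1 + 1 / \<alpha> + 1 / \<bar>\<alpha> - 1\<bar>) * ts_weight \<alpha> S" if S: "2 \<le> S" for S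
      proof -
        have w: "ts_weight \<alpha> S = S powr \<alpha>" using 4 by (simp add: ts_weight_def)
        have nn: "0 \<le> 1 / \<alpha> * S powr \<alpha>" "0 \<le> 1 / \<bar>\<alpha> - 1\<bar> * S powr \<alpha>" "0 \<le> S powr \<alpha>" using 4 by auto
        consider "\<beta> < 0" | "\<beta> = 0" | "\<beta> = 1" | "0 < \<beta>" "\<beta> \<noteq> 1" by linarith
        then have "ts_weight \<beta> S \<le> S powr \<alpha> + 1 / \<alpha> * S powr \<alpha> + 1 / \<bar>\<alpha> - 1\<bar> * S powr \<alpha>"
        proof cases
          case 1
          then have "ts_weight \<beta> S = 1" by (simp add: ts_weight_def)
          then show ?thesis using ge1[OF S, of \<alpha>] 4 nn by linarith
        next
          case 2
          then have "ts_weight \<beta> S = ln S" by (simp add: ts_weight_def)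
          moreover have "ln S \<le> 1 / \<alpha> * S powr \<alpha>" using lnp[OF S, of \<alpha>] 4 by simp
          ultimately show ?thesis using nn by linarith
        next
          case 3
          then have "ts_weight \<beta> S = S * ln S" by (simp add: ts_weight_def)
          also have "\<dots> \<le> S * (S powr (\<alpha> - 1) / (\<alpha> - 1))"
            using S 3 \<open>\<beta> < \<alpha>\<close> by (intro mult_left_mono lnp) auto
          also have "\<dots> = 1 / \<bar>\<alpha> - 1\<bar> * S powr \<alpha>" using S 3 \<open>\<beta> < \<alpha>\<close> by (simp add: powr_diff)
          finally show ?thesis using nn by linarith
        next
          case 4
          then have "ts_weight \<beta> S = S powr \<beta>" by (simp add: ts_weight_def)
          also have "\<dots> \<le> S powr \<alpha>" using S \<open>\<beta> < \<alpha>\<close> by (intro powr_mono) auto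
          finally show ?thesis using nn by linarith
        qed
        then show ?thesis unfolding w by (simp add: algebra_simps)
      qed
      then show ?thesis by blast
    qed
  qed
  show ?thesis
  proof (cases "\<beta> = \<alpha>")
    case False
    then obtain C where C: "\<And>S. 2 \<le> S \<Longrightarrow> ts_weight \<beta> S \<le> C * ts_weight \<alpha> S"
      using * assms(2) by force
    have nn: "0 \<le> ts_weight \<beta> S" if "2 \<le> S" for S using that by (simp add: ts_weight_def)
    have [measurable]: "ts_weight \<beta> \<in> borel_measurable borel"
      unfolding ts_weight_def[abs_def] by measurable
    have w: "set_integrable R {x. norm x > 2} (\<lambda>x. ts_weight \<alpha> (norm x))"
      using R rosinski_measure_iff_weight[OF \<open>\<alpha> < 2\<close>] by blast
    have "set_integrable R {x. norm x > 2} (\<lambda>x. ts_weight \<beta> (norm x))"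
    proof (rule set_integrable_bound)
      show "set_integrable R {x. norm x > 2} (\<lambda>x. C * ts_weight \<alpha> (norm x))"
        using w by (rule set_integrable_mult_right)
      show "set_borel_measurable R {x. 2 < norm x} (\<lambda>x. ts_weight \<beta> (norm x))"
        unfolding set_borel_measurable_def by measurable
      show "AE x in R. x \<in> {x. 2 < norm x} \<longrightarrow> norm (ts_weight \<beta> (norm x)) \<le> norm (C * ts_weight \<alpha> (norm x))"
      proof (rule AE_I2, rule impI)
        fix x :: 'a assume "x \<in> {x. 2 < norm x}"
        then show "norm (ts_weight \<beta> (norm x)) \<le> norm (C * ts_weight \<alpha> (norm x))"
          using C[of "norm x"] nn[of "norm x"] by simp
      qed
    qed
    then show ?thesis
      using R assms rosinski_measure_iff_weight[of \<beta> R] by (simp add: rosinski_measureD[OF R])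
  qed (use R in simp)
qed

subsection \<open>The exponent of a tempered stable law\<close>

definition ts_integral :: "real \<Rightarrow> real \<Rightarrow> real \<Rightarrow> complex" where
  "ts_integral p \<alpha> s = (CLBINT u:{0<..}. ts_jump \<alpha> (u * s) * complex_of_real (ts_kernel p \<alpha> u))"

lemma ts_integral_measurable [measurable]: "ts_integral p \<alpha> \<in> borel_measurable borel"
  unfolding ts_integral_def[abs_def] set_lebesgue_integral_def by measurable

lemma norm_ts_integrand_le:
  "cmod (ts_jump \<alpha> (u * s) * complex_of_real (ts_kernel p \<alpha> u)) \<le> ts_bound \<alpha> (u * s) * ts_kernel p \<alpha> u"
  unfolding norm_mult norm_of_real by (simp add: mult_right_mono norm_ts_jump_le)

lemma ts_integrand_integrable:
  assumes "p > 0" "\<alpha> < 2"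
  shows "set_integrable lborel {0<..} (\<lambda>u. ts_jump \<alpha> (u * s) * complex_of_real (ts_kernel p \<alpha> u))"
  by (rule set_integrable_bound[OF ts_kernel_bound_integrable[OF assms, of s]])
     (auto simp: set_borel_measurable_def intro!: AE_I2 order_trans[OF norm_ts_integrand_le])

lemma norm_ts_integral_le:
  assumes "p > 0" "\<alpha> < 2"
  shows "cmod (ts_integral p \<alpha> s) \<le> ts_majorant p \<alpha> s"
  unfolding ts_integral_def ts_majorant_def set_lebesgue_integral_def
proof (rule order_trans[OF integral_norm_bound integral_mono_AE])
  show "integrable lborel (\<lambda>u. norm (indicator {0<..} u *\<^sub>R (ts_jump \<alpha> (u * s) * complex_of_real (ts_kernel p \<alpha> u))))"
    using ts_integrand_integrable[OF assms] unfolding set_integrable_def by (rule integrable_norm)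
  show "integrable lborel (\<lambda>u. indicator {0<..} u *\<^sub>R (ts_bound \<alpha> (u * s) * ts_kernel p \<alpha> u))"
    using ts_kernel_bound_integrable[OF assms] unfolding set_integrable_def .
  show "AE u in lborel. norm (indicator {0<..} u *\<^sub>R (ts_jump \<alpha> (u * s) * complex_of_real (ts_kernel p \<alpha> u)))
    \<le> indicator {0<..} u *\<^sub>R (ts_bound \<alpha> (u * s) * ts_kernel p \<alpha> u)"
    unfolding norm_scaleR by (intro AE_I2) (auto simp: indicator_def intro: norm_ts_integrand_le)
qed

lemma ts_jump_0 [simp]: "ts_jump \<alpha> 0 = 0"
  by (simp add: ts_jump_def)

lemma ts_integral_0 [simp]: "ts_integral p \<alpha> 0 = 0"
  by (simp add: ts_integral_def)

lemma continuous_ts_jump: "continuous_on S (ts_jump \<alpha>)"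
  unfolding ts_jump_def[abs_def] by (cases "\<alpha> \<ge> 1") (auto intro!: continuous_intros)

lemma continuous_ts_integral:
  assumes "p > 0" "\<alpha> < 2"
  shows "continuous_on UNIV (ts_integral p \<alpha>)"
  unfolding continuous_on_sequentially
proof safe
  fix X :: "nat \<Rightarrow> real" and s assume X: "X \<longlonglongrightarrow> s"
  then obtain K where K: "\<And>n. \<bar>X n\<bar> \<le> K"
    using convergent_imp_Bseq[of X] by (auto simp: convergent_def Bseq_def)
  then have K': "\<bar>X n\<bar> \<le> \<bar>K\<bar>" for n by (meson abs_ge_self order_trans)
  show "(ts_integral p \<alpha> \<circ> X) \<longlonglongrightarrow> ts_integral p \<alpha> s"
    unfolding comp_def ts_integral_def set_lebesgue_integral_def
  proof (rule integral_dominated_convergence)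
    show "integrable lborel (\<lambda>u. indicator {0<..} u *\<^sub>R (ts_bound \<alpha> (u * K) * ts_kernel p \<alpha> u))"
      using ts_kernel_bound_integrable[OF assms] unfolding set_integrable_def .
    show "AE u in lborel. (\<lambda>n. indicator {0<..} u *\<^sub>R (ts_jump \<alpha> (u * X n) * complex_of_real (ts_kernel p \<alpha> u)))
        \<longlonglongrightarrow> indicator {0<..} u *\<^sub>R (ts_jump \<alpha> (u * s) * complex_of_real (ts_kernel p \<alpha> u))"
    proof (rule AE_I2)
      fix u
      have "(\<lambda>n. ts_jump \<alpha> (u * X n)) \<longlonglongrightarrow> ts_jump \<alpha> (u * s)"
        by (rule continuous_on_tendsto_compose[OF continuous_ts_jump[of UNIV]]) (auto intro!: tendsto_intros X)
      then show "(\<lambda>n. indicator {0<..} u *\<^sub>R (ts_jump \<alpha> (u * X n) * complex_of_real (ts_kernel p \<alpha> u)))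
        \<longlonglongrightarrow> indicator {0<..} u *\<^sub>R (ts_jump \<alpha> (u * s) * complex_of_real (ts_kernel p \<alpha> u))"
        by (intro tendsto_intros)
    qed
    show "AE u in lborel. norm (indicator {0<..} u *\<^sub>R (ts_jump \<alpha> (u * X n) * complex_of_real (ts_kernel p \<alpha> u)))
      \<le> indicator {0<..} u *\<^sub>R (ts_bound \<alpha> (u * K) * ts_kernel p \<alpha> u)" for n
    proof (rule AE_I2)
      fix u
      have "\<bar>u * X n\<bar> \<le> \<bar>u * K\<bar>" using K'[of n] by (simp add: abs_mult mult_left_mono)
      then have "ts_bound \<alpha> (u * X n) * ts_kernel p \<alpha> u \<le> ts_bound \<alpha> (u * K) * ts_kernel p \<alpha> u"
        by (intro mult_right_mono ts_bound_mono) auto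
      then show "norm (indicator {0<..} u *\<^sub>R (ts_jump \<alpha> (u * X n) * complex_of_real (ts_kernel p \<alpha> u)))
        \<le> indicator {0<..} u *\<^sub>R (ts_bound \<alpha> (u * K) * ts_kernel p \<alpha> u)"
        unfolding norm_scaleR using norm_ts_integrand_le[of \<alpha> u "X n" p] by (auto simp: indicator_def)
    qed
  qed auto
qed

lemma TS_exponent_eq:
  "TS_exponent p \<alpha> R b z = \<i> * complex_of_real (b \<bullet> z) + (CLINT x|R. ts_integral p \<alpha> (x \<bullet> z))"
  by (simp add: TS_exponent_def ts_integral_def ts_jump_def ts_kernel_def)

lemma TS_exponent_0: "TS_exponent p \<alpha> R b 0 = 0"
  by (simp add: TS_exponent_eq)

lemma ts_majorant_inner_le:
  fixes x z :: "'a::real_inner"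
  assumes "p > 0" "\<alpha> < 2" "norm z \<le> K"
  shows "ts_majorant p \<alpha> (x \<bullet> z) \<le> (1 + \<bar>K\<bar>)\<^sup>2 * ts_majorant p \<alpha> (norm x)"
proof -
  have "\<bar>x \<bullet> z\<bar> \<le> norm x * norm z" by (rule Cauchy_Schwarz_ineq2)
  also have "\<dots> \<le> norm x * \<bar>K\<bar>" using assms(3) by (intro mult_left_mono) auto
  finally have "ts_majorant p \<alpha> (x \<bullet> z) \<le> ts_majorant p \<alpha> (K * norm x)"
    by (intro ts_majorant_mono assms) (simp add: abs_mult mult.commute)
  also have "\<dots> \<le> (1 + \<bar>K\<bar>)\<^sup>2 * ts_majorant p \<alpha> (norm x)"
    by (rule ts_majorant_scale[OF assms(1,2)])
  finally show ?thesis .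
qed

lemma ts_integral_integrable:
  fixes R :: "'a::euclidean_space measure"
  assumes R: "rosinski_measure \<alpha> R" and p: "p > 0" and \<alpha>: "\<alpha> < 2"
  shows "integrable R (\<lambda>x. ts_integral p \<alpha> (x \<bullet> z))"
proof (rule Bochner_Integration.integrable_bound)
  note [measurable_cong] = rosinski_measureD(1)[OF R]
  show "integrable R (\<lambda>x. (1 + \<bar>norm z\<bar>)\<^sup>2 * ts_majorant p \<alpha> (norm x))"
    by (intro integrable_mult_right ts_majorant_integrable[OF R p \<alpha>])
  show "(\<lambda>x. ts_integral p \<alpha> (x \<bullet> z)) \<in> borel_measurable R" by measurable
  show "AE x in R. norm (ts_integral p \<alpha> (x \<bullet> z)) \<le> norm ((1 + \<bar>norm z\<bar>)\<^sup>2 * ts_majorant p \<alpha> (norm x))"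
  proof (rule AE_I2)
    fix x
    have "norm (ts_integral p \<alpha> (x \<bullet> z)) \<le> (1 + \<bar>norm z\<bar>)\<^sup>2 * ts_majorant p \<alpha> (norm x)"
      using norm_ts_integral_le[OF p \<alpha>] ts_majorant_inner_le[OF p \<alpha> order_refl] by (rule order_trans)
    then show "norm (ts_integral p \<alpha> (x \<bullet> z)) \<le> norm ((1 + \<bar>norm z\<bar>)\<^sup>2 * ts_majorant p \<alpha> (norm x))"
      by simp
  qed
qed

text \<open>Together with \<open>TS_exponent_0\<close> this makes the exponent the distinguished
  logarithm required by \<open>levy_exponent\<close>.\<close>

lemma continuous_TS_exponent:
  fixes R :: "'a::euclidean_space measure"
  assumes R: "rosinski_measure \<alpha> R" and p: "p > 0" and \<alpha>: "\<alpha> < 2"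
  shows "continuous_on UNIV (TS_exponent p \<alpha> R b)"
  unfolding TS_exponent_eq continuous_on_sequentially
proof safe
  note [measurable_cong] = rosinski_measureD(1)[OF R]
  fix X and z :: 'a assume X: "X \<longlonglongrightarrow> z"
  then obtain K where K: "\<And>n. norm (X n) \<le> K"
    using convergent_imp_Bseq[of X] by (auto simp: convergent_def Bseq_def)
  have "(\<lambda>n. CLINT x|R. ts_integral p \<alpha> (x \<bullet> X n)) \<longlonglongrightarrow> (CLINT x|R. ts_integral p \<alpha> (x \<bullet> z))"
  proof (rule integral_dominated_convergence)
    show "integrable R (\<lambda>x. (1 + \<bar>K\<bar>)\<^sup>2 * ts_majorant p \<alpha> (norm x))"
      by (intro integrable_mult_right ts_majorant_integrable[OF R p \<alpha>])
    show "AE x in R. (\<lambda>n. ts_integral p \<alpha> (x \<bullet> X n)) \<longlonglongrightarrow> ts_integral p \<alpha> (x \<bullet> z)"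
      by (intro AE_I2 continuous_on_tendsto_compose[OF continuous_ts_integral[OF p \<alpha>]]) (auto intro!: tendsto_intros X)
    show "AE x in R. norm (ts_integral p \<alpha> (x \<bullet> X n)) \<le> (1 + \<bar>K\<bar>)\<^sup>2 * ts_majorant p \<alpha> (norm x)" for n
      by (intro AE_I2 order_trans[OF norm_ts_integral_le[OF p \<alpha>] ts_majorant_inner_le[OF p \<alpha> K]])
  qed measurable
  then show "((\<lambda>z. \<i> * complex_of_real (b \<bullet> z) + (CLINT x|R. ts_integral p \<alpha> (x \<bullet> z))) \<circ> X) \<longlonglongrightarrow>
      \<i> * complex_of_real (b \<bullet> z) + (CLINT x|R. ts_integral p \<alpha> (x \<bullet> z))"
    unfolding comp_def by (intro tendsto_intros X)
qed

subsection \<open>Existence of tempered stable laws\<close>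

text \<open>The Levy measure is the image of R times the tempering kernel under (x, u) \<mapsto> u
  x, and it enters as a product measure with this jump map. The compensator of jumps of norm at most
  1 differs from the one of order \<alpha> by an integrable linear term, which is absorbed into a
  translation.\<close>

theorem TS_distr_exists:
  fixes R :: "'a::euclidean_space measure"
  assumes R: "rosinski_measure \<alpha> R" and p: "p > 0" and \<alpha>: "\<alpha> < 2"
  obtains \<mu> :: "'a measure" where "TS_distr p \<alpha> R b \<mu>"
proof -
  note [measurable_cong] = rosinski_measureD(1)[OF R]
  interpret R: finite_measure R by (rule rosinski_measureD(2)[OF R])
  define k where "k u = indicator {0<..} u * ts_kernel p \<alpha> u" for u :: real
  have k0: "0 \<le> k u" for u by (simp add: k_def)
  have [measurable]: "k \<in> borel_measurable borel" unfolding k_def[abs_def] by measurable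
  let ?N = "density lborel (\<lambda>u. ennreal (k u))"
  have sN [measurable_cong]: "sets ?N = sets borel" by simp
  interpret N: sigma_finite_measure ?N
    by (subst sigma_finite_measure.sigma_finite_iff_density_finite[OF sigma_finite_lborel]) auto
  interpret P: pair_sigma_finite R ?N ..
  let ?Q = "R \<Otimes>\<^sub>M ?N"
  let ?J = "\<lambda>p. snd p *\<^sub>R fst p :: 'a"
  have intN: "(\<integral>u. f u \<partial>?N) = (LBINT u:{0<..}. ts_kernel p \<alpha> u *\<^sub>R f u)" if "f \<in> borel_measurable borel"
    for f :: "real \<Rightarrow> 'c::{banach, second_countable_topology}"
    unfolding set_lebesgue_integral_def
    by (subst integral_density) (use that k0 in \<open>auto simp: k_def\<close>)
  have integrN: "integrable ?N f \<longleftrightarrow> set_integrable lborel {0<..} (\<lambda>u. ts_kernel p \<alpha> u *\<^sub>R f u)" if "f \<in> borel_measurable borel"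
    for f :: "real \<Rightarrow> 'c::{banach, second_countable_topology}"
    unfolding set_integrable_def
    by (subst integrable_density) (use that k0 in \<open>auto simp: k_def\<close>)
  have bnd: "integrable ?Q (\<lambda>p. ts_bound \<alpha> (snd p * norm (fst p)))"
  proof (rule P.Fubini_integrable)
    have e: "(\<integral>u. norm (ts_bound \<alpha> (snd (x, u) * norm (fst (x, u)))) \<partial>?N) = ts_majorant p \<alpha> (norm x)" for x :: 'a
      unfolding ts_majorant_def by (subst intN) (auto simp: mult.commute)
    show "integrable R (\<lambda>x. \<integral>u. norm (ts_bound \<alpha> (snd (x, u) * norm (fst (x, u)))) \<partial>?N)"
      unfolding e by (rule ts_majorant_integrable[OF R p \<alpha>])
    show "AE x in R. integrable ?N (\<lambda>u. ts_bound \<alpha> (snd (x, u) * norm (fst (x, u))))"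
    proof (rule AE_I2)
      fix x :: 'a
      have "set_integrable lborel {0<..} (\<lambda>u. ts_kernel p \<alpha> u *\<^sub>R ts_bound \<alpha> (u * norm x))"
        using ts_kernel_bound_integrable[OF p \<alpha>, of "norm x"] by (simp add: mult.commute[of "ts_kernel p \<alpha> _"])
      then show "integrable ?N (\<lambda>u. ts_bound \<alpha> (snd (x, u) * norm (fst (x, u))))"
        by (subst integrN) simp_all
    qed
  qed measurable
  \<comment> \<open>The density is carried by u > 0, where the norm of the jump u x is u times the
    norm of x.\<close>
  have posN: "AE p in ?Q. 0 < snd p"
  proof -
    have "AE u in ?N. 0 < u" by (subst AE_density) (auto simp: k_def indicator_def)
    then have "AE x in R. AE u in ?N. 0 < snd (x, u)" by simp
    moreover have "{p \<in> space ?Q. 0 < snd p} \<in> sets ?Q" by measurable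
    ultimately show ?thesis by (intro P.AE_pair_measure)
  qed
  have nJ: "AE p in ?Q. ts_bound \<alpha> (norm (?J p)) = ts_bound \<alpha> (snd p * norm (fst p))"
    using posN by eventually_elim simp
  have bJ: "integrable ?Q (\<lambda>p. ts_bound \<alpha> (norm (?J p)))"
    by (rule integrable_cong_AE_imp[OF bnd]) (use nJ in \<open>auto elim: AE_mp\<close>)
  have "(\<integral>\<^sup>+x. ennreal (min 1 ((norm (?J x))\<^sup>2)) \<partial>?Q) \<le> (\<integral>\<^sup>+x. ennreal (ts_bound \<alpha> (norm (?J x))) \<partial>?Q)"
    by (intro nn_integral_mono ennreal_leI powr_min_le_ts_bound) simp
  also have "\<dots> < \<infinity>" using bJ by (simp add: integrable_iff_bounded)
  finally have fin: "(\<integral>\<^sup>+x. ennreal (min 1 ((norm (?J x))\<^sup>2)) \<partial>?Q) < \<infinity>" .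
  obtain \<mu> :: "'a measure" where \<mu>: "prob_space \<mu>" "sets \<mu> = sets borel"
    "\<And>z. charfun \<mu> z = exp (CLINT x|?Q. levy_khintchine_integrand z (?J x))"
    using levy_khintchine_exists[of ?J ?Q, OF _ fin] by auto
  \<comment> \<open>This is the difference of the two compensators: minus the large jumps if all
    jumps are compensated in order \<alpha>, and the small jumps if none is.\<close>
  define D where "D y = (if 1 \<le> \<alpha> then if norm y \<le> 1 then 0 else - y else if norm y \<le> 1 then y else 0)" for y :: 'a
  have [measurable]: "D \<in> borel_measurable borel" unfolding D_def[abs_def] by measurable
  have Db: "norm (D y) \<le> ts_bound \<alpha> (norm y)" for y
  proof (cases "y = 0")
    case False
    have "norm y \<le> 1 \<or> norm y \<le> (norm y)\<^sup>2"
      unfolding power2_eq_square by (metis linear mult_left_mono mult.right_neutral norm_ge_zero)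
    then show ?thesis
      using False by (auto simp: D_def ts_bound_def ts_order_def powr_numeral min_def)
  qed (simp add: D_def)
  have D: "integrable ?Q (\<lambda>p. D (?J p))"
  proof (rule Bochner_Integration.integrable_bound[OF bJ])
    show "AE p in ?Q. norm (D (?J p)) \<le> norm (ts_bound \<alpha> (norm (?J p)))"
      using Db by (intro AE_I2) (simp del: norm_scaleR)
  qed measurable
  have split: "ts_jump \<alpha> (y \<bullet> z) = levy_khintchine_integrand z y + \<i> * complex_of_real (D y \<bullet> z)" for y z :: 'a
    by (auto simp: ts_jump_def levy_khintchine_integrand_def D_def)
  define c where "c = b + (\<integral>p. D (?J p) \<partial>?Q)"
  obtain \<nu> :: "'a measure" where \<nu>: "prob_space \<nu>" "sets \<nu> = sets borel"
    "\<And>z. charfun \<nu> z = iexp (c \<bullet> z) * charfun \<mu> z"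
    using charfun_shift_exists[OF \<mu>(1,2), of c] by blast
  have "charfun \<nu> z = exp (TS_exponent p \<alpha> R b z)" for z
  proof -
    have jm: "integrable ?Q (\<lambda>p. ts_jump \<alpha> (?J p \<bullet> z))"
    proof (rule Bochner_Integration.integrable_bound)
      show "integrable ?Q (\<lambda>p. (1 + \<bar>norm z\<bar>)\<^sup>2 * ts_bound \<alpha> (norm (?J p)))"
        by (intro integrable_mult_right bJ)
      show "AE p in ?Q. norm (ts_jump \<alpha> (?J p \<bullet> z)) \<le> norm ((1 + \<bar>norm z\<bar>)\<^sup>2 * ts_bound \<alpha> (norm (?J p)))"
      proof (rule AE_I2)
        fix p :: "'a \<times> real"
        have "norm (ts_jump \<alpha> (?J p \<bullet> z)) \<le> ts_bound \<alpha> (?J p \<bullet> z)" by (rule norm_ts_jump_le)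
        also have "\<dots> \<le> ts_bound \<alpha> (norm z * norm (?J p))"
          using Cauchy_Schwarz_ineq2[of "?J p" z] by (intro ts_bound_mono) (simp add: abs_mult mult_ac)
        also have "\<dots> \<le> (1 + \<bar>norm z\<bar>)\<^sup>2 * ts_bound \<alpha> (norm (?J p))" by (rule ts_bound_scale)
        finally show "norm (ts_jump \<alpha> (?J p \<bullet> z)) \<le> norm ((1 + \<bar>norm z\<bar>)\<^sup>2 * ts_bound \<alpha> (norm (?J p)))"
          by simp
      qed
    qed measurable
    have Dz: "integrable ?Q (\<lambda>p. \<i> * complex_of_real (D (?J p) \<bullet> z))"
      by (intro integrable_mult_right integrable_of_real integrable_inner_left D)
    have "(CLINT x|?Q. levy_khintchine_integrand z (?J x)) =
      (CLINT p|?Q. ts_jump \<alpha> (?J p \<bullet> z) - \<i> * complex_of_real (D (?J p) \<bullet> z))"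
      unfolding split by simp
    also have "\<dots> = (CLINT p|?Q. ts_jump \<alpha> (?J p \<bullet> z)) - (CLINT p|?Q. \<i> * complex_of_real (D (?J p) \<bullet> z))"
      by (rule Bochner_Integration.integral_diff[OF jm Dz])
    also have "(CLINT p|?Q. \<i> * complex_of_real (D (?J p) \<bullet> z)) = \<i> * complex_of_real ((\<integral>p. D (?J p) \<partial>?Q) \<bullet> z)"
      unfolding integral_mult_right_zero integral_complex_of_real integral_inner_left[OF D] ..
    also have "(CLINT p|?Q. ts_jump \<alpha> (?J p \<bullet> z)) = (CLINT x|R. CLINT u|?N. ts_jump \<alpha> (?J (x, u) \<bullet> z))"
      by (rule P.integral_fst'[OF jm, symmetric])
    also have "\<dots> = (CLINT x|R. ts_integral p \<alpha> (x \<bullet> z))"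
      unfolding ts_integral_def
      by (subst intN) (auto simp: scaleR_conv_of_real mult.commute)
    finally show ?thesis
      unfolding \<nu>(3) \<mu>(3) exp_add[symmetric] TS_exponent_eq
      by (simp add: c_def inner_add_left distrib_left)
  qed
  then have "TS_distr p \<alpha> R b \<nu>"
    using R \<nu> by (simp add: TS_distr_def)
  then show ?thesis by (rule that)
qed

subsection \<open>The incomplete integrals of the remainder term\<close>

lemma LBINT_eq_integral_continuous:
  fixes f :: "real \<Rightarrow> 'a::euclidean_space"
  assumes "continuous_on {a..b} f"
  shows "(LBINT x:{a..b}. f x) = integral {a..b} f"
  by (rule set_borel_integral_eq_integral(2)) (rule borel_integrable_atLeastAtMost'[OF assms])

locale incomplete_integrals =
  fixes p \<alpha> \<eta> :: real
  assumes p: "p > 0" and \<eta>: "\<eta> > 1"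
begin

definition h :: "nat \<Rightarrow> real \<Rightarrow> real" where
  "h n u = (1 - u powr p) ^ n / fact n * u powr (- 1 - \<alpha>)"

text \<open>At \<open>\<theta> = \<eta>\<close> these are the constants \<open>kappa\<close> (see
  \<open>kappa_eq_H\<close>); for \<open>n = m\<close> and \<gamma> = \<open>Suc m\<close> they are,
  up to a factorial, the inner integrals of the IBGM density.\<close>

definition H :: "nat \<Rightarrow> real \<Rightarrow> real" where
  "H n \<theta> = integral {1 / \<theta>..1} (h n)"

text \<open>The power of \<theta> is chosen so that \<open>F n\<close> is the antiderivative of
  \<open>dF n\<close> vanishing at 1 and also \<open>dF (Suc n)\<close> divided by p \<theta>^(p -
  1), the factor that differentiating the exponential in \<open>G\<close> brings out. The
  integration by parts can therefore be repeated.\<close>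

definition F :: "nat \<Rightarrow> real \<Rightarrow> real" where
  "F n \<theta> = \<theta> powr (real n * p - \<alpha>) * H n \<theta>"

definition dF :: "nat \<Rightarrow> real \<Rightarrow> real" where
  "dF n \<theta> = (case n of 0 \<Rightarrow> \<theta> powr (- 1 - \<alpha>)
    | Suc m \<Rightarrow> p * \<theta> powr (real n * p - \<alpha> - 1) * H m \<theta>)"

text \<open>\<open>G 0\<close> is the density of jump sizes in one direction, and \<open>G n\<close>
  is what remains of it after n integrations by parts, without the factor v^(n p).\<close>

definition G :: "nat \<Rightarrow> real \<Rightarrow> real" where
  "G n v = integral {1..\<eta>} (\<lambda>\<theta>. dF n \<theta> * exp (- (v powr p * \<theta> powr p)))"

lemma inverse_interval_pos: "1 \<le> \<theta> \<Longrightarrow> u \<in> {1 / \<theta>..1} \<Longrightarrow> 0 < u" for u \<theta> :: real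
  by (rule less_le_trans[of 0 "1 / \<theta>"]) auto

lemma minus_alpha: "- \<alpha> - 1 = - 1 - \<alpha>"
  by simp

lemma continuous_h: "0 < a \<Longrightarrow> continuous_on {a..b} (h n)"
  unfolding h_def by (intro continuous_intros) auto

lemma h_nonneg: "0 < u \<Longrightarrow> u \<le> 1 \<Longrightarrow> 0 \<le> h n u"
  using p powr_le1[of p u] by (simp add: h_def)

lemma H_nonneg: "1 \<le> \<theta> \<Longrightarrow> 0 \<le> H n \<theta>"
proof -
  assume \<theta>: "1 \<le> \<theta>"
  then have "0 < 1 / \<theta>" by simp
  show ?thesis unfolding H_def
  proof (rule integral_nonneg)
    show "h n integrable_on {1 / \<theta>..1}"
      by (intro integrable_continuous_interval continuous_h) fact
    fix u assume u: "u \<in> {1 / \<theta>..1}"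
    show "0 \<le> h n u"
      by (rule h_nonneg[OF inverse_interval_pos[OF \<theta> u]]) (use u in simp)
  qed
qed

lemma h_inverse: "\<theta> > 0 \<Longrightarrow> h n (1 / \<theta>) / \<theta>\<^sup>2 = \<theta> powr (\<alpha> - 1) * (1 - \<theta> powr - p) ^ n / fact n"
proof -
  assume \<theta>: "\<theta> > 0"
  have "1 / \<theta> = \<theta> powr - 1" using \<theta> by (simp add: powr_minus_divide)
  then have "(1 / \<theta>) powr (- 1 - \<alpha>) = \<theta> powr (1 + \<alpha>)" by (simp only: powr_powr) (simp add: add.commute)
  also have "\<theta> powr (1 + \<alpha>) = \<theta> powr (\<alpha> - 1) * \<theta> powr 2"
    by (simp add: powr_add[symmetric])
  also have "\<theta> powr 2 = \<theta>\<^sup>2" using \<theta> by (simp add: powr_numeral)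
  finally have "(1 / \<theta>) powr (- 1 - \<alpha>) / \<theta>\<^sup>2 = \<theta> powr (\<alpha> - 1)" using \<theta> by simp
  moreover have "(1 / \<theta>) powr p = \<theta> powr - p" using \<theta> by (simp add: powr_divide powr_minus_divide)
  moreover have "h n (1 / \<theta>) / \<theta>\<^sup>2 = (1 - (1 / \<theta>) powr p) ^ n / fact n * ((1 / \<theta>) powr (- 1 - \<alpha>) / \<theta>\<^sup>2)"
    by (simp add: h_def)
  ultimately show ?thesis by (simp only:) simp
qed

lemma H_has_derivative:
  assumes "1 \<le> \<theta>" "\<theta> \<le> \<Theta>"
  shows "(H n has_real_derivative \<theta> powr (\<alpha> - 1) * (1 - \<theta> powr - p) ^ n / fact n) (at \<theta> within {1..\<Theta>})"
proof -
  let ?I = "\<lambda>x. integral {x..1} (h n)"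
  have \<Theta>: "1 \<le> \<Theta>" using assms by simp
  have "(?I has_real_derivative - h n (1 / \<theta>)) (at (1 / \<theta>) within {1 / \<Theta>..1})"
    using assms by (intro integral_has_real_derivative' continuous_h) (auto simp: frac_le)
  then have "(?I has_real_derivative - h n (1 / \<theta>)) (at (1 / \<theta>) within (\<lambda>x. 1 / x) ` {1..\<Theta>})"
    by (rule has_field_derivative_subset) (use \<Theta> in \<open>auto simp: frac_le\<close>)
  moreover have "((\<lambda>x. 1 / x) has_real_derivative - (1 / \<theta>\<^sup>2)) (at \<theta> within {1..\<Theta>})"
    using assms by (auto intro!: derivative_eq_intros simp: power2_eq_square)
  ultimately have "(?I \<circ> (\<lambda>x. 1 / x) has_real_derivative - h n (1 / \<theta>) * - (1 / \<theta>\<^sup>2)) (at \<theta> within {1..\<Theta>})"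
    by (rule DERIV_image_chain)
  then show ?thesis
    using assms h_inverse[of \<theta> n] by (simp add: comp_def H_def[abs_def])
qed

lemma continuous_H: "continuous_on {1..\<Theta>} (H n)"
  unfolding continuous_on_eq_continuous_within
  by (intro ballI DERIV_continuous[OF H_has_derivative]) auto

text \<open>Multiplying by \<open>\<alpha>\<close> keeps the identity meaningful for
  \<open>\<alpha> = 0\<close>, where the antiderivative is a logarithm.\<close>

lemma H_0: "1 \<le> \<theta> \<Longrightarrow> \<alpha> * H 0 \<theta> = \<theta> powr \<alpha> - 1"
proof -
  assume \<theta>: "1 \<le> \<theta>"
  have "((\<lambda>u. \<alpha> * h 0 u) has_integral - (1 powr - \<alpha>) - - ((1 / \<theta>) powr - \<alpha>)) {1 / \<theta>..1}"
  proof (rule fundamental_theorem_of_calculus)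
    fix u assume "u \<in> {1 / \<theta>..1}"
    then have "u > 0" by (rule inverse_interval_pos[OF \<theta>])
    then show "((\<lambda>u. - (u powr - \<alpha>)) has_vector_derivative \<alpha> * h 0 u) (at u within {1 / \<theta>..1})"
      by (auto intro!: derivative_eq_intros simp: h_def minus_alpha
          simp flip: has_real_derivative_iff_has_vector_derivative)
  qed (use \<theta> in simp)
  from integral_unique[OF this] show ?thesis
    using \<theta> by (simp add: H_def powr_divide powr_minus_divide)
qed

text \<open>Integrate the derivative of - (1 - u^p)^(n + 1) u^(- \<alpha>) / (n + 1)!. Writing u^p
  as 1 - (1 - u^p) expresses the result through \<open>h n\<close> and \<open>h (Suc n)\<close>, and
  the boundary term at u = 1 vanishes.\<close>

lemma H_Suc:
  assumes \<theta>: "1 \<le> \<theta>"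
  shows "p * H n \<theta> - (real (Suc n) * p - \<alpha>) * H (Suc n) \<theta> = \<theta> powr \<alpha> * (1 - \<theta> powr - p) ^ Suc n / fact (Suc n)"
proof -
  let ?A = "\<lambda>u. - ((1 - u powr p) ^ Suc n / fact (Suc n) * u powr - \<alpha>)"
  have t0: "0 < 1 / \<theta>" using \<theta> by simp
  have int: "((\<lambda>u. p * h n u - (real (Suc n) * p - \<alpha>) * h (Suc n) u) has_integral ?A 1 - ?A (1 / \<theta>)) {1 / \<theta>..1}"
  proof (rule fundamental_theorem_of_calculus)
    fix u assume "u \<in> {1 / \<theta>..1}"
    then have u: "u > 0" by (rule inverse_interval_pos[OF \<theta>])
    define x where "x = 1 - u powr p"
    define w where "w = u powr (- 1 - \<alpha>)"
    have f: "(fact (Suc n) :: real) = real (Suc n) * fact n" by simp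
    have d1: "((\<lambda>u. (1 - u powr p) ^ Suc n) has_real_derivative real (Suc n) * x ^ n * - (p * u powr (p - 1))) (at u within {1 / \<theta>..1})"
    proof -
      have "((\<lambda>u. 1 - u powr p) has_real_derivative - (p * u powr (p - 1))) (at u within {1 / \<theta>..1})"
        using u by (auto intro!: derivative_eq_intros)
      from DERIV_power[OF this, of "Suc n"] show ?thesis
        unfolding x_def by (simp add: mult_ac del: power_Suc of_nat_Suc)
    qed
    have d2: "((\<lambda>u. u powr - \<alpha>) has_real_derivative - \<alpha> * u powr (- \<alpha> - 1)) (at u within {1 / \<theta>..1})"
      using u by (auto intro!: derivative_eq_intros)
    have "(?A has_real_derivative
       - ((real (Suc n) * x ^ n * - (p * u powr (p - 1))) / fact (Suc n) * u powr - \<alpha> +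
          - \<alpha> * u powr (- \<alpha> - 1) * ((1 - u powr p) ^ Suc n / fact (Suc n)))) (at u within {1 / \<theta>..1})"
      by (rule DERIV_minus[OF DERIV_mult[OF DERIV_cdivide[OF d1] d2]])
    moreover have "u powr (- \<alpha> - 1) = w" by (simp add: w_def minus_alpha)
    moreover have "u powr (p - 1) * u powr - \<alpha> = (1 - x) * w"
    proof -
      have "p - 1 + - \<alpha> = p + (- 1 - \<alpha>)" by simp
      then show ?thesis by (simp only: x_def w_def powr_add[symmetric]) (simp add: powr_add)
    qed
    \<comment> \<open>What remains is field arithmetic with N for \<open>Suc n\<close>, X for
      \<open>x ^ n\<close> and c for \<open>fact n\<close>; T is the value of
      \<open>h (Suc n)\<close>.\<close>
    moreover have "- ((N * X * - (p * P)) / (N * c) * Q + - \<alpha> * w * (x * X / (N * c))) =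
        p * (X / c * w) - (N * p - \<alpha>) * (x * X / (N * c) * w)"
      if PQ: "P * Q = (1 - x) * w" and N: "N \<noteq> 0" "c \<noteq> 0" for P Q N X c :: real
    proof -
      define T where "T = x * X / (N * c) * w"
      have NT: "N * T = x * X * w / c" using N by (simp add: T_def)
      have "(N * X * - (p * P)) / (N * c) * Q = - (X * p * (P * Q) / c)"
        using N by simp
      also have "X * p * (P * Q) / c = p * (X / c * w) - p * (N * T)"
        unfolding PQ NT by (simp add: algebra_simps diff_divide_distrib)
      finally have Y: "(N * X * - (p * P)) / (N * c) * Q = - (p * (X / c * w) - p * (N * T))" .
      have Z: "- \<alpha> * w * (x * X / (N * c)) = - \<alpha> * T" by (simp add: T_def)
      show ?thesis unfolding Y Z T_def[symmetric] by (simp add: algebra_simps)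
    qed
    ultimately have "(?A has_real_derivative p * (x ^ n / fact n * w) -
        (real (Suc n) * p - \<alpha>) * (x * x ^ n / (real (Suc n) * fact n) * w)) (at u within {1 / \<theta>..1})"
      unfolding f power_Suc x_def[symmetric] by (simp only: fact_nonzero not_False_eq_True of_nat_eq_0_iff nat.distinct simp_thms)
    then have "(?A has_real_derivative p * h n u - (real (Suc n) * p - \<alpha>) * h (Suc n) u) (at u within {1 / \<theta>..1})"
      unfolding h_def x_def w_def f power_Suc .
    then show "(?A has_vector_derivative p * h n u - (real (Suc n) * p - \<alpha>) * h (Suc n) u) (at u within {1 / \<theta>..1})"
      by (simp add: has_real_derivative_iff_has_vector_derivative)
  qed (use \<theta> in simp)
  have hi: "h m integrable_on {1 / \<theta>..1}" for m
    by (intro integrable_continuous_interval continuous_h t0)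
  have "integral {1 / \<theta>..1} (\<lambda>u. p * h n u - (real (Suc n) * p - \<alpha>) * h (Suc n) u) =
      p * H n \<theta> - (real (Suc n) * p - \<alpha>) * H (Suc n) \<theta>"
    unfolding H_def by (subst integral_diff) (use hi in \<open>auto intro!: integrable_on_mult_right simp: integral_mult_right\<close>)
  moreover have "?A 1 = 0" by simp
  moreover have "- ?A (1 / \<theta>) = \<theta> powr \<alpha> * (1 - \<theta> powr - p) ^ Suc n / fact (Suc n)"
    using \<theta> by (simp add: powr_divide powr_minus_divide)
  ultimately show ?thesis using integral_unique[OF int] by linarith
qed

text \<open>The product rule yields one term with \<open>H n\<close> and one boundary term. The
  identities \<open>H_0\<close> and \<open>H_Suc\<close> merge them into a single term of lower
  index.\<close>

lemma F_has_derivative: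
  assumes \<theta>: "1 \<le> \<theta>" "\<theta> \<le> \<Theta>"
  shows "(F n has_real_derivative dF n \<theta>) (at \<theta> within {1..\<Theta>})"
proof -
  let ?a = "real n * p - \<alpha>" and ?r = "\<theta> powr (\<alpha> - 1) * (1 - \<theta> powr - p) ^ n / fact n"
  have D: "(F n has_real_derivative ?a * \<theta> powr (?a - 1) * H n \<theta> + ?r * \<theta> powr ?a) (at \<theta> within {1..\<Theta>})"
  proof -
    have "((\<lambda>x. x powr ?a) has_real_derivative ?a * \<theta> powr (?a - 1)) (at \<theta> within {1..\<Theta>})"
      using \<theta> by (auto intro!: derivative_eq_intros)
    from DERIV_mult[OF this H_has_derivative[OF \<theta>, of n]] show ?thesis
      unfolding F_def[abs_def] by (simp add: algebra_simps)
  qed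
  have e: "?r * \<theta> powr ?a = \<theta> powr (?a - 1) * (\<theta> powr \<alpha> * (1 - \<theta> powr - p) ^ n / fact n)"
  proof -
    have "\<theta> powr (\<alpha> - 1) * \<theta> powr ?a = \<theta> powr (?a - 1) * \<theta> powr \<alpha>" by (simp add: powr_add[symmetric] algebra_simps)
    then show ?thesis by (simp add: mult_ac)
  qed
  show ?thesis
  proof (cases n)
    case 0
    have a: "?a - 1 = - 1 - \<alpha>" "?a = - \<alpha>" using 0 by simp_all
    have "?a * \<theta> powr (?a - 1) * H n \<theta> + ?r * \<theta> powr ?a = \<theta> powr (- 1 - \<alpha>) * (\<theta> powr \<alpha> - \<alpha> * H 0 \<theta>)"
      unfolding e a(1) using 0 by (simp add: right_diff_distrib)
    also have "\<dots> = dF n \<theta>" using 0 \<theta> by (simp add: H_0 dF_def)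
    finally show ?thesis using D by simp
  next
    case (Suc m)
    have "?a * \<theta> powr (?a - 1) * H n \<theta> + ?r * \<theta> powr ?a =
        \<theta> powr (?a - 1) * (?a * H n \<theta> + \<theta> powr \<alpha> * (1 - \<theta> powr - p) ^ n / fact n)"
      unfolding e by (simp add: distrib_left mult_ac)
    also have "?a * H n \<theta> + \<theta> powr \<alpha> * (1 - \<theta> powr - p) ^ n / fact n = p * H m \<theta>"
      using H_Suc[OF \<theta>(1), of m] unfolding Suc by linarith
    also have "\<theta> powr (?a - 1) * (p * H m \<theta>) = dF n \<theta>"
      unfolding Suc dF_def by (simp add: mult_ac)
    finally show ?thesis using D by simp
  qed
qed

lemma dF_0: "dF 0 \<theta> = \<theta> powr (- 1 - \<alpha>)"
  by (simp add: dF_def)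

lemma dF_Suc_eq: "dF (Suc m) \<theta> = p * \<theta> powr (real (Suc m) * p - \<alpha> - 1) * H m \<theta>"
  by (simp add: dF_def)

lemma continuous_dF: "continuous_on {1..\<eta>} (dF n)"
proof (cases n)
  case 0
  show ?thesis unfolding 0 dF_0[abs_def] by (intro continuous_intros) auto
next
  case (Suc m)
  show ?thesis
    unfolding Suc dF_Suc_eq[abs_def]
    by (rule continuous_on_mult[OF _ continuous_H]) (intro continuous_intros, auto)
qed

lemma dF_nonneg: "1 \<le> \<theta> \<Longrightarrow> 0 \<le> dF n \<theta>"
  using p H_nonneg[of \<theta>] by (cases n) (simp_all only: dF_0 dF_Suc_eq powr_ge_zero mult_nonneg_nonneg less_imp_le)

lemma F_1 [simp]: "F n 1 = 0"
  by (simp add: F_def H_def)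

lemma dF_Suc: "p * \<theta> powr (p - 1) * F n \<theta> = dF (Suc n) \<theta>"
proof -
  have "p - 1 + (real n * p - \<alpha>) = real (Suc n) * p - \<alpha> - 1"
    unfolding of_nat_Suc distrib_right by linarith
  then have "\<theta> powr (p - 1) * \<theta> powr (real n * p - \<alpha>) = \<theta> powr (real (Suc n) * p - \<alpha> - 1)"
    by (simp only: powr_add[symmetric])
  then have "p * (\<theta> powr (p - 1) * \<theta> powr (real n * p - \<alpha>)) * H n \<theta> = p * \<theta> powr (real (Suc n) * p - \<alpha> - 1) * H n \<theta>"
    by (simp only:)
  then show ?thesis unfolding F_def dF_Suc_eq mult.assoc .
qed

text \<open>Integration by parts in \<open>\<theta>\<close>, with boundary terms that will be the laws of the \<open>X\<^sub>n\<close>.\<close>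

lemma G_step: "G n v = F n \<eta> * exp (- (v powr p * \<eta> powr p)) + v powr p * G (Suc n) v"
proof -
  let ?e = "\<lambda>\<theta>. exp (- (v powr p * \<theta> powr p))"
  have ci: "continuous_on {1..\<eta>} (\<lambda>\<theta>. dF m \<theta> * ?e \<theta>)" for m
    by (intro continuous_on_mult continuous_dF) (intro continuous_intros, auto)
  \<comment> \<open>Only the end \<open>\<eta>\<close> will contribute, since
    \<open>F n 1 = 0\<close>.\<close>
  have "((\<lambda>\<theta>. dF n \<theta> * ?e \<theta> - v powr p * (dF (Suc n) \<theta> * ?e \<theta>)) has_integral F n \<eta> * ?e \<eta> - F n 1 * ?e 1) {1..\<eta>}"
  proof (rule fundamental_theorem_of_calculus)
    fix \<theta> assume "\<theta> \<in> {1..\<eta>}"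
    then have \<theta>: "1 \<le> \<theta>" "\<theta> \<le> \<eta>" by auto
    have "(?e has_real_derivative - (v powr p * (p * \<theta> powr (p - 1))) * ?e \<theta>) (at \<theta> within {1..\<eta>})"
      using \<theta> by (auto intro!: derivative_eq_intros)
    from DERIV_mult[OF F_has_derivative[OF \<theta>] this]
    have "((\<lambda>\<theta>. F n \<theta> * ?e \<theta>) has_real_derivative
        dF n \<theta> * ?e \<theta> - v powr p * ((p * \<theta> powr (p - 1) * F n \<theta>) * ?e \<theta>)) (at \<theta> within {1..\<eta>})"
      by (simp add: algebra_simps)
    then show "((\<lambda>\<theta>. F n \<theta> * ?e \<theta>) has_vector_derivative
        dF n \<theta> * ?e \<theta> - v powr p * (dF (Suc n) \<theta> * ?e \<theta>)) (at \<theta> within {1..\<eta>})"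
      unfolding dF_Suc has_real_derivative_iff_has_vector_derivative .
  qed (use \<eta> in simp)
  moreover have "integral {1..\<eta>} (\<lambda>\<theta>. dF n \<theta> * ?e \<theta> - v powr p * (dF (Suc n) \<theta> * ?e \<theta>)) = G n v - v powr p * G (Suc n) v"
  proof -
    have gi: "(\<lambda>\<theta>. dF m \<theta> * ?e \<theta>) integrable_on {1..\<eta>}" for m
      by (rule integrable_continuous_interval[OF ci])
    show ?thesis
      unfolding G_def integral_diff[OF gi integrable_on_mult_right[OF gi]] integral_mult_right ..
  qed
  ultimately show ?thesis by (simp add: integral_unique)
qed

lemma G_0_eq:
  "0 < v \<Longrightarrow> G 0 v = (\<Sum>n<N. v powr (real n * p) * F n \<eta> * exp (- (v powr p * \<eta> powr p))) + v powr (real N * p) * G N v"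
proof (induction N)
  case (Suc N)
  have "v powr (real N * p) * v powr p = v powr (real (Suc N) * p)"
    by (simp add: powr_add[symmetric] algebra_simps)
  then have "v powr (real N * p) * G N v = v powr (real N * p) * F N \<eta> * exp (- (v powr p * \<eta> powr p)) + v powr (real (Suc N) * p) * G (Suc N) v"
    unfolding G_step[of N v] distrib_left by (simp only: mult.assoc[symmetric])
  then show ?case using Suc by simp
qed simp

lemma G_nonneg: "0 \<le> G n v"
  unfolding G_def
  by (intro integral_nonneg integrable_continuous_interval continuous_intros continuous_dF)
     (auto intro!: mult_nonneg_nonneg dF_nonneg)

lemma G_eq_LBINT: "G n v = (LBINT \<theta>:{1..\<eta>}. dF n \<theta> * exp (- (v powr p * \<theta> powr p)))"
  unfolding G_def by (rule LBINT_eq_integral_continuous[symmetric]) (auto intro!: continuous_intros continuous_dF)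

lemma dF_ind_measurable [measurable]: "(\<lambda>\<theta>. indicator {1..\<eta>} \<theta> * dF n \<theta>) \<in> borel_measurable borel"
  using borel_measurable_continuous_on_indicator[OF _ continuous_dF[of n]] by simp

lemma G_measurable [measurable]: "G n \<in> borel_measurable borel"
proof -
  have "G n = (\<lambda>v. \<integral>\<theta>. (indicator {1..\<eta>} \<theta> * dF n \<theta>) * exp (- (v powr p * \<theta> powr p)) \<partial>lborel)"
    by (simp add: fun_eq_iff G_eq_LBINT set_lebesgue_integral_def mult.assoc)
  then show ?thesis by simp
qed

lemma H_eq_LBINT: "1 \<le> \<theta> \<Longrightarrow> H n \<theta> = (LBINT u:{1 / \<theta>..1}. h n u)"
  unfolding H_def by (rule LBINT_eq_integral_continuous[symmetric]) (auto intro!: continuous_h)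

lemma IBGM_inner_eq:
  assumes "1 \<le> \<theta>"
  shows "(LBINT u:{1 / \<theta>..1}. (1 - u powr p) powr (real (Suc m) - 1) * u powr (- 1 - \<alpha>)) = fact m * H m \<theta>"
proof -
  have "(LBINT u:{1 / \<theta>..1}. (1 - u powr p) powr (real (Suc m) - 1) * u powr (- 1 - \<alpha>)) =
      (LBINT u:{1 / \<theta>..1}. fact m * h m u)"
  proof (rule set_lebesgue_integral_cong_AE)
    \<comment> \<open>The point 1 is discarded because for m = 0 the two integrands differ there:
      \<open>0 powr 0\<close> is 0 while \<open>0 ^ 0\<close> is 1.\<close>
    have "AE u in lborel. u \<noteq> (1::real)" by (rule AE_lborel_singleton)
    then show "AE u \<in> {1 / \<theta>..1} in lborel. (1 - u powr p) powr (real (Suc m) - 1) * u powr (- 1 - \<alpha>) = fact m * h m u"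
    proof eventually_elim
      case (elim u)
      show ?case
      proof
        assume "u \<in> {1 / \<theta>..1}"
        then have "0 < u" "u < 1" using elim inverse_interval_pos[OF assms, of u] by auto
        then have "0 < 1 - u powr p" using p powr_less_mono2[of p u 1] by simp
        then show "(1 - u powr p) powr (real (Suc m) - 1) * u powr (- 1 - \<alpha>) = fact m * h m u"
          by (simp add: h_def powr_realpow)
      qed
    qed
  qed (auto simp: h_def)
  then show ?thesis using assms by (simp add: H_eq_LBINT)
qed

text \<open>This is the Poisson rate per unit mass of R. It turns out to be the total mass of
  \<open>jump_density\<close> (see \<open>jump_density_integral\<close>).\<close>

definition mass :: "nat \<Rightarrow> real" where
  "mass m = p * IBGM_const \<alpha> (real (Suc m)) p \<eta> / fact m"

lemma mass_eq: "mass m = Gamma (real (Suc m) - \<alpha> / p) * integral {1..\<eta>} (\<lambda>\<theta>. \<theta> powr - 1 * H m \<theta>)"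
proof -
  have "(LBINT \<theta>:{1..\<eta>}. \<theta> powr (- 1) * (LBINT u:{1/\<theta>..1}. (1 - u powr p) powr (real (Suc m) - 1) * u powr (- 1 - \<alpha>))) =
    (LBINT \<theta>:{1..\<eta>}. fact m * (\<theta> powr - 1 * H m \<theta>))"
    by (rule set_lebesgue_integral_cong) (auto simp: IBGM_inner_eq simp del: of_nat_Suc)
  also have "\<dots> = fact m * integral {1..\<eta>} (\<lambda>\<theta>. \<theta> powr - 1 * H m \<theta>)"
  proof -
    have "continuous_on {1..\<eta>} (\<lambda>\<theta>. \<theta> powr - 1 * H m \<theta>)"
      by (intro continuous_on_mult continuous_H) (intro continuous_intros, auto)
    then show ?thesis by (simp only: set_integral_mult_right LBINT_eq_integral_continuous)
  qed
  finally show ?thesis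
    using p unfolding mass_def IBGM_const_def by simp
qed

lemma H_pos: "1 < \<theta> \<Longrightarrow> 0 < H n \<theta>"
proof -
  assume \<theta>: "1 < \<theta>"
  then have t0: "0 < 1 / \<theta>" "1 / \<theta> < 1" by auto
  have "integral {1 / \<theta>..1} (\<lambda>_. 0) < integral {1 / \<theta>..1} (h n)"
  proof (rule integral_less_real)
    show "continuous_on {1 / \<theta>..1} (h n)"
      by (intro continuous_h t0)
    show "{1 / \<theta><..<1} \<noteq> {}" using t0 by simp
    fix u assume u: "u \<in> {1 / \<theta><..<1}"
    then have "0 < u" "u < 1" using inverse_interval_pos[of \<theta> u] \<theta> by auto
    then show "0 < h n u" using p powr_less_mono2[of p u 1] by (simp add: h_def)
  qed simp
  then show ?thesis by (simp add: H_def)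
qed

lemma mass_pos:
  assumes "real (Suc m) * p > \<alpha>"
  shows "mass m > 0"
proof -
  have "integral {1..\<eta>} (\<lambda>_. 0) < integral {1..\<eta>} (\<lambda>\<theta>. \<theta> powr - 1 * H m \<theta>)"
  proof (rule integral_less_real)
    show "continuous_on {1..\<eta>} (\<lambda>\<theta>. \<theta> powr - 1 * H m \<theta>)"
      by (intro continuous_on_mult continuous_H) (intro continuous_intros, auto)
    show "{1<..<\<eta>} \<noteq> {}" using \<eta> by simp
    fix \<theta> assume "\<theta> \<in> {1<..<\<eta>}"
    then show "0 < \<theta> powr - 1 * H m \<theta>" using H_pos[of \<theta> m] by simp
  qed simp
  moreover have "Gamma (real (Suc m) - \<alpha> / p) > 0"
    using assms p by (intro Gamma_real_pos) (simp add: pos_divide_less_eq del: of_nat_Suc)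
  ultimately show ?thesis unfolding mass_eq by simp
qed

text \<open>With \<gamma> = \<open>Suc m\<close> this is the last term of \<open>G_0_eq\<close>
  times v^(- 1 - \<alpha>): the unnormalised IBGM density.\<close>

definition jump_density :: "nat \<Rightarrow> real \<Rightarrow> real" where
  "jump_density m v = (if v > 0 then v powr (real (Suc m) * p - \<alpha> - 1) * G (Suc m) v else 0)"

lemma jump_density_measurable [measurable]: "jump_density m \<in> borel_measurable borel"
  unfolding jump_density_def[abs_def] by measurable

lemma jump_density_nonneg: "0 \<le> jump_density m v"
  by (simp add: jump_density_def G_nonneg)

lemma IBGM_density_eq:
  assumes "real (Suc m) * p > \<alpha>"
  shows "mass m * IBGM_density \<alpha> (real (Suc m)) p \<eta> v = jump_density m v"
proof (cases "v > 0")
  case True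
  let ?\<gamma> = "real (Suc m)"
  let ?I = "\<lambda>\<theta>. LBINT u:{1/\<theta>..1}. (1 - u powr p) powr (?\<gamma> - 1) * u powr (- 1 - \<alpha>)"
  have C: "IBGM_const \<alpha> ?\<gamma> p \<eta> \<noteq> 0"
    using mass_pos[OF assms] by (auto simp: mass_def)
  have "(LBINT \<theta>:{1..\<eta>}. \<theta> powr (p * ?\<gamma> - \<alpha> - 1) * exp (- (v powr p * \<theta> powr p)) * ?I \<theta>) =
    (LBINT \<theta>:{1..\<eta>}. (fact m / p) * (dF (Suc m) \<theta> * exp (- (v powr p * \<theta> powr p))))"
  proof (rule set_lebesgue_integral_cong)
    show "\<forall>\<theta>. \<theta> \<in> {1..\<eta>} \<longrightarrow> \<theta> powr (p * ?\<gamma> - \<alpha> - 1) * exp (- (v powr p * \<theta> powr p)) * ?I \<theta> =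
      (fact m / p) * (dF (Suc m) \<theta> * exp (- (v powr p * \<theta> powr p)))"
    proof (intro allI impI)
      fix \<theta> assume "\<theta> \<in> {1..\<eta>}"
      then have "?I \<theta> = fact m * H m \<theta>" by (intro IBGM_inner_eq) simp
      then show "\<theta> powr (p * ?\<gamma> - \<alpha> - 1) * exp (- (v powr p * \<theta> powr p)) * ?I \<theta> =
        (fact m / p) * (dF (Suc m) \<theta> * exp (- (v powr p * \<theta> powr p)))"
        using p by (simp only: dF_Suc_eq mult.commute[of p ?\<gamma>]) simp
    qed
  qed simp
  also have "\<dots> = fact m / p * G (Suc m) v"
    by (simp only: set_integral_mult_right G_eq_LBINT)
  finally have I: "(LBINT \<theta>:{1..\<eta>}. \<theta> powr (p * ?\<gamma> - \<alpha> - 1) * exp (- (v powr p * \<theta> powr p)) * ?I \<theta>) =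
    fact m / p * G (Suc m) v" .
  have "mass m * IBGM_density \<alpha> ?\<gamma> p \<eta> v =
      mass m * (1 / IBGM_const \<alpha> ?\<gamma> p \<eta> * v powr (p * ?\<gamma> - \<alpha> - 1) * (fact m / p * G (Suc m) v))"
    unfolding IBGM_density_def I using True by simp
  also have "\<dots> = v powr (p * ?\<gamma> - \<alpha> - 1) * G (Suc m) v"
    using p C by (simp add: mass_def)
  finally show ?thesis using True by (simp add: jump_density_def mult.commute)
qed (simp add: IBGM_density_def jump_density_def)

end

section \<open>Scaling of Lebesgue integrals on the line\<close>

lemma lborel_integral_scale:
  fixes f :: "real \<Rightarrow> 'a::{banach, second_countable_topology}"
  assumes "c > 0"
  shows "(\<integral>x. f x \<partial>lborel) = c *\<^sub>R (\<integral>x. f (c * x) \<partial>lborel)"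
  using lborel_integral_real_affine[of c f 0] assms by simp

lemma lborel_integrable_scale:
  fixes f :: "real \<Rightarrow> 'a::{banach, second_countable_topology}"
  assumes "c > 0"
  shows "integrable lborel (\<lambda>x. f (c * x)) \<longleftrightarrow> integrable lborel f"
  using lborel_integrable_real_affine_iff[of c f 0] assms by simp

section \<open>The remainder as an IBGM law, and the decomposition in a single direction\<close>

context incomplete_integrals
begin

text \<open>For 1 \<le> \<theta> the tempering exp (- v^p \<theta>^p) is at most exp (- v^p), so
  integrability of \<open>w\<close> against the latter dominates the double integral.\<close>

lemma G_fubini:
  fixes w :: "real \<Rightarrow> 'b::{banach, second_countable_topology}"
  assumes [measurable]: "w \<in> borel_measurable borel"
    and int: "integrable lborel (\<lambda>v. exp (- (v powr p)) *\<^sub>R w v)"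
  shows "integrable lborel (\<lambda>v. G n v *\<^sub>R w v)"
    and "(\<integral>v. G n v *\<^sub>R w v \<partial>lborel) =
      (LBINT \<theta>:{1..\<eta>}. dF n \<theta> *\<^sub>R (\<integral>v. exp (- (v powr p * \<theta> powr p)) *\<^sub>R w v \<partial>lborel))"
proof -
  define d where "d \<theta> = indicator {1..\<eta>} \<theta> * dF n \<theta>" for \<theta>
  have [measurable]: "d \<in> borel_measurable borel"
    unfolding d_def[abs_def] by (rule dF_ind_measurable)
  have d0: "0 \<le> d \<theta>" for \<theta> by (auto simp: d_def indicator_def dF_nonneg)
  have d_int: "integrable lborel d"
    using borel_integrable_atLeastAtMost'[OF continuous_dF] by (simp add: set_integrable_def d_def[abs_def])
  define f where "f \<theta> v = d \<theta> *\<^sub>R exp (- (v powr p * \<theta> powr p)) *\<^sub>R w v" for \<theta> v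
  have fm [measurable]: "(\<lambda>q. f (fst q) (snd q)) \<in> borel_measurable (lborel \<Otimes>\<^sub>M lborel)"
    unfolding f_def by measurable
  define m where "m v = norm (exp (- (v powr p)) *\<^sub>R w v)" for v
  have m_int: "integrable lborel m"
    unfolding m_def[abs_def] by (rule integrable_norm[OF int])
  have [measurable]: "m \<in> borel_measurable borel" unfolding m_def[abs_def] by measurable
  have P: "integrable (lborel \<Otimes>\<^sub>M lborel) (\<lambda>q. d (fst q) * m (snd q))"
  proof (rule lborel_pair.Fubini_integrable)
    have "(\<integral>v. norm (d \<theta> * m v) \<partial>lborel) = d \<theta> * (\<integral>v. m v \<partial>lborel)" for \<theta>
      using d0[of \<theta>] by (simp add: abs_mult m_def)
    then show "integrable lborel (\<lambda>\<theta>. \<integral>v. norm (d (fst (\<theta>, v)) * m (snd (\<theta>, v))) \<partial>lborel)"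
      using d_int by simp
    show "AE \<theta> in lborel. integrable lborel (\<lambda>v. d (fst (\<theta>, v)) * m (snd (\<theta>, v)))"
      using m_int by simp
  qed measurable
  have fint: "integrable (lborel \<Otimes>\<^sub>M lborel) (\<lambda>(\<theta>, v). f \<theta> v)"
    unfolding case_prod_unfold
  proof (rule Bochner_Integration.integrable_bound[OF P fm])
    show "AE q in lborel \<Otimes>\<^sub>M lborel. norm (f (fst q) (snd q)) \<le> norm (d (fst q) * m (snd q))"
    proof (rule AE_I2)
      fix q :: "real \<times> real"
      obtain \<theta> v where q: "q = (\<theta>, v)" by force
      have "exp (- (v powr p * \<theta> powr p)) \<le> exp (- (v powr p))" if "1 \<le> \<theta>"
      proof -
        have "v powr p * 1 \<le> v powr p * \<theta> powr p"
          using p that by (intro mult_left_mono) (auto intro!: ge_one_powr_ge_zero)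
        then show ?thesis by simp
      qed
      then have "d \<theta> * (exp (- (v powr p * \<theta> powr p)) * norm (w v)) \<le> d \<theta> * (exp (- (v powr p)) * norm (w v))"
        by (cases "\<theta> \<in> {1..\<eta>}") (auto simp: d_def intro!: mult_left_mono mult_right_mono dF_nonneg)
      then show "norm (f (fst q) (snd q)) \<le> norm (d (fst q) * m (snd q))"
        using d0[of \<theta>] by (simp add: q f_def m_def abs_mult)
    qed
  qed
  have G: "(\<integral>\<theta>. f \<theta> v \<partial>lborel) = G n v *\<^sub>R w v" for v
  proof -
    have "set_integrable lborel {1..\<eta>} (\<lambda>\<theta>. dF n \<theta> * exp (- (v powr p * \<theta> powr p)))"
      by (intro borel_integrable_atLeastAtMost' continuous_on_mult continuous_dF) (intro continuous_intros, auto)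
    then have "integrable lborel (\<lambda>\<theta>. d \<theta> * exp (- (v powr p * \<theta> powr p)))"
      by (simp add: set_integrable_def d_def mult.assoc)
    from integral_scaleR_left[OF this, of "w v"] show ?thesis
      by (simp add: f_def G_eq_LBINT set_lebesgue_integral_def d_def mult.assoc)
  qed
  show "integrable lborel (\<lambda>v. G n v *\<^sub>R w v)"
    using lborel_pair.integrable_snd[OF fint] unfolding G .
  have "(\<integral>v. (\<integral>\<theta>. f \<theta> v \<partial>lborel) \<partial>lborel) = (\<integral>\<theta>. (\<integral>v. f \<theta> v \<partial>lborel) \<partial>lborel)"
    by (rule lborel_pair.Fubini_integral[OF fint])
  then show "(\<integral>v. G n v *\<^sub>R w v \<partial>lborel) =
      (LBINT \<theta>:{1..\<eta>}. dF n \<theta> *\<^sub>R (\<integral>v. exp (- (v powr p * \<theta> powr p)) *\<^sub>R w v \<partial>lborel))"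
  proof -
    have "(\<integral>v. f \<theta> v \<partial>lborel) = d \<theta> *\<^sub>R (\<integral>v. exp (- (v powr p * \<theta> powr p)) *\<^sub>R w v \<partial>lborel)" for \<theta>
      unfolding f_def by (rule integral_scaleR_right)
    then show ?thesis
      using \<open>(\<integral>v. (\<integral>\<theta>. f \<theta> v \<partial>lborel) \<partial>lborel) = (\<integral>\<theta>. (\<integral>v. f \<theta> v \<partial>lborel) \<partial>lborel)\<close>
      unfolding G by (simp only: set_lebesgue_integral_def d_def scaleR_scaleR)
  qed
qed

lemma powr_jump_density_integrable:
  assumes a: "real (Suc m) * p - \<alpha> > 0" and k: "0 \<le> k"
  shows "integrable lborel (\<lambda>v. v powr k * jump_density m v)"
proof -
  let ?a = "real (Suc m) * p - \<alpha>"
  let ?w = "\<lambda>v. indicator {0<..} v * v powr (?a + k - 1)"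
  have "integrable lborel (\<lambda>v. G (Suc m) v *\<^sub>R ?w v)"
    using gamma_powr_integral(1)[OF p, of "?a + k"] a k
    by (intro G_fubini) (auto simp: set_integrable_def mult_ac)
  moreover have "G (Suc m) v *\<^sub>R ?w v = v powr k * jump_density m v" for v
  proof -
    have "v powr (?a + k - 1) = v powr k * v powr (?a - 1)"
      unfolding powr_add[symmetric] by (simp add: algebra_simps)
    then show ?thesis by (simp add: jump_density_def indicator_def)
  qed
  ultimately show ?thesis by simp
qed

text \<open>After exchanging the integrals, the substitution u = \<theta> v leaves a Gamma integral
  and a negative power of \<theta>, which combines with the power in \<open>dF\<close> to 1 /
  \<theta>. The result is the double integral in the constant C, which confirms that C normalises
  the density.\<close>

lemma jump_density_integral:
  assumes a: "real (Suc m) * p - \<alpha> > 0"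
  shows "(\<integral>v. jump_density m v \<partial>lborel) = mass m"
proof -
  let ?a = "real (Suc m) * p - \<alpha>"
  let ?w = "\<lambda>v. indicator {0<..} v * v powr (?a - 1)"
  let ?g = "\<lambda>u. indicator {0<..} u * (u powr (?a - 1) * exp (- (u powr p)))"
  have gam: "(\<integral>u. ?g u \<partial>lborel) = Gamma (?a / p) / p"
    using gamma_powr_integral(2)[OF p a] by (simp add: set_lebesgue_integral_def)
  have inner: "(\<integral>v. exp (- (v powr p * \<theta> powr p)) *\<^sub>R ?w v \<partial>lborel) = \<theta> powr - ?a * (Gamma (?a / p) / p)"
    if \<theta>: "1 \<le> \<theta>" for \<theta>
  proof -
    have "(\<integral>u. ?g u \<partial>lborel) = \<theta> *\<^sub>R (\<integral>v. ?g (\<theta> * v) \<partial>lborel)"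
      using \<theta> by (intro lborel_integral_scale) simp
    also have "(\<lambda>v. ?g (\<theta> * v)) = (\<lambda>v. \<theta> powr (?a - 1) * (exp (- (v powr p * \<theta> powr p)) *\<^sub>R ?w v))"
      using \<theta> by (auto simp: fun_eq_iff indicator_def zero_less_mult_iff powr_mult mult_ac)
    also have "\<theta> *\<^sub>R (\<integral>v. \<theta> powr (?a - 1) * (exp (- (v powr p * \<theta> powr p)) *\<^sub>R ?w v) \<partial>lborel) =
        (\<theta> * \<theta> powr (?a - 1)) * (\<integral>v. exp (- (v powr p * \<theta> powr p)) *\<^sub>R ?w v \<partial>lborel)"
      by simp
    also have "\<theta> * \<theta> powr (?a - 1) = \<theta> powr ?a" using \<theta> by (simp add: powr_mult_base)
    finally have eq: "Gamma (?a / p) / p = \<theta> powr ?a * (\<integral>v. exp (- (v powr p * \<theta> powr p)) *\<^sub>R ?w v \<partial>lborel)"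
      unfolding gam .
    have "\<theta> powr - ?a * \<theta> powr ?a = 1" using \<theta> by (simp only: powr_add[symmetric]) simp
    then show ?thesis unfolding eq mult.assoc[symmetric] by (simp only: mult_1)
  qed
  have "(\<integral>v. jump_density m v \<partial>lborel) = (\<integral>v. G (Suc m) v *\<^sub>R ?w v \<partial>lborel)"
    by (intro Bochner_Integration.integral_cong) (auto simp: jump_density_def indicator_def)
  also have "\<dots> = (LBINT \<theta>:{1..\<eta>}. dF (Suc m) \<theta> *\<^sub>R (\<integral>v. exp (- (v powr p * \<theta> powr p)) *\<^sub>R ?w v \<partial>lborel))"
    using gamma_powr_integral(1)[OF p a]
    by (intro G_fubini) (auto simp: set_integrable_def mult_ac)
  also have "\<dots> = (LBINT \<theta>:{1..\<eta>}. Gamma (?a / p) * (\<theta> powr - 1 * H m \<theta>))"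
  proof (rule set_lebesgue_integral_cong, simp, intro allI impI)
    fix \<theta> assume "\<theta> \<in> {1..\<eta>}"
    then have \<theta>: "1 \<le> \<theta>" by simp
    have "?a - 1 + - ?a = - 1" by simp
    then have "\<theta> powr (?a - 1) * \<theta> powr - ?a = \<theta> powr - 1" by (simp only: powr_add[symmetric])
    then show "dF (Suc m) \<theta> *\<^sub>R (\<integral>v. exp (- (v powr p * \<theta> powr p)) *\<^sub>R ?w v \<partial>lborel) =
        Gamma (?a / p) * (\<theta> powr - 1 * H m \<theta>)"
    proof -
      have "(p * A * Hm) *\<^sub>R (B * (g / p)) = g * ((A * B) * Hm)" for A B Hm g :: real
        using p by simp
      then show ?thesis
        unfolding inner[OF \<theta>] dF_Suc_eq using \<open>\<theta> powr (?a - 1) * \<theta> powr - ?a = \<theta> powr - 1\<close> by (simp only:)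
    qed
  qed
  also have "\<dots> = Gamma (?a / p) * integral {1..\<eta>} (\<lambda>\<theta>. \<theta> powr - 1 * H m \<theta>)"
  proof -
    have "continuous_on {1..\<eta>} (\<lambda>\<theta>. \<theta> powr - 1 * H m \<theta>)"
      by (intro continuous_on_mult continuous_H) (intro continuous_intros, auto)
    then show ?thesis by (simp only: set_integral_mult_right LBINT_eq_integral_continuous)
  qed
  also have "?a / p = real (Suc m) - \<alpha> / p" using p by (simp add: diff_divide_distrib del: of_nat_Suc)
  finally show ?thesis unfolding mass_eq .
qed

lemma IBGM_density_jump:
  assumes a: "real (Suc m) * p - \<alpha> > 0"
  shows "IBGM_density \<alpha> (real (Suc m)) p \<eta> v = jump_density m v / mass m"
  using IBGM_density_eq[of m v] mass_pos[of m] a by (simp add: field_simps del: of_nat_Suc)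

lemma IBGM_eq:
  assumes a: "real (Suc m) * p - \<alpha> > 0"
  shows "IBGM \<alpha> (real (Suc m)) p \<eta> = density lborel (\<lambda>v. ennreal (jump_density m v / mass m))"
  unfolding IBGM_def IBGM_density_jump[OF a] ..

lemma integral_IBGM:
  fixes f :: "real \<Rightarrow> 'b::{banach, second_countable_topology}"
  assumes a: "real (Suc m) * p - \<alpha> > 0" and [measurable]: "f \<in> borel_measurable borel"
  shows "mass m *\<^sub>R (\<integral>v. f v \<partial>IBGM \<alpha> (real (Suc m)) p \<eta>) = (\<integral>v. jump_density m v *\<^sub>R f v \<partial>lborel)"
proof -
  have mp: "mass m > 0" using mass_pos[of m] a by simp
  have "(\<integral>v. f v \<partial>IBGM \<alpha> (real (Suc m)) p \<eta>) = (\<integral>v. (jump_density m v / mass m) *\<^sub>R f v \<partial>lborel)"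
    unfolding IBGM_eq[OF a] using mp by (intro integral_density) (auto simp: jump_density_nonneg)
  also have "\<dots> = (\<integral>v. (1 / mass m) *\<^sub>R (jump_density m v *\<^sub>R f v) \<partial>lborel)" by simp
  also have "\<dots> = (1 / mass m) *\<^sub>R (\<integral>v. jump_density m v *\<^sub>R f v \<partial>lborel)"
    by (rule integral_scaleR_right)
  finally show ?thesis using mp by simp
qed

lemma prob_space_IBGM:
  assumes a: "real (Suc m) * p - \<alpha> > 0"
  shows "prob_space (IBGM \<alpha> (real (Suc m)) p \<eta>)"
proof (rule prob_spaceI)
  have mp: "mass m > 0" using mass_pos[of m] a by simp
  have i: "integrable lborel (jump_density m)"
  proof (rule integrable_cong_AE_imp[OF powr_jump_density_integrable[OF a order_refl]])
    show "AE v in lborel. v powr 0 * jump_density m v = jump_density m v"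
      by (auto simp: jump_density_def)
  qed simp
  have "emeasure (IBGM \<alpha> (real (Suc m)) p \<eta>) UNIV = (\<integral>\<^sup>+v. ennreal (jump_density m v / mass m) \<partial>lborel)"
    unfolding IBGM_eq[OF a] by (subst emeasure_density) auto
  also have "\<dots> = ennreal (\<integral>v. jump_density m v / mass m \<partial>lborel)"
    using i mp by (intro nn_integral_eq_integral integrable_divide_zero) (auto simp: jump_density_nonneg)
  also have "(\<integral>v. jump_density m v / mass m \<partial>lborel) = 1"
    using jump_density_integral[OF a] mp by simp
  finally show "emeasure (IBGM \<alpha> (real (Suc m)) p \<eta>) (space (IBGM \<alpha> (real (Suc m)) p \<eta>)) = 1"
    by (simp add: IBGM_def)
qed

lemma sets_IBGM [simp]: "sets (IBGM \<alpha> \<gamma> p \<eta>) = sets borel"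
  by (simp add: IBGM_def)

lemma integrable_IBGM:
  assumes a: "real (Suc m) * p - \<alpha> > 0"
  shows "integrable (IBGM \<alpha> (real (Suc m)) p \<eta>) (\<lambda>v. v)"
proof -
  have mp: "mass m > 0" using mass_pos[of m] a by simp
  have "integrable lborel (\<lambda>v. (1 / mass m) * (v powr 1 * jump_density m v))"
    using powr_jump_density_integrable[OF a, of 1] by (rule integrable_mult_right) simp
  moreover have "(1 / mass m) * (v powr 1 * jump_density m v) = (jump_density m v / mass m) *\<^sub>R v" for v
    by (simp add: jump_density_def)
  ultimately have *: "integrable lborel (\<lambda>v. (jump_density m v / mass m) *\<^sub>R v)" by (simp only:)
  show ?thesis
    unfolding IBGM_eq[OF a]
  proof (subst integrable_density)
    show "AE v in lborel. 0 \<le> jump_density m v / mass m"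
      using mp by (simp add: jump_density_nonneg)
  qed (use * in simp_all)
qed

text \<open>The compensator of order \<open>\<alpha>\<close> differs from the one of order \<open>\<alpha> - n p\<close> by a linear term in the
  case that gives rise to the constants \<open>b\<^sup>*\<^sub>n\<close>.\<close>

lemma ts_jump_order_change:
  assumes "\<alpha>' \<le> \<alpha>"
  shows "ts_jump \<alpha> y = ts_jump \<alpha>' y - (if 1 \<le> \<alpha> \<and> \<alpha>' < 1 then \<i> * complex_of_real y else 0)"
  using assms by (auto simp: ts_jump_def)

text \<open>For \<alpha>' = \<alpha> - n p this value is the Gamma factor in the constants
  b*_n.\<close>

lemma ts_kernel_first_moment:
  assumes "\<alpha>' < 1"
  shows "set_integrable lborel {0<..} (\<lambda>u. u * ts_kernel p \<alpha>' u)"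
    and "(LBINT u:{0<..}. u * ts_kernel p \<alpha>' u) = Gamma ((1 - \<alpha>') / p) / p"
proof -
  have e: "u * ts_kernel p \<alpha>' u = u powr ((1 - \<alpha>') - 1) * exp (- (u powr p))" if "u > 0" for u
    using that powr_mult_base[of u "- 1 - \<alpha>'"] by (simp add: ts_kernel_def mult.assoc[symmetric])
  have s: "1 - \<alpha>' > 0" using assms by simp
  show "set_integrable lborel {0<..} (\<lambda>u. u * ts_kernel p \<alpha>' u)"
    using gamma_powr_integral(1)[OF p s] by (subst set_integrable_cong[OF refl refl e]) auto
  show "(LBINT u:{0<..}. u * ts_kernel p \<alpha>' u) = Gamma ((1 - \<alpha>') / p) / p"
    unfolding gamma_powr_integral(2)[OF p s, symmetric]
    by (rule set_lebesgue_integral_cong) (use e in auto)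
qed

lemma ts_integral_order_change:
  assumes \<alpha>': "\<alpha>' \<le> \<alpha>" "\<alpha> < 2"
  shows "set_integrable lborel {0<..} (\<lambda>u. ts_jump \<alpha> (u * s) * complex_of_real (ts_kernel p \<alpha>' u))"
    and "(CLBINT u:{0<..}. ts_jump \<alpha> (u * s) * complex_of_real (ts_kernel p \<alpha>' u)) =
      ts_integral p \<alpha>' s - (if 1 \<le> \<alpha> \<and> \<alpha>' < 1 then \<i> * complex_of_real (s * (Gamma ((1 - \<alpha>') / p) / p)) else 0)"
proof -
  let ?c = "if 1 \<le> \<alpha> \<and> \<alpha>' < 1 then \<i> * complex_of_real s else 0"
  have eq: "ts_jump \<alpha> (u * s) * complex_of_real (ts_kernel p \<alpha>' u) =
    ts_jump \<alpha>' (u * s) * complex_of_real (ts_kernel p \<alpha>' u) - ?c * complex_of_real (u * ts_kernel p \<alpha>' u)" for u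
    unfolding ts_jump_order_change[OF \<alpha>'(1)] by (simp add: algebra_simps)
  have i1: "set_integrable lborel {0<..} (\<lambda>u. ts_jump \<alpha>' (u * s) * complex_of_real (ts_kernel p \<alpha>' u))"
    by (rule ts_integrand_integrable[OF p]) (use \<alpha>' in simp)
  have i2: "set_integrable lborel {0<..} (\<lambda>u. ?c * complex_of_real (u * ts_kernel p \<alpha>' u))"
  proof (cases "1 \<le> \<alpha> \<and> \<alpha>' < 1")
    case True
    then have "integrable lborel (\<lambda>u. complex_of_real (indicator {0<..} u *\<^sub>R (u * ts_kernel p \<alpha>' u)))"
      using ts_kernel_first_moment(1)[of \<alpha>'] unfolding set_integrable_def by (intro integrable_of_real) simp
    then have "set_integrable lborel {0<..} (\<lambda>u. complex_of_real (u * ts_kernel p \<alpha>' u))"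
      by (simp add: set_integrable_def scaleR_conv_of_real)
    then show ?thesis by (rule set_integrable_mult_right)
  next
    case False
    show ?thesis unfolding if_not_P[OF False] by (simp add: set_integrable_def)
  qed
  show "set_integrable lborel {0<..} (\<lambda>u. ts_jump \<alpha> (u * s) * complex_of_real (ts_kernel p \<alpha>' u))"
    unfolding eq by (rule set_integral_diff(1)[OF i1 i2])
  have "(CLBINT u:{0<..}. ?c * complex_of_real (u * ts_kernel p \<alpha>' u)) =
     (if 1 \<le> \<alpha> \<and> \<alpha>' < 1 then \<i> * complex_of_real (s * (Gamma ((1 - \<alpha>') / p) / p)) else 0)"
  proof (cases "1 \<le> \<alpha> \<and> \<alpha>' < 1")
    case True
    have "(CLBINT u:{0<..}. \<i> * complex_of_real s * complex_of_real (u * ts_kernel p \<alpha>' u)) =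
        \<i> * complex_of_real s * (CLBINT u:{0<..}. complex_of_real (u * ts_kernel p \<alpha>' u))"
      by (rule set_integral_mult_right)
    also have "(CLBINT u:{0<..}. complex_of_real (u * ts_kernel p \<alpha>' u)) =
        complex_of_real (LBINT u:{0<..}. u * ts_kernel p \<alpha>' u)"
      unfolding set_lebesgue_integral_def by (subst integral_complex_of_real[symmetric]) (simp add: scaleR_conv_of_real)
    finally show ?thesis using True by (simp only: ts_kernel_first_moment(2) if_True simp_thms) simp
  next
    case False
    show ?thesis unfolding if_not_P[OF False] by (simp add: set_lebesgue_integral_def)
  qed
  then show "(CLBINT u:{0<..}. ts_jump \<alpha> (u * s) * complex_of_real (ts_kernel p \<alpha>' u)) =
      ts_integral p \<alpha>' s - (if 1 \<le> \<alpha> \<and> \<alpha>' < 1 then \<i> * complex_of_real (s * (Gamma ((1 - \<alpha>') / p) / p)) else 0)"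
    unfolding eq set_integral_diff(2)[OF i1 i2] ts_integral_def by simp
qed

text \<open>This is the theorem for a single direction, at the level of exponents, with s standing
  for x \<bullet> v. The left side becomes an integral against \<open>G 0\<close>; expanding by
  \<open>G_0_eq\<close> gives one tempered stable exponent for each boundary term and a compound
  Poisson exponent for the remainder, each corrected by the difference of compensators.\<close>

lemma scalar_decomposition:
  fixes s :: real
  assumes \<alpha>: "\<alpha> < 2" and a: "real (Suc m) * p - \<alpha> > 0"
  shows "(CLBINT \<theta>:{1..\<eta>}. (1 / \<theta>) *\<^sub>R ts_integral p \<alpha> (s / \<theta>)) =
    (\<Sum>n<Suc m. H n \<eta> *\<^sub>R (ts_integral p (\<alpha> - real n * p) (s / \<eta>) -
       (if 1 \<le> \<alpha> \<and> \<alpha> - real n * p < 1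
        then \<i> * complex_of_real (s / \<eta> * (Gamma ((1 - (\<alpha> - real n * p)) / p) / p)) else 0))) +
    mass m *\<^sub>R ((CLINT v|IBGM \<alpha> (real (Suc m)) p \<eta>. iexp (v * s)) - 1 -
       (if 1 \<le> \<alpha> then \<i> * complex_of_real ((\<integral>v. v \<partial>IBGM \<alpha> (real (Suc m)) p \<eta>) * s) else 0))"
proof -
  let ?\<mu> = "IBGM \<alpha> (real (Suc m)) p \<eta>"
  \<comment> \<open>The jump function is multiplied by the stable density v^(- 1 - \<alpha>); the
    tempering is left to \<open>G\<close>.\<close>
  define w where "w v = (if v > 0 then v powr (- 1 - \<alpha>) *\<^sub>R ts_jump \<alpha> (v * s) else 0)" for v
  have wm [measurable]: "w \<in> borel_measurable borel" unfolding w_def[abs_def] by measurable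
  have w_int: "integrable lborel (\<lambda>v. exp (- (v powr p)) *\<^sub>R w v)"
  proof -
    have "integrable lborel (\<lambda>u. indicator {0<..} u *\<^sub>R (ts_jump \<alpha> (u * s) * complex_of_real (ts_kernel p \<alpha> u)))"
      using ts_integrand_integrable[OF p \<alpha>] unfolding set_integrable_def .
    moreover have "indicator {0<..} u *\<^sub>R (ts_jump \<alpha> (u * s) * complex_of_real (ts_kernel p \<alpha> u)) =
        exp (- (u powr p)) *\<^sub>R w u" for u
      by (simp add: w_def ts_kernel_def scaleR_conv_of_real mult_ac indicator_def)
    ultimately show ?thesis by simp
  qed
  \<comment> \<open>For each \<theta> the substitution u = \<theta> v moves the scaling from the
    jump into the tempering factor and produces \<theta>^(- 1 - \<alpha>), which is
    \<open>dF 0 \<theta>\<close>.\<close>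
  have lhs: "(CLBINT \<theta>:{1..\<eta>}. (1 / \<theta>) *\<^sub>R ts_integral p \<alpha> (s / \<theta>)) = (\<integral>v. G 0 v *\<^sub>R w v \<partial>lborel)"
    unfolding G_fubini(2)[OF wm w_int]
  proof (rule set_lebesgue_integral_cong, simp, intro allI impI)
    fix \<theta> assume "\<theta> \<in> {1..\<eta>}"
    then have \<theta>: "\<theta> > 0" by simp
    have "ts_integral p \<alpha> (s / \<theta>) =
      (\<integral>u. indicator {0<..} u *\<^sub>R (ts_jump \<alpha> (u * (s / \<theta>)) * complex_of_real (ts_kernel p \<alpha> u)) \<partial>lborel)"
      by (simp add: ts_integral_def set_lebesgue_integral_def)
    also have "\<dots> = \<theta> *\<^sub>R (\<integral>v. indicator {0<..} (\<theta> * v) *\<^sub>R (ts_jump \<alpha> (\<theta> * v * (s / \<theta>)) * complex_of_real (ts_kernel p \<alpha> (\<theta> * v))) \<partial>lborel)"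
      by (rule lborel_integral_scale[OF \<theta>])
    also have "(\<lambda>v. indicator {0<..} (\<theta> * v) *\<^sub>R (ts_jump \<alpha> (\<theta> * v * (s / \<theta>)) * complex_of_real (ts_kernel p \<alpha> (\<theta> * v)))) =
       (\<lambda>v. \<theta> powr (- 1 - \<alpha>) *\<^sub>R (exp (- (v powr p * \<theta> powr p)) *\<^sub>R w v))"
      using \<theta> by (auto simp: fun_eq_iff indicator_def zero_less_mult_iff w_def ts_kernel_def powr_mult
          scaleR_conv_of_real mult_ac)
    also have "(\<integral>v. \<theta> powr (- 1 - \<alpha>) *\<^sub>R (exp (- (v powr p * \<theta> powr p)) *\<^sub>R w v) \<partial>lborel) =
        \<theta> powr (- 1 - \<alpha>) *\<^sub>R (\<integral>v. exp (- (v powr p * \<theta> powr p)) *\<^sub>R w v \<partial>lborel)"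
      by (rule integral_scaleR_right)
    finally show "(1 / \<theta>) *\<^sub>R ts_integral p \<alpha> (s / \<theta>) =
        dF 0 \<theta> *\<^sub>R (\<integral>v. exp (- (v powr p * \<theta> powr p)) *\<^sub>R w v \<partial>lborel)"
      using \<theta> by (simp add: dF_0)
  qed
  have \<eta>0: "\<eta> > 0" using \<eta> by simp
  let ?t = "\<lambda>n v. (v powr (real n * p) * F n \<eta> * exp (- (v powr p * \<eta> powr p))) *\<^sub>R w v"
  have tm: "integrable lborel (?t n) \<and> (\<integral>v. ?t n v \<partial>lborel) = H n \<eta> *\<^sub>R (ts_integral p (\<alpha> - real n * p) (s / \<eta>) -
       (if 1 \<le> \<alpha> \<and> \<alpha> - real n * p < 1
        then \<i> * complex_of_real (s / \<eta> * (Gamma ((1 - (\<alpha> - real n * p)) / p) / p)) else 0))" for n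
  proof -
    let ?\<beta> = "\<alpha> - real n * p"
    have \<beta>: "?\<beta> \<le> \<alpha>" using p by simp
    define g where "g u = indicator {0<..} u *\<^sub>R (ts_jump \<alpha> (u * (s / \<eta>)) * complex_of_real (ts_kernel p ?\<beta> u))" for u
    have gi: "integrable lborel g"
      using ts_integral_order_change(1)[OF \<beta> \<alpha>] unfolding set_integrable_def g_def[abs_def] .
    \<comment> \<open>The substitution u = \<eta> v turns the boundary term into a kernel of order
      \<alpha> - n p with standard tempering. The powers of \<eta> cancel against those in
      \<open>F n \<eta>\<close>, leaving \<open>H n \<eta>\<close> and the argument s /
      \<eta>.\<close>
    have g\<eta>: "\<eta> *\<^sub>R (H n \<eta> *\<^sub>R g (\<eta> * v)) = ?t n v" for v
    proof (cases "v > 0")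
      case True
      have "\<eta> powr (- 1 - ?\<beta>) * \<eta> = \<eta> powr - ?\<beta>"
        using powr_mult_base[of \<eta> "- 1 - ?\<beta>"] \<eta>0 by (simp add: mult.commute)
      moreover have "v powr (- 1 - ?\<beta>) = v powr (real n * p) * v powr (- 1 - \<alpha>)"
      proof -
        have "- 1 - ?\<beta> = real n * p + (- 1 - \<alpha>)" by simp
        then show ?thesis by (simp only: powr_add)
      qed
      moreover have "F n \<eta> = \<eta> powr - ?\<beta> * H n \<eta>" by (simp add: F_def)
      ultimately show ?thesis
        using True \<eta>0 by (simp add: g_def w_def ts_kernel_def powr_mult scaleR_conv_of_real mult_ac flip: of_real_mult)
    qed (use \<eta>0 in \<open>simp add: g_def w_def zero_less_mult_iff indicator_def\<close>)
    have "integrable lborel (\<lambda>v. g (\<eta> * v))"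
      using gi lborel_integrable_scale[OF \<eta>0] by blast
    then have "integrable lborel (\<lambda>v. \<eta> *\<^sub>R (H n \<eta> *\<^sub>R g (\<eta> * v)))"
      by (intro integrable_scaleR_right)
    moreover have "(\<integral>v. \<eta> *\<^sub>R (H n \<eta> *\<^sub>R g (\<eta> * v)) \<partial>lborel) = H n \<eta> *\<^sub>R (\<integral>u. g u \<partial>lborel)"
      using lborel_integral_scale[OF \<eta>0, of g] by simp
    moreover have "(\<integral>u. g u \<partial>lborel) = (CLBINT u:{0<..}. ts_jump \<alpha> (u * (s / \<eta>)) * complex_of_real (ts_kernel p ?\<beta> u))"
      by (simp add: set_lebesgue_integral_def g_def)
    ultimately show ?thesis
      unfolding g\<eta> ts_integral_order_change(2)[OF \<beta> \<alpha>] by simp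
  qed
  have decomp: "G 0 v *\<^sub>R w v = (\<Sum>n<Suc m. ?t n v) + jump_density m v *\<^sub>R ts_jump \<alpha> (v * s)" for v
  proof (cases "v > 0")
    case True
    have "real (Suc m) * p + (- 1 - \<alpha>) = real (Suc m) * p - \<alpha> - 1" by simp
    then have "v powr (real (Suc m) * p) * v powr (- 1 - \<alpha>) = v powr (real (Suc m) * p - \<alpha> - 1)"
      by (simp only: powr_add[symmetric])
    then have "(v powr (real (Suc m) * p) * G (Suc m) v) *\<^sub>R w v = jump_density m v *\<^sub>R ts_jump \<alpha> (v * s)"
      using True by (simp add: w_def jump_density_def mult_ac)
    then show ?thesis
      unfolding G_0_eq[OF True, of "Suc m"] scaleR_add_left scaleR_sum_left by (simp only:)
  qed (simp add: w_def jump_density_def)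
  have sum_int: "integrable lborel (\<lambda>v. \<Sum>n<Suc m. ?t n v)"
    using tm by (intro Bochner_Integration.integrable_sum) blast
  \<comment> \<open>The remainder is integrable as the difference of the whole and the boundary
    terms.\<close>
  have rem_int: "integrable lborel (\<lambda>v. jump_density m v *\<^sub>R ts_jump \<alpha> (v * s))"
  proof -
    have "integrable lborel (\<lambda>v. G 0 v *\<^sub>R w v - (\<Sum>n<Suc m. ?t n v))"
      by (intro Bochner_Integration.integrable_diff G_fubini(1) sum_int w_int) measurable
    then show ?thesis unfolding decomp by simp
  qed
  interpret \<mu>: prob_space ?\<mu> by (rule prob_space_IBGM[OF a])
  have "(\<integral>v. G 0 v *\<^sub>R w v \<partial>lborel) = (\<Sum>n<Suc m. \<integral>v. ?t n v \<partial>lborel) + (\<integral>v. jump_density m v *\<^sub>R ts_jump \<alpha> (v * s) \<partial>lborel)"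
    unfolding decomp Bochner_Integration.integral_add[OF sum_int rem_int]
    using tm by (subst Bochner_Integration.integral_sum) auto
  also have "(\<integral>v. jump_density m v *\<^sub>R ts_jump \<alpha> (v * s) \<partial>lborel) = mass m *\<^sub>R (\<integral>v. ts_jump \<alpha> (v * s) \<partial>?\<mu>)"
    by (rule integral_IBGM[OF a, symmetric]) simp
  also have "(\<integral>v. ts_jump \<alpha> (v * s) \<partial>?\<mu>) = (CLINT v|?\<mu>. iexp (v * s)) - 1 -
       (if 1 \<le> \<alpha> then \<i> * complex_of_real ((\<integral>v. v \<partial>?\<mu>) * s) else 0)"
  proof -
    have [measurable_cong]: "sets ?\<mu> = sets borel" by simp
    have i1: "integrable ?\<mu> (\<lambda>v. iexp (v * s))" by (rule \<mu>.integrable_iexp_real) measurable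
    have i2: "integrable ?\<mu> (\<lambda>v. \<i> * complex_of_real (v * s))"
      by (intro integrable_mult_right integrable_of_real integrable_mult_left integrable_IBGM[OF a])
    have "(\<integral>v. \<i> * complex_of_real (v * s) \<partial>?\<mu>) = \<i> * complex_of_real ((\<integral>v. v \<partial>?\<mu>) * s)"
      unfolding integral_mult_right_zero integral_complex_of_real integral_mult_left_zero ..
    moreover have i3: "integrable ?\<mu> (\<lambda>v. iexp (v * s) - 1)"
      by (rule Bochner_Integration.integrable_diff[OF i1]) (rule \<mu>.integrable_const)
    moreover have "(CLINT v|?\<mu>. iexp (v * s) - 1) = (CLINT v|?\<mu>. iexp (v * s)) - 1"
      using Bochner_Integration.integral_diff[OF i1 \<mu>.integrable_const, of 1] \<mu>.prob_space
      by (simp del: of_nat_Suc of_real_mult)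
    ultimately show ?thesis
      unfolding ts_jump_def
      by (cases "1 \<le> \<alpha>") (simp_all add: Bochner_Integration.integral_diff[OF i3 i2] del: of_real_mult of_nat_Suc)
  qed
  finally show ?thesis
    unfolding lhs using tm by simp
qed

end

subsection \<open>The product space of the transition law\<close>

text \<open>The canonical model: all variables are coordinates of a product space, so joint
  independence becomes a computation with rectangles.\<close>

locale transition_space =
  fixes r :: real and \<mu>X :: "nat \<Rightarrow> 'a::euclidean_space measure" and \<mu>V :: "'a measure" and \<mu>W :: "real measure"
  assumes r: "r > 0"
    and X: "\<And>n. prob_space (\<mu>X n)" and sX [simp, measurable_cong]: "\<And>n. sets (\<mu>X n) = sets borel"
    and V: "prob_space \<mu>V" and sV [simp, measurable_cong]: "sets \<mu>V = sets borel"
    and W: "prob_space \<mu>W" and sW [simp, measurable_cong]: "sets \<mu>W = sets borel"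
begin

abbreviation "pN \<equiv> measure_pmf (poisson_pmf r)"
abbreviation "PX \<equiv> PiM (UNIV::nat set) \<mu>X"
abbreviation "PV \<equiv> PiM (UNIV::nat set) (\<lambda>_. \<mu>V)"
abbreviation "PW \<equiv> PiM (UNIV::nat set) (\<lambda>_. \<mu>W)"

definition \<Omega> :: "(nat \<times> (nat \<Rightarrow> 'a) \<times> (nat \<Rightarrow> 'a) \<times> (nat \<Rightarrow> real)) measure" where
  "\<Omega> = pN \<Otimes>\<^sub>M (PX \<Otimes>\<^sub>M (PV \<Otimes>\<^sub>M PW))"

definition rN :: "(nat \<times> (nat \<Rightarrow> 'a) \<times> (nat \<Rightarrow> 'a) \<times> (nat \<Rightarrow> real)) \<Rightarrow> nat" where
  "rN \<omega> = fst \<omega>"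

definition rX :: "nat \<Rightarrow> (nat \<times> (nat \<Rightarrow> 'a) \<times> (nat \<Rightarrow> 'a) \<times> (nat \<Rightarrow> real)) \<Rightarrow> 'a" where
  "rX n \<omega> = fst (snd \<omega>) n"

definition rV :: "nat \<Rightarrow> (nat \<times> (nat \<Rightarrow> 'a) \<times> (nat \<Rightarrow> 'a) \<times> (nat \<Rightarrow> real)) \<Rightarrow> 'a" where
  "rV n \<omega> = fst (snd (snd \<omega>)) n"

definition rW :: "nat \<Rightarrow> (nat \<times> (nat \<Rightarrow> 'a) \<times> (nat \<Rightarrow> 'a) \<times> (nat \<Rightarrow> real)) \<Rightarrow> real" where
  "rW n \<omega> = snd (snd (snd \<omega>)) n"

lemma space_eq [simp]: "space (\<mu>X n) = UNIV" "space \<mu>V = UNIV" "space \<mu>W = UNIV"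
  using sets_eq_imp_space_eq[OF sX] sets_eq_imp_space_eq[OF sV] sets_eq_imp_space_eq[OF sW] by simp_all

lemma prob_spaces: "prob_space pN" "prob_space PX" "prob_space PV" "prob_space PW"
  by (auto intro!: prob_space_PiM X V W measure_pmf.prob_space_axioms)

lemma prob_space_pairs: "prob_space (PV \<Otimes>\<^sub>M PW)" "prob_space (PX \<Otimes>\<^sub>M (PV \<Otimes>\<^sub>M PW))" "prob_space \<Omega>"
proof -
  show 1: "prob_space (PV \<Otimes>\<^sub>M PW)"
    by (intro prob_space_pair prob_spaces)
  show 2: "prob_space (PX \<Otimes>\<^sub>M (PV \<Otimes>\<^sub>M PW))"
    by (intro prob_space_pair prob_spaces 1)
  show "prob_space \<Omega>"
    unfolding \<Omega>_def by (intro prob_space_pair prob_spaces 2)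
qed

lemma space_PiMs [simp]: "space PX = UNIV" "space PV = UNIV" "space PW = UNIV"
  by (simp_all add: space_PiM)

lemma space_\<Omega> [simp]: "space \<Omega> = UNIV"
  by (simp add: \<Omega>_def space_pair_measure)

lemma rv_measurable [measurable]:
  "rN \<in> \<Omega> \<rightarrow>\<^sub>M count_space UNIV" "rX n \<in> borel_measurable \<Omega>" "rV n \<in> borel_measurable \<Omega>" "rW n \<in> borel_measurable \<Omega>"
proof -
  have "fst \<in> \<Omega> \<rightarrow>\<^sub>M pN" unfolding \<Omega>_def by (rule measurable_fst)
  then show "rN \<in> \<Omega> \<rightarrow>\<^sub>M count_space UNIV"
    unfolding rN_def[abs_def] by (simp cong: measurable_cong_sets)
  show "rX n \<in> borel_measurable \<Omega>" "rV n \<in> borel_measurable \<Omega>" "rW n \<in> borel_measurable \<Omega>"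
    unfolding rX_def[abs_def] rV_def[abs_def] rW_def[abs_def] \<Omega>_def by measurable
qed

text \<open>A rectangle restricting finitely many coordinates of every kind. Suitable index sets and
  \<open>UNIV\<close> specialise its probability both to the single laws and to the product formula
  of independence.\<close>

definition event :: "nat set \<Rightarrow> nat set \<Rightarrow> (nat \<Rightarrow> 'a set) \<Rightarrow> nat set \<Rightarrow> (nat \<Rightarrow> 'a set) \<Rightarrow> nat set \<Rightarrow> (nat \<Rightarrow> real set) \<Rightarrow>
    (nat \<times> (nat \<Rightarrow> 'a) \<times> (nat \<Rightarrow> 'a) \<times> (nat \<Rightarrow> real)) set" where
  "event B JX BX JV BV JW BW = {\<omega>. rN \<omega> \<in> B \<and> (\<forall>n\<in>JX. rX n \<omega> \<in> BX n) \<and> (\<forall>n\<in>JV. rV n \<omega> \<in> BV n) \<and> (\<forall>n\<in>JW. rW n \<omega> \<in> BW n)}"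

lemma measure_event:
  assumes fin: "finite JX" "finite JV" "finite JW"
    and [measurable]: "\<And>n. n \<in> JX \<Longrightarrow> BX n \<in> sets borel" "\<And>n. n \<in> JV \<Longrightarrow> BV n \<in> sets borel" "\<And>n. n \<in> JW \<Longrightarrow> BW n \<in> sets borel"
  shows "measure \<Omega> (event B JX BX JV BV JW BW) = measure pN B * (\<Prod>n\<in>JX. measure (\<mu>X n) (BX n)) *
    (\<Prod>n\<in>JV. measure \<mu>V (BV n)) * (\<Prod>n\<in>JW. measure \<mu>W (BW n))"
proof -
  interpret N: prob_space pN by (rule prob_spaces)
  interpret X: prob_space "\<mu>X n" for n by (rule X)
  interpret V: prob_space \<mu>V by (rule V)
  interpret W: prob_space \<mu>W by (rule W)
  interpret PPX: product_prob_space \<mu>X UNIV ..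
  interpret PPV: product_prob_space "\<lambda>_::nat. \<mu>V" UNIV ..
  interpret PPW: product_prob_space "\<lambda>_::nat. \<mu>W" UNIV ..
  interpret sPW: prob_space PW by (rule prob_spaces)
  interpret sVW: prob_space "PV \<Otimes>\<^sub>M PW" by (rule prob_space_pairs)
  interpret sXVW: prob_space "PX \<Otimes>\<^sub>M (PV \<Otimes>\<^sub>M PW)" by (rule prob_space_pairs)
  let ?EX = "{x \<in> space PX. \<forall>n\<in>JX. x n \<in> BX n}"
  let ?EV = "{x \<in> space PV. \<forall>n\<in>JV. x n \<in> BV n}"
  let ?EW = "{x \<in> space PW. \<forall>n\<in>JW. x n \<in> BW n}"
  have [measurable]: "?EX \<in> sets PX" "?EV \<in> sets PV" "?EW \<in> sets PW"
    by (rule sets.sets_Collect_finite_All[OF sets_Collect_single']; use fin assms(4-6) in simp)+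
  have "event B JX BX JV BV JW BW = B \<times> (?EX \<times> (?EV \<times> ?EW))"
    by (auto simp: event_def rN_def rX_def rV_def rW_def)
  then have "emeasure \<Omega> (event B JX BX JV BV JW BW) = emeasure pN B * (emeasure PX ?EX * (emeasure PV ?EV * emeasure PW ?EW))"
    unfolding \<Omega>_def by (simp add: prob_space_pairs prob_spaces prob_space_imp_sigma_finite
        sigma_finite_measure.emeasure_pair_measure_Times del: space_PiMs)
  also have "\<dots> = ennreal (measure pN B * (\<Prod>n\<in>JX. measure (\<mu>X n) (BX n)) *
    (\<Prod>n\<in>JV. measure \<mu>V (BV n)) * (\<Prod>n\<in>JW. measure \<mu>W (BW n)))"
    using fin assms
    by (simp add: PPX.emeasure_PiM_Collect PPV.emeasure_PiM_Collect PPW.emeasure_PiM_Collect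
        X.emeasure_eq_measure V.emeasure_eq_measure W.emeasure_eq_measure measure_pmf.emeasure_eq_measure prod_ennreal prod_nonneg
        ennreal_mult[symmetric] mult.assoc del: space_PiMs)
  finally show ?thesis
    by (intro measure_eq_emeasure_eq_ennreal) (auto intro!: mult_nonneg_nonneg prod_nonneg)
qed

lemma distr_rX: "distr \<Omega> borel (rX n) = \<mu>X n"
proof (rule measure_eqI)
  fix A assume "A \<in> sets (distr \<Omega> borel (rX n))"
  then have A: "A \<in> sets borel" by simp
  interpret X: prob_space "\<mu>X n" by (rule X)
  interpret O: prob_space \<Omega> by (rule prob_space_pairs)
  have "rX n -` A \<inter> space \<Omega> = event UNIV {n} (\<lambda>_. A) {} (\<lambda>_. UNIV) {} (\<lambda>_. UNIV)"
    by (auto simp: event_def)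
  then have "measure \<Omega> (rX n -` A \<inter> space \<Omega>) = measure (\<mu>X n) A"
    using A by (simp add: measure_event measure_pmf.prob_space[simplified])
  then show "emeasure (distr \<Omega> borel (rX n)) A = emeasure (\<mu>X n) A"
    using A by (simp add: emeasure_distr X.emeasure_eq_measure O.emeasure_eq_measure)
qed simp

lemma distr_rV: "distr \<Omega> borel (rV n) = \<mu>V"
proof (rule measure_eqI)
  fix A assume "A \<in> sets (distr \<Omega> borel (rV n))"
  then have A: "A \<in> sets borel" by simp
  interpret V: prob_space \<mu>V by (rule V)
  interpret O: prob_space \<Omega> by (rule prob_space_pairs)
  have "rV n -` A \<inter> space \<Omega> = event UNIV {} (\<lambda>_. UNIV) {n} (\<lambda>_. A) {} (\<lambda>_. UNIV)"
    by (auto simp: event_def)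
  then have "measure \<Omega> (rV n -` A \<inter> space \<Omega>) = measure \<mu>V A"
    using A by (simp add: measure_event measure_pmf.prob_space[simplified])
  then show "emeasure (distr \<Omega> borel (rV n)) A = emeasure \<mu>V A"
    using A by (simp add: emeasure_distr V.emeasure_eq_measure O.emeasure_eq_measure)
qed simp

lemma distr_rW: "distr \<Omega> borel (rW n) = \<mu>W"
proof (rule measure_eqI)
  fix A assume "A \<in> sets (distr \<Omega> borel (rW n))"
  then have A: "A \<in> sets borel" by simp
  interpret W: prob_space \<mu>W by (rule W)
  interpret O: prob_space \<Omega> by (rule prob_space_pairs)
  have "rW n -` A \<inter> space \<Omega> = event UNIV {} (\<lambda>_. UNIV) {} (\<lambda>_. UNIV) {n} (\<lambda>_. A)"
    by (auto simp: event_def)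
  then have "measure \<Omega> (rW n -` A \<inter> space \<Omega>) = measure \<mu>W A"
    using A by (simp add: measure_event measure_pmf.prob_space[simplified])
  then show "emeasure (distr \<Omega> borel (rW n)) A = emeasure \<mu>W A"
    using A by (simp add: emeasure_distr W.emeasure_eq_measure O.emeasure_eq_measure)
qed simp

lemma distr_rN: "distr \<Omega> (count_space UNIV) rN = pN"
proof (rule measure_eqI)
  fix A assume "A \<in> sets (distr \<Omega> (count_space UNIV) rN)"
  interpret O: prob_space \<Omega> by (rule prob_space_pairs)
  have "rN -` A \<inter> space \<Omega> = event A {} (\<lambda>_. UNIV) {} (\<lambda>_. UNIV) {} (\<lambda>_. UNIV)"
    by (auto simp: event_def)
  then have "measure \<Omega> (rN -` A \<inter> space \<Omega>) = measure pN A"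
    by (simp add: measure_event)
  then show "emeasure (distr \<Omega> (count_space UNIV) rN) A = emeasure pN A"
    by (simp add: emeasure_distr measure_pmf.emeasure_eq_measure O.emeasure_eq_measure)
qed simp

text \<open>A finite set of indices is split by constructor, and the chosen preimages turn the
  intersection into one rectangle. Independence is proved for the index set \<open>UNIV\<close> and
  then restricted.\<close>

lemma indep_family_rv: "indep_family \<Omega> \<gamma> rN rX rV rW"
proof -
  interpret O: prob_space \<Omega> by (rule prob_space_pairs)
  let ?F = "\<lambda>i. case i of
              Idx_N \<Rightarrow> sets (vimage_algebra (space \<Omega>) rN (count_space UNIV))
            | Idx_X n \<Rightarrow> sets (vimage_algebra (space \<Omega>) (rX n) borel)
            | Idx_V n \<Rightarrow> sets (vimage_algebra (space \<Omega>) (rV n) borel)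
            | Idx_W n \<Rightarrow> sets (vimage_algebra (space \<Omega>) (rW n) borel)"
  have sub: "?F i \<subseteq> sets \<Omega>" for i
    by (cases i) (auto intro!: sets_image_in_sets del: subsetI)
  have "O.indep_sets ?F UNIV"
  proof (rule O.indep_setsI)
    fix A and J :: "rv_index set"
    assume J: "J \<noteq> {}" "finite J" and A: "\<forall>j\<in>J. A j \<in> ?F j"
    define JX where "JX = {n. Idx_X n \<in> J}"
    define JV where "JV = {n. Idx_V n \<in> J}"
    define JW where "JW = {n. Idx_W n \<in> J}"
    have fin: "finite JX" "finite JV" "finite JW"
      unfolding JX_def JV_def JW_def
      using finite_vimageI[OF J(2), of Idx_X] finite_vimageI[OF J(2), of Idx_V] finite_vimageI[OF J(2), of Idx_W]
      by (auto simp: inj_on_def vimage_def)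
    have "\<exists>B. Idx_N \<in> J \<longrightarrow> A Idx_N = rN -` B"
    proof (cases "Idx_N \<in> J")
      case True
      with A have "A Idx_N \<in> ?F Idx_N" by blast
      then show ?thesis by (auto simp: sets_vimage_algebra2)
    qed simp
    then obtain B0 where B0: "Idx_N \<in> J \<Longrightarrow> A Idx_N = rN -` B0" by blast
    \<comment> \<open>If \<open>N\<close> is not among the chosen variables, \<open>UNIV\<close>
      contributes the factor 1.\<close>
    define B where "B = (if Idx_N \<in> J then B0 else UNIV)"
    have "\<exists>BX. \<forall>n\<in>JX. BX n \<in> sets borel \<and> A (Idx_X n) = rX n -` BX n"
    proof (rule bchoice, rule ballI)
      fix n assume "n \<in> JX"
      then have "A (Idx_X n) \<in> ?F (Idx_X n)" using A unfolding JX_def by blast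
      then show "\<exists>y. y \<in> sets borel \<and> A (Idx_X n) = rX n -` y" by (auto simp: sets_vimage_algebra2)
    qed
    then obtain BX where BX: "\<And>n. n \<in> JX \<Longrightarrow> BX n \<in> sets borel" "\<And>n. n \<in> JX \<Longrightarrow> A (Idx_X n) = rX n -` BX n" by blast
    have "\<exists>BV. \<forall>n\<in>JV. BV n \<in> sets borel \<and> A (Idx_V n) = rV n -` BV n"
    proof (rule bchoice, rule ballI)
      fix n assume "n \<in> JV"
      then have "A (Idx_V n) \<in> ?F (Idx_V n)" using A unfolding JV_def by blast
      then show "\<exists>y. y \<in> sets borel \<and> A (Idx_V n) = rV n -` y" by (auto simp: sets_vimage_algebra2)
    qed
    then obtain BV where BV: "\<And>n. n \<in> JV \<Longrightarrow> BV n \<in> sets borel" "\<And>n. n \<in> JV \<Longrightarrow> A (Idx_V n) = rV n -` BV n" by blast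
    have "\<exists>BW. \<forall>n\<in>JW. BW n \<in> sets borel \<and> A (Idx_W n) = rW n -` BW n"
    proof (rule bchoice, rule ballI)
      fix n assume "n \<in> JW"
      then have "A (Idx_W n) \<in> ?F (Idx_W n)" using A unfolding JW_def by blast
      then show "\<exists>y. y \<in> sets borel \<and> A (Idx_W n) = rW n -` y" by (auto simp: sets_vimage_algebra2)
    qed
    then obtain BW where BW: "\<And>n. n \<in> JW \<Longrightarrow> BW n \<in> sets borel" "\<And>n. n \<in> JW \<Longrightarrow> A (Idx_W n) = rW n -` BW n" by blast
    have Jeq: "J = (J \<inter> {Idx_N}) \<union> (Idx_X ` JX \<union> (Idx_V ` JV \<union> Idx_W ` JW))"
    proof (intro equalityI subsetI)
      fix j assume "j \<in> J"
      then show "j \<in> (J \<inter> {Idx_N}) \<union> (Idx_X ` JX \<union> (Idx_V ` JV \<union> Idx_W ` JW))"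
        by (cases j) (auto simp: JX_def JV_def JW_def)
    qed (auto simp: JX_def JV_def JW_def)
    have "(\<Inter>j\<in>J. A j) = event B JX BX JV BV JW BW"
    proof (intro set_eqI iffI)
      fix \<omega> assume "\<omega> \<in> (\<Inter>j\<in>J. A j)"
      then have w: "\<And>j. j \<in> J \<Longrightarrow> \<omega> \<in> A j" by blast
      show "\<omega> \<in> event B JX BX JV BV JW BW"
        using w[of Idx_N] w[of "Idx_X n" for n] w[of "Idx_V n" for n] w[of "Idx_W n" for n] B0 BX(2) BV(2) BW(2)
        by (auto simp: event_def B_def JX_def JV_def JW_def)
    next
      fix \<omega> assume w: "\<omega> \<in> event B JX BX JV BV JW BW"
      show "\<omega> \<in> (\<Inter>j\<in>J. A j)"
      proof
        fix j assume j: "j \<in> J"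
        show "\<omega> \<in> A j"
        proof (cases j)
          case Idx_N
          then show ?thesis using w j B0 by (simp add: event_def B_def)
        next
          case (Idx_X n)
          then have "n \<in> JX" using j by (simp add: JX_def)
          then show ?thesis using w BX(2) Idx_X by (simp add: event_def)
        next
          case (Idx_V n)
          then have "n \<in> JV" using j by (simp add: JV_def)
          then show ?thesis using w BV(2) Idx_V by (simp add: event_def)
        next
          case (Idx_W n)
          then have "n \<in> JW" using j by (simp add: JW_def)
          then show ?thesis using w BW(2) Idx_W by (simp add: event_def)
        qed
      qed
    qed
    then have "measure \<Omega> (\<Inter>j\<in>J. A j) = measure pN B * (\<Prod>n\<in>JX. measure (\<mu>X n) (BX n)) *
      (\<Prod>n\<in>JV. measure \<mu>V (BV n)) * (\<Prod>n\<in>JW. measure \<mu>W (BW n))"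
      using fin BX(1) BV(1) BW(1) by (simp add: measure_event)
    also have "measure pN B = (\<Prod>j\<in>J \<inter> {Idx_N}. measure \<Omega> (A j))"
    proof (cases "Idx_N \<in> J")
      case True
      have "A Idx_N = event B0 {} (\<lambda>_. UNIV) {} (\<lambda>_. UNIV) {} (\<lambda>_. UNIV)"
        using B0[OF True] by (auto simp: event_def)
      then show ?thesis using True by (simp add: B_def measure_event)
    next
      case False
      then show ?thesis by (simp add: B_def measure_pmf.prob_space[simplified])
    qed
    also have "(\<Prod>n\<in>JX. measure (\<mu>X n) (BX n)) = (\<Prod>j\<in>Idx_X ` JX. measure \<Omega> (A j))"
    proof (subst prod.reindex, simp add: inj_on_def, rule prod.cong[OF refl])
      fix n assume n: "n \<in> JX"
      have "A (Idx_X n) = event UNIV {n} BX {} (\<lambda>_. UNIV) {} (\<lambda>_. UNIV)"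
        using BX(2)[OF n] by (auto simp: event_def)
      then show "measure (\<mu>X n) (BX n) = ((\<lambda>j. measure \<Omega> (A j)) \<circ> Idx_X) n"
        using BX(1)[OF n] unfolding comp_def
        by (simp only:) (subst measure_event, auto simp: measure_pmf.prob_space[simplified])
    qed
    also have "(\<Prod>n\<in>JV. measure \<mu>V (BV n)) = (\<Prod>j\<in>Idx_V ` JV. measure \<Omega> (A j))"
    proof (subst prod.reindex, simp add: inj_on_def, rule prod.cong[OF refl])
      fix n assume n: "n \<in> JV"
      have "A (Idx_V n) = event UNIV {} (\<lambda>_. UNIV) {n} BV {} (\<lambda>_. UNIV)"
        using BV(2)[OF n] by (auto simp: event_def)
      then show "measure \<mu>V (BV n) = ((\<lambda>j. measure \<Omega> (A j)) \<circ> Idx_V) n"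
        using BV(1)[OF n] unfolding comp_def
        by (simp only:) (subst measure_event, auto simp: measure_pmf.prob_space[simplified])
    qed
    also have "(\<Prod>n\<in>JW. measure \<mu>W (BW n)) = (\<Prod>j\<in>Idx_W ` JW. measure \<Omega> (A j))"
    proof (subst prod.reindex, simp add: inj_on_def, rule prod.cong[OF refl])
      fix n assume n: "n \<in> JW"
      have "A (Idx_W n) = event UNIV {} (\<lambda>_. UNIV) {} (\<lambda>_. UNIV) {n} BW"
        using BW(2)[OF n] by (auto simp: event_def)
      then show "measure \<mu>W (BW n) = ((\<lambda>j. measure \<Omega> (A j)) \<circ> Idx_W) n"
        using BW(1)[OF n] unfolding comp_def
        by (simp only:) (subst measure_event, auto simp: measure_pmf.prob_space[simplified])
    qed
    also have "(\<Prod>j\<in>J \<inter> {Idx_N}. measure \<Omega> (A j)) * (\<Prod>j\<in>Idx_X ` JX. measure \<Omega> (A j)) *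
        (\<Prod>j\<in>Idx_V ` JV. measure \<Omega> (A j)) * (\<Prod>j\<in>Idx_W ` JW. measure \<Omega> (A j)) = (\<Prod>j\<in>J. measure \<Omega> (A j))"
    proof -
      have "(\<Prod>j\<in>(J \<inter> {Idx_N}) \<union> (Idx_X ` JX \<union> (Idx_V ` JV \<union> Idx_W ` JW)). measure \<Omega> (A j)) =
          (\<Prod>j\<in>J \<inter> {Idx_N}. measure \<Omega> (A j)) * ((\<Prod>j\<in>Idx_X ` JX. measure \<Omega> (A j)) *
          ((\<Prod>j\<in>Idx_V ` JV. measure \<Omega> (A j)) * (\<Prod>j\<in>Idx_W ` JW. measure \<Omega> (A j))))"
      proof -
        have d: "(J \<inter> {Idx_N}) \<inter> (Idx_X ` JX \<union> (Idx_V ` JV \<union> Idx_W ` JW)) = {}"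
          "Idx_X ` JX \<inter> (Idx_V ` JV \<union> Idx_W ` JW) = {}" "Idx_V ` JV \<inter> Idx_W ` JW = {}" by auto
        have f: "finite (J \<inter> {Idx_N})" "finite (Idx_X ` JX)" "finite (Idx_V ` JV)" "finite (Idx_W ` JW)"
          "finite (Idx_X ` JX \<union> (Idx_V ` JV \<union> Idx_W ` JW))" "finite (Idx_V ` JV \<union> Idx_W ` JW)"
          using fin by simp_all
        show ?thesis
          by (simp only: prod.union_disjoint[OF f(1,5) d(1)] prod.union_disjoint[OF f(2,6) d(2)] prod.union_disjoint[OF f(3,4) d(3)])
      qed
      then show ?thesis unfolding Jeq[symmetric] by (simp only: mult.assoc)
    qed
    finally show "measure \<Omega> (\<Inter>j\<in>J. A j) = (\<Prod>j\<in>J. measure \<Omega> (A j))" .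
  qed (use sub in auto)
  then show ?thesis
    unfolding indep_family_def by (rule O.indep_sets_mono_index[rotated]) simp
qed

text \<open>The finitely many X_n form the weight \<open>g\<close> of
  \<open>integral_random_sum\<close>. In the random sum W is integrated out for fixed V, so every
  summand contributes the same factor.\<close>

lemma charfun_sum:
  assumes c: "finite I"
  shows "charfun (distr \<Omega> borel (\<lambda>\<omega>. c *\<^sub>R (\<Sum>n\<in>I. rX n \<omega>) + (\<Sum>k=1..rN \<omega>. rW k \<omega> *\<^sub>R rV k \<omega>))) z =
    (\<Prod>n\<in>I. charfun (\<mu>X n) (c *\<^sub>R z)) *
    exp (complex_of_real r * ((CLINT x|\<mu>V. CLINT w|\<mu>W. iexp (w * (x \<bullet> z))) - 1))"
    and rsum_measurable: "(\<lambda>\<omega>. c *\<^sub>R (\<Sum>n\<in>I. rX n \<omega>) + (\<Sum>k=1..rN \<omega>. rW k \<omega> *\<^sub>R rV k \<omega>)) \<in> borel_measurable \<Omega>"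
proof -
  interpret X: prob_space "\<mu>X n" for n by (rule X)
  interpret V: prob_space \<mu>V by (rule V)
  interpret W: prob_space \<mu>W by (rule W)
  interpret PPX: product_prob_space \<mu>X UNIV ..
  interpret PPV: product_prob_space "\<lambda>_::nat. \<mu>V" UNIV ..
  interpret PPW: product_prob_space "\<lambda>_::nat. \<mu>W" UNIV ..
  interpret sPX: prob_space PX by (rule prob_spaces)
  interpret sPV: prob_space PV by (rule prob_spaces)
  interpret sPW: prob_space PW by (rule prob_spaces)
  interpret VW: pair_prob_space PV PW ..
  interpret sVW: prob_space "PV \<Otimes>\<^sub>M PW" by (rule prob_space_pairs)
  interpret XVW: pair_prob_space PX "PV \<Otimes>\<^sub>M PW" ..
  let ?S = "PX \<Otimes>\<^sub>M (PV \<Otimes>\<^sub>M PW)"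
  let ?\<xi> = "\<lambda>k s. snd (snd s) k *\<^sub>R fst (snd s) k :: 'a"
  let ?g = "\<lambda>s. \<Prod>n\<in>I. iexp (fst s n \<bullet> (c *\<^sub>R z))"
  define \<phi> where "\<phi> = (CLINT x|\<mu>V. CLINT w|\<mu>W. iexp (w * (x \<bullet> z)))"
  let ?u = "\<lambda>x. CLINT w|\<mu>W. iexp (w * (x \<bullet> z))"
  have um [measurable]: "?u \<in> borel_measurable borel" by measurable
  have u: "integrable \<mu>V ?u"
    by (rule V.integrable_const_bound[of _ 1])
       (auto intro!: AE_I2 order_trans[OF integral_norm_bound] simp: W.prob_space[simplified] simp del: of_real_mult)
  have VWprod: "(CLINT q|PV \<Otimes>\<^sub>M PW. (\<Prod>k=1..n. iexp (snd q k * (fst q k \<bullet> z)))) = \<phi> ^ n" for n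
  proof -
    have "(CLINT q|PV \<Otimes>\<^sub>M PW. (\<Prod>k=1..n. iexp (snd q k * (fst q k \<bullet> z)))) =
      (CLINT v|PV. CLINT w|PW. (\<Prod>k=1..n. iexp (w k * (v k \<bullet> z))))"
      by (subst VW.integral_fst'[symmetric])
         (auto intro!: VW.integrable_const_bound[of _ 1] simp: prod_norm[symmetric] simp del: of_real_mult)
    also have "\<dots> = (CLINT v|PV. (\<Prod>k=1..n. ?u (v k)))"
    proof (rule Bochner_Integration.integral_cong[OF refl])
      fix v :: "nat \<Rightarrow> 'a"
      show "(CLINT w|PW. (\<Prod>k=1..n. iexp (w k * (v k \<bullet> z)))) = (\<Prod>k=1..n. ?u (v k))"
        by (rule PPW.integral_PiM_prod) (auto intro!: W.integrable_iexp_real simp del: of_real_mult)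
    qed
    also have "\<dots> = (\<Prod>k=1..n. CLINT x|\<mu>V. ?u x)"
      by (rule PPV.integral_PiM_prod) (use u in auto)
    finally show ?thesis by (simp add: \<phi>_def)
  qed
  have gX: "(CLINT x|PX. (\<Prod>n\<in>I. iexp (x n \<bullet> (c *\<^sub>R z)))) = (\<Prod>n\<in>I. charfun (\<mu>X n) (c *\<^sub>R z))"
    unfolding charfun_def by (rule PPX.integral_PiM_prod) (use c in \<open>auto intro!: X.integrable_iexp_real simp del: inner_scaleR_right\<close>)
  have prod: "(CLINT s|?S. ?g s * (\<Prod>k=1..n. iexp (?\<xi> k s \<bullet> z))) = (\<Prod>n\<in>I. charfun (\<mu>X n) (c *\<^sub>R z)) * \<phi> ^ n" for n
  proof -
    have "(CLINT s|?S. ?g s * (\<Prod>k=1..n. iexp (?\<xi> k s \<bullet> z))) =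
      (CLINT x|PX. CLINT q|PV \<Otimes>\<^sub>M PW. (\<Prod>n\<in>I. iexp (x n \<bullet> (c *\<^sub>R z))) * (\<Prod>k=1..n. iexp (snd q k * (fst q k \<bullet> z))))"
      by (subst XVW.integral_fst'[symmetric])
         (auto intro!: XVW.integrable_const_bound[of _ 1] simp: norm_mult prod_norm[symmetric] simp del: of_real_mult)
    also have "\<dots> = (CLINT x|PX. (\<Prod>n\<in>I. iexp (x n \<bullet> (c *\<^sub>R z)))) * \<phi> ^ n"
      by (simp only: integral_mult_right_zero integral_mult_left_zero VWprod)
    finally show ?thesis unfolding gX .
  qed
  have [measurable]: "(\<lambda>\<omega>. \<Sum>k=1..rN \<omega>. rW k \<omega> *\<^sub>R rV k \<omega>) \<in> borel_measurable \<Omega>"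
    by (rule measurable_compose_countable[of "\<lambda>n \<omega>. \<Sum>k=1..n. rW k \<omega> *\<^sub>R rV k \<omega>" _ _ rN]) measurable
  show m: "(\<lambda>\<omega>. c *\<^sub>R (\<Sum>n\<in>I. rX n \<omega>) + (\<Sum>k=1..rN \<omega>. rW k \<omega> *\<^sub>R rV k \<omega>)) \<in> borel_measurable \<Omega>"
    by measurable
  have e: "iexp ((c *\<^sub>R (\<Sum>n\<in>I. rX n \<omega>) + (\<Sum>k=1..rN \<omega>. rW k \<omega> *\<^sub>R rV k \<omega>)) \<bullet> z) =
     ?g (snd \<omega>) * iexp ((\<Sum>k=1..fst \<omega>. ?\<xi> k (snd \<omega>)) \<bullet> z)" for \<omega>
  proof -
    have "iexp ((c *\<^sub>R (\<Sum>n\<in>I. rX n \<omega>)) \<bullet> z) = ?g (snd \<omega>)"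
      using c by (simp add: rX_def inner_sum_left sum_distrib_left exp_sum)
    then show ?thesis
      unfolding inner_add_left of_real_add distrib_left exp_add by (simp add: rN_def rV_def rW_def)
  qed
  have "charfun (distr \<Omega> borel (\<lambda>\<omega>. c *\<^sub>R (\<Sum>n\<in>I. rX n \<omega>) + (\<Sum>k=1..rN \<omega>. rW k \<omega> *\<^sub>R rV k \<omega>))) z =
    (CLINT \<omega>|\<Omega>. ?g (snd \<omega>) * iexp ((\<Sum>k=1..fst \<omega>. ?\<xi> k (snd \<omega>)) \<bullet> z))"
    unfolding charfun_distr[OF m] e ..
  also have "\<dots> = (CLINT \<omega>|pN \<Otimes>\<^sub>M ?S. ?g (snd \<omega>) * iexp ((\<Sum>k=1..fst \<omega>. ?\<xi> k (snd \<omega>)) \<bullet> z))"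
    by (simp only: \<Omega>_def)
  also have "\<dots> = (\<Prod>n\<in>I. charfun (\<mu>X n) (c *\<^sub>R z)) * exp (complex_of_real r * (\<phi> - 1))"
    by (rule integral_random_sum[OF r prob_space_pairs(2) _ _ _ prod])
       (auto simp: prod_norm[symmetric] simp del: inner_scaleR_right)
  finally show "charfun (distr \<Omega> borel (\<lambda>\<omega>. c *\<^sub>R (\<Sum>n\<in>I. rX n \<omega>) + (\<Sum>k=1..rN \<omega>. rW k \<omega> *\<^sub>R rV k \<omega>))) z =
    (\<Prod>n\<in>I. charfun (\<mu>X n) (c *\<^sub>R z)) *
    exp (complex_of_real r * ((CLINT x|\<mu>V. CLINT w|\<mu>W. iexp (w * (x \<bullet> z))) - 1))"
    unfolding \<phi>_def .
qed

end

subsection \<open>Conditional distributions\<close>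

text \<open>The hypothesis says that T is c U plus a variable of law \<open>\<rho>\<close>
  independent of U. Given U = y the law of T is therefore \<open>\<rho>\<close> translated by c
  y.\<close>

lemma cond_distr_affine:
  fixes U T :: "'w \<Rightarrow> 'a::euclidean_space" and \<rho> :: "'a measure"
  assumes "prob_space M" and [measurable]: "U \<in> borel_measurable M" "T \<in> borel_measurable M"
    and "prob_space \<rho>" and s\<rho> [simp, measurable_cong]: "sets \<rho> = sets borel"
    and char: "\<And>u v. (CLINT \<omega>|M. iexp (U \<omega> \<bullet> u + (T \<omega> - c *\<^sub>R U \<omega>) \<bullet> v)) =
      (CLINT \<omega>|M. iexp (U \<omega> \<bullet> u)) * charfun \<rho> v"
  shows "cond_distr M T U (\<lambda>y. distr \<rho> borel (\<lambda>z. c *\<^sub>R y + z))"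
proof -
  interpret prob_space M by fact
  interpret \<rho>: prob_space \<rho> by fact
  have spM: "space \<rho> = UNIV" using sets_eq_imp_space_eq[OF s\<rho>] by simp
  let ?\<mu> = "distr M borel U"
  let ?J = "\<lambda>\<omega>. (U \<omega>, T \<omega> - c *\<^sub>R U \<omega>)"
  interpret \<mu>: prob_space ?\<mu> by (rule prob_space_distr) simp
  interpret P: pair_prob_space ?\<mu> \<rho> ..
  let ?K = "\<lambda>y. distr \<rho> borel (\<lambda>z. c *\<^sub>R y + z)"
  have sP: "sets (?\<mu> \<Otimes>\<^sub>M \<rho>) = sets (borel :: ('a \<times> 'a) measure)"
    unfolding borel_prod[symmetric] by (rule sets_pair_measure_cong) simp_all
  \<comment> \<open>The pairs form a Euclidean space again, so the uniqueness theorem identifies the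
    joint law as a product.\<close>
  have joint: "distr M borel ?J = ?\<mu> \<Otimes>\<^sub>M \<rho>"
  proof (rule charfun_eqI)
    show "finite_measure (distr M borel ?J)"
      by (rule finite_measure_distr) simp
    show "finite_measure (?\<mu> \<Otimes>\<^sub>M \<rho>)" by (rule P.finite_measure_axioms)
    show "sets (?\<mu> \<Otimes>\<^sub>M \<rho>) = sets borel" by (rule sP)
    fix q :: "'a \<times> 'a"
    obtain u v where q: "q = (u, v)" by force
    have "charfun (?\<mu> \<Otimes>\<^sub>M \<rho>) q = (CLINT a|?\<mu> \<Otimes>\<^sub>M \<rho>. iexp (fst a \<bullet> u) * iexp (snd a \<bullet> v))"
      unfolding charfun_def q inner_Pair_0
      by (intro Bochner_Integration.integral_cong) (auto simp: inner_prod_def exp_add[symmetric] distrib_left)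
    also have "\<dots> = (CLINT x|?\<mu>. CLINT y|\<rho>. iexp (x \<bullet> u) * iexp (y \<bullet> v))"
      by (subst P.integral_fst'[symmetric]) (auto intro!: P.integrable_const_bound[of _ 1] simp: norm_mult)
    also have "\<dots> = charfun ?\<mu> u * charfun \<rho> v" by (simp add: charfun_def)
    also have "charfun ?\<mu> u = (CLINT \<omega>|M. iexp (U \<omega> \<bullet> u))" by (rule charfun_distr) simp
    also have "(CLINT \<omega>|M. iexp (U \<omega> \<bullet> u)) * charfun \<rho> v = charfun (distr M borel ?J) q"
      unfolding char[symmetric] by (subst charfun_distr) (auto simp: q inner_prod_def)
    finally show "charfun (distr M borel ?J) q = charfun (?\<mu> \<Otimes>\<^sub>M \<rho>) q" ..
  qed simp
  note [measurable_cong] = sP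
  have K: "?K \<in> borel \<rightarrow>\<^sub>M prob_algebra borel"
  proof (rule measurable_distr_prob_space2[where M=borel])
    show "(\<lambda>y. \<rho>) \<in> borel \<rightarrow>\<^sub>M prob_algebra borel"
      by (rule measurable_const) (simp add: space_prob_algebra \<rho>.prob_space_axioms)
  qed measurable
  let ?F = "vimage_algebra (space M) U borel"
  have sub: "subalgebra M ?F"
    unfolding subalgebra_def by (auto intro!: sets_image_in_sets del: subsetI)
  interpret F: finite_measure_subalgebra M ?F
    by (unfold_locales) (rule sub)
  have UF: "U \<in> ?F \<rightarrow>\<^sub>M borel" by (rule measurable_vimage_algebra1) simp
  have "AE \<omega> in M. real_cond_exp M ?F (\<lambda>\<omega>. indicator B (T \<omega>)) \<omega> = measure (?K (U \<omega>)) B"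
    if B [measurable]: "B \<in> sets borel" for B
  proof (rule F.real_cond_exp_charact)
    have gB [measurable]: "(\<lambda>y. measure (?K y) B) \<in> borel_measurable borel"
    proof -
      have "Sigma (space borel) (\<lambda>_::'a. B) = UNIV \<times> B" by auto
      moreover have "UNIV \<times> B \<in> sets ((borel :: 'a measure) \<Otimes>\<^sub>M borel)" by measurable
      ultimately show ?thesis using measure_measurable_prob_algebra2[of borel "\<lambda>_. B" borel ?K] K by simp
    qed
    show "(\<lambda>\<omega>. measure (?K (U \<omega>)) B) \<in> borel_measurable ?F"
      by (rule measurable_compose[OF UF gB])
    show "integrable M (\<lambda>\<omega>. indicator B (T \<omega>) :: real)"
      by (rule integrable_const_bound[of _ 1]) (auto simp: indicator_def)
    have K1: "prob_space (?K y)" for y by (rule \<rho>.prob_space_distr) simp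
    show "integrable M (\<lambda>\<omega>. measure (?K (U \<omega>)) B)"
      by (rule integrable_const_bound[of _ 1]) (auto simp: prob_space.prob_le_1[OF K1])
    \<comment> \<open>The kernel is tested on the events {U \<in> C}, which make up the
      sigma-algebra of U; the product form of the joint law reduces this to Fubini.\<close>
    fix A assume "A \<in> sets ?F"
    then obtain C where C [measurable]: "C \<in> sets borel" and A: "A = U -` C \<inter> space M"
      by (auto simp: sets_vimage_algebra2)
    let ?f = "\<lambda>q. indicator C (fst q) * indicator B (c *\<^sub>R fst q + snd q) :: real"
    have [measurable]: "?f \<in> borel_measurable borel"
      unfolding borel_prod[symmetric] by measurable
    have "(\<integral>\<omega>\<in>A. indicator B (T \<omega>) \<partial>M) = (\<integral>\<omega>. ?f (?J \<omega>) \<partial>M)"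
      unfolding set_lebesgue_integral_def
      by (intro Bochner_Integration.integral_cong) (auto simp: A indicator_def)
    also have "\<dots> = (\<integral>q. ?f q \<partial>(?\<mu> \<Otimes>\<^sub>M \<rho>))"
      unfolding joint[symmetric] by (subst integral_distr) auto
    also have "\<dots> = (\<integral>x. \<integral>z. ?f (x, z) \<partial>\<rho> \<partial>?\<mu>)"
      by (rule P.integral_fst'[symmetric], rule P.integrable_const_bound[of _ 1], simp add: indicator_def, measurable)
    also have "\<dots> = (\<integral>x. indicator C x * measure (?K x) B \<partial>?\<mu>)"
    proof (rule Bochner_Integration.integral_cong[OF refl])
      fix x
      have "measure (?K x) B = measure \<rho> {z. c *\<^sub>R x + z \<in> B}"
        by (subst measure_distr) (auto simp: spM vimage_def)
      also have "\<dots> = (\<integral>z. indicator {z. c *\<^sub>R x + z \<in> B} z \<partial>\<rho>)"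
        by (simp add: spM)
      also have "\<dots> = (\<integral>z. indicator B (c *\<^sub>R x + z) \<partial>\<rho>)"
        by (intro Bochner_Integration.integral_cong) (auto simp: indicator_def)
      finally show "(\<integral>z. ?f (x, z) \<partial>\<rho>) = indicator C x * measure (?K x) B" by simp
    qed
    also have "\<dots> = (\<integral>\<omega>. indicator C (U \<omega>) * measure (?K (U \<omega>)) B \<partial>M)"
      by (rule integral_distr) measurable
    also have "\<dots> = (\<integral>\<omega>\<in>A. measure (?K (U \<omega>)) B \<partial>M)"
      unfolding set_lebesgue_integral_def
      by (intro Bochner_Integration.integral_cong) (auto simp: A indicator_def)
    finally show "(\<integral>\<omega>\<in>A. indicator B (T \<omega>) \<partial>M) = (\<integral>\<omega>\<in>A. measure (?K (U \<omega>)) B \<partial>M)" .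
  qed
  with K show ?thesis by (auto simp: cond_distr_def)
qed

subsection \<open>The exponent of the transition law\<close>

text \<open>For n = 0 the closed forms in \<open>kappa\<close> are the values of one integral of
  u^(- 1 - \<alpha>), so the limiting value at \<open>\<alpha> = 0\<close> is obtained without a
  limit.\<close>

lemma (in incomplete_integrals) kappa_eq_H:
  assumes \<eta>_eq: "\<eta> = exp (l * t)"
  shows "kappa p \<alpha> l t n = H n \<eta>"
proof (cases n)
  case 0
  show ?thesis
  proof (cases "\<alpha> = 0")
    case True
    have "(h 0 has_integral ln 1 - ln (1 / \<eta>)) {1 / \<eta>..1}"
    proof (rule fundamental_theorem_of_calculus)
      fix u assume "u \<in> {1 / \<eta>..1}"
      then have "u > 0" by (rule inverse_interval_pos[rotated]) (use \<eta> in simp)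
      then have "(ln has_real_derivative inverse u) (at u within {1 / \<eta>..1})"
        by (auto intro!: derivative_eq_intros simp: divide_inverse)
      moreover have "h 0 u = inverse u"
        unfolding h_def using \<open>u > 0\<close> True by (simp add: powr_minus)
      ultimately show "(ln has_vector_derivative h 0 u) (at u within {1 / \<eta>..1})"
        by (simp add: has_real_derivative_iff_has_vector_derivative)
    qed (use \<eta> in simp)
    then have "H 0 \<eta> = ln \<eta>" using \<eta> unfolding H_def by (simp add: integral_unique ln_div)
    then show ?thesis using 0 True by (simp add: kappa_def \<eta>_eq)
  next
    case False
    have "H 0 \<eta> = (\<eta> powr \<alpha> - 1) / \<alpha>" using H_0[of \<eta>] \<eta> False by (simp add: field_simps)
    moreover have "\<eta> powr \<alpha> = exp (\<alpha> * l * t)" by (simp add: \<eta>_eq powr_def mult_ac)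
    ultimately show ?thesis using 0 False by (simp add: kappa_def)
  qed
next
  case (Suc m)
  have "exp (- l * t) = 1 / \<eta>" by (simp add: \<eta>_eq exp_minus divide_inverse)
  then show ?thesis
    using Suc H_eq_LBINT[of \<eta> n] \<eta> unfolding kappa_def h_def by simp
qed

text \<open>By monotonicity it is enough to treat order 1, where the weight S ln S dominates S for S
  > 2. This makes the means in the b*_n genuine integrals.\<close>

lemma rosinski_first_moment:
  fixes R :: "'a::euclidean_space measure"
  assumes R: "rosinski_measure \<alpha> R" and \<alpha>: "1 \<le> \<alpha>" "\<alpha> < 2"
  shows "integrable R (\<lambda>x. x)"
proof -
  note [measurable_cong] = rosinski_measureD(1)[OF R]
  interpret finite_measure R by (rule rosinski_measureD(2)[OF R])
  have "rosinski_measure 1 R" by (rule rosinski_measure_mono[OF R \<alpha>])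
  then have "set_integrable R {x. norm x > 2} (\<lambda>x. norm x * ln (norm x))"
    by (simp add: rosinski_measure_def)
  then have "integrable R (\<lambda>x. 2 + 1 / ln 2 * (indicator {x. norm x > 2} x *\<^sub>R (norm x * ln (norm x))))"
    unfolding set_integrable_def by (intro Bochner_Integration.integrable_add integrable_mult_right) auto
  then show ?thesis
  proof (rule Bochner_Integration.integrable_bound)
    show "AE x in R. norm x \<le> norm (2 + 1 / ln 2 * (indicator {x. norm x > 2} x *\<^sub>R (norm x * ln (norm x))))"
    proof (rule AE_I2)
      fix x :: 'a
      show "norm x \<le> norm (2 + 1 / ln 2 * (indicator {x. norm x > 2} x *\<^sub>R (norm x * ln (norm x))))"
      proof (cases "norm x > 2")
        case True
        then have "ln 2 \<le> ln (norm x)" by (subst ln_le_cancel_iff) auto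
        then have "1 \<le> ln (norm x) / ln 2" by (simp add: pos_le_divide_eq)
        then have "norm x * 1 \<le> norm x * (ln (norm x) / ln 2)" by (intro mult_left_mono) auto
        then have "norm x \<le> 2 + 1 / ln 2 * (norm x * ln (norm x))" by simp
        then show ?thesis using True by simp
      qed simp
    qed
  qed simp
qed

text \<open>The variable is \<theta> = exp (l (t - r)), because the exponent of the transition law
  arrives with time running backwards.\<close>

lemma integral_exp_substitution:
  fixes f :: "real \<Rightarrow> complex"
  assumes l: "l > 0" and t: "t > 0" and f: "continuous_on UNIV f"
  shows "integral {0..t} (\<lambda>r. f (exp (- l * (t - r)))) =
    integral {1..exp (l * t)} (\<lambda>\<theta>. (1 / (l * \<theta>)) *\<^sub>R f (1 / \<theta>))"
proof -
  let ?\<eta> = "exp (l * t)"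
  let ?g = "\<lambda>r. exp (l * (t - r))"
  let ?k = "\<lambda>\<theta>. (1 / (l * \<theta>)) *\<^sub>R f (1 / \<theta>)"
  have \<eta>: "1 < ?\<eta>" using l t by simp
  have k: "continuous_on {1..?\<eta>} ?k"
    using l by (intro continuous_intros continuous_on_compose2[OF f]) auto
  \<comment> \<open>The substitution is decreasing, so the rule returns an oriented difference of
    integrals; the first one is over an empty interval.\<close>
  have "((\<lambda>r. (- l * ?g r) *\<^sub>R ?k (?g r)) has_integral (integral {?g 0..?g t} ?k - integral {?g t..?g 0} ?k)) {0..t}"
  proof (rule has_integral_substitution_general[where s="{}"])
    show "?g ` {0..t} \<subseteq> {1..?\<eta>}" using l t by auto
    show "continuous_on {0..t} ?g" by (intro continuous_intros)
    show "(?g has_real_derivative - l * ?g r) (at r within {0..t})" for r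
      by (auto intro!: derivative_eq_intros)
  qed (use k t in auto)
  moreover have "(- l * ?g r) *\<^sub>R ?k (?g r) = - f (exp (- l * (t - r)))" for r
    using l by (simp add: exp_minus inverse_eq_divide)
  moreover have "integral {?g 0..?g t} ?k = 0" using \<eta> by simp
  ultimately have "((\<lambda>r. - f (exp (- l * (t - r)))) has_integral - integral {1..?\<eta>} ?k) {0..t}" by simp
  from has_integral_neg[OF this] show ?thesis by (simp add: integral_unique)
qed

text \<open>The factor l in the Rosinski measure and in the drift of the driving process cancels
  against the 1 / (l \<theta>) of the substitution. The drift then collects the integral of
  \<theta>^(- 2), which is 1 - e^(- l t).\<close>

lemma transition_exponent:
  fixes R :: "'a::euclidean_space measure"
  assumes R: "rosinski_measure \<alpha> R" and p: "p > 0" and \<alpha>: "\<alpha> < 2" and l: "l > 0" and t: "t > 0"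
  shows "integral {0..t} (\<lambda>r. TS_exponent p \<alpha> (scale_measure (ennreal l) R) (l *\<^sub>R b) (exp (- l * (t - r)) *\<^sub>R v)) =
    \<i> * complex_of_real ((1 - exp (- l * t)) * (b \<bullet> v)) +
    (CLINT x|R. CLBINT \<theta>:{1..exp (l * t)}. (1 / \<theta>) *\<^sub>R ts_integral p \<alpha> ((x \<bullet> v) / \<theta>))"
proof -
  note [measurable_cong] = rosinski_measureD(1)[OF R]
  interpret R: finite_measure R by (rule rosinski_measureD(2)[OF R])
  interpret P: pair_sigma_finite R "lborel :: real measure" ..
  let ?\<eta> = "exp (l * t)"
  have \<eta>: "1 < ?\<eta>" using l t by simp
  define \<Psi> where "\<Psi> z = (CLINT x|R. ts_integral p \<alpha> (x \<bullet> z))" for z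
  have \<Psi>c: "continuous_on UNIV \<Psi>"
    using continuous_TS_exponent[OF R p \<alpha>, of 0] by (simp add: TS_exponent_eq[abs_def] \<Psi>_def[abs_def])
  have ex: "TS_exponent p \<alpha> (scale_measure (ennreal l) R) (l *\<^sub>R b) z = l *\<^sub>R (\<i> * complex_of_real (b \<bullet> z) + \<Psi> z)" for z
    using l by (simp add: TS_exponent_eq integral_scale_measure \<Psi>_def scaleR_conv_of_real distrib_left mult.left_commute)
  let ?f = "\<lambda>w. l *\<^sub>R (\<i> * complex_of_real (b \<bullet> (w *\<^sub>R v)) + \<Psi> (w *\<^sub>R v))"
  have fc: "continuous_on UNIV ?f"
    by (intro continuous_intros continuous_on_compose2[OF \<Psi>c]) auto
  have "integral {0..t} (\<lambda>r. TS_exponent p \<alpha> (scale_measure (ennreal l) R) (l *\<^sub>R b) (exp (- l * (t - r)) *\<^sub>R v)) =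
      integral {1..?\<eta>} (\<lambda>\<theta>. (1 / (l * \<theta>)) *\<^sub>R ?f (1 / \<theta>))"
    unfolding ex by (rule integral_exp_substitution[OF l t fc])
  also have "\<dots> = integral {1..?\<eta>} (\<lambda>\<theta>. (\<i> * complex_of_real (b \<bullet> v)) * complex_of_real (1 / \<theta>\<^sup>2) + (1 / \<theta>) *\<^sub>R \<Psi> ((1 / \<theta>) *\<^sub>R v))"
  proof (rule integral_cong)
    fix \<theta> :: real
    have "(1 / (l * \<theta>)) *\<^sub>R (l *\<^sub>R z) = (1 / \<theta>) *\<^sub>R z" for z :: complex using l by simp
    then have "(1 / (l * \<theta>)) *\<^sub>R ?f (1 / \<theta>) =
        (1 / \<theta>) *\<^sub>R (\<i> * complex_of_real (b \<bullet> ((1 / \<theta>) *\<^sub>R v)) + \<Psi> ((1 / \<theta>) *\<^sub>R v))" .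
    also have "\<dots> = (\<i> * complex_of_real (b \<bullet> v)) * complex_of_real (1 / \<theta>\<^sup>2) + (1 / \<theta>) *\<^sub>R \<Psi> ((1 / \<theta>) *\<^sub>R v)"
      by (simp add: scaleR_add_right scaleR_conv_of_real power2_eq_square divide_inverse distrib_left)
    finally show "(1 / (l * \<theta>)) *\<^sub>R ?f (1 / \<theta>) =
        (\<i> * complex_of_real (b \<bullet> v)) * complex_of_real (1 / \<theta>\<^sup>2) + (1 / \<theta>) *\<^sub>R \<Psi> ((1 / \<theta>) *\<^sub>R v)" .
  qed
  also have "\<dots> = integral {1..?\<eta>} (\<lambda>\<theta>. (\<i> * complex_of_real (b \<bullet> v)) * complex_of_real (1 / \<theta>\<^sup>2)) +
      integral {1..?\<eta>} (\<lambda>\<theta>. (1 / \<theta>) *\<^sub>R \<Psi> ((1 / \<theta>) *\<^sub>R v))"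
    by (intro integral_add integrable_continuous_interval continuous_intros continuous_on_compose2[OF \<Psi>c]) auto
  also have "integral {1..?\<eta>} (\<lambda>\<theta>. (\<i> * complex_of_real (b \<bullet> v)) * complex_of_real (1 / \<theta>\<^sup>2)) =
      \<i> * complex_of_real ((1 - exp (- l * t)) * (b \<bullet> v))"
  proof -
    have "((\<lambda>\<theta>. 1 / \<theta>\<^sup>2) has_integral - (1 / ?\<eta>) - - (1 / 1)) {1..?\<eta>}"
    proof (rule fundamental_theorem_of_calculus)
      fix \<theta> :: real assume "\<theta> \<in> {1..?\<eta>}"
      then show "((\<lambda>\<theta>. - (1 / \<theta>)) has_vector_derivative 1 / \<theta>\<^sup>2) (at \<theta> within {1..?\<eta>})"
        by (auto intro!: derivative_eq_intros simp: power2_eq_square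
            simp flip: has_real_derivative_iff_has_vector_derivative)
    qed (use \<eta> in simp)
    then have "((\<lambda>\<theta>. 1 / \<theta>\<^sup>2) has_integral (1 - exp (- l * t))) {1..?\<eta>}"
      by (simp add: exp_minus inverse_eq_divide)
    from has_integral_mult_right[OF has_integral_of_real[OF this], of "\<i> * complex_of_real (b \<bullet> v)"]
    have "((\<lambda>\<theta>. (\<i> * complex_of_real (b \<bullet> v)) * complex_of_real (1 / \<theta>\<^sup>2)) has_integral
        (\<i> * complex_of_real (b \<bullet> v)) * complex_of_real (1 - exp (- l * t))) {1..?\<eta>}" .
    from integral_unique[OF this] show ?thesis by (simp only: of_real_mult mult_ac)
  qed
  also have "integral {1..?\<eta>} (\<lambda>\<theta>. (1 / \<theta>) *\<^sub>R \<Psi> ((1 / \<theta>) *\<^sub>R v)) =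
      (CLBINT \<theta>:{1..?\<eta>}. (1 / \<theta>) *\<^sub>R \<Psi> ((1 / \<theta>) *\<^sub>R v))"
    by (intro LBINT_eq_integral_continuous[symmetric] continuous_intros continuous_on_compose2[OF \<Psi>c]) auto
  also have "\<dots> = (\<integral>\<theta>. (CLINT x|R. indicator {1..?\<eta>} \<theta> *\<^sub>R ((1 / \<theta>) *\<^sub>R ts_integral p \<alpha> ((x \<bullet> v) / \<theta>))) \<partial>lborel)"
    unfolding set_lebesgue_integral_def \<Psi>_def by (simp add: mult.commute)
  also have "\<dots> = (CLINT x|R. (\<integral>\<theta>. indicator {1..?\<eta>} \<theta> *\<^sub>R ((1 / \<theta>) *\<^sub>R ts_integral p \<alpha> ((x \<bullet> v) / \<theta>)) \<partial>lborel))"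
  proof (rule P.Fubini_integral)
    let ?m = "\<lambda>x. (1 + \<bar>norm v\<bar>)\<^sup>2 * ts_majorant p \<alpha> (norm x)"
    have m: "integrable R ?m" by (intro integrable_mult_right ts_majorant_integrable[OF R p \<alpha>])
    have i: "integrable lborel (indicator {1..?\<eta>} :: real \<Rightarrow> real)"
      by (intro integrable_real_indicator) (auto simp: emeasure_lborel_Icc_eq)
    have "integrable (R \<Otimes>\<^sub>M lborel) (\<lambda>q. ?m (fst q) * indicator {1..?\<eta>} (snd q))"
    proof (rule P.Fubini_integrable)
      show "integrable R (\<lambda>x. \<integral>\<theta>. norm (?m (fst (x, \<theta>)) * indicator {1..?\<eta>} (snd (x, \<theta>))) \<partial>lborel)"
        using m by (simp add: abs_mult)
      show "AE x in R. integrable lborel (\<lambda>\<theta>. ?m (fst (x, \<theta>)) * indicator {1..?\<eta>} (snd (x, \<theta>)))"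
        using i by simp
    qed measurable
    then show "integrable (R \<Otimes>\<^sub>M lborel) (\<lambda>(x, \<theta>). indicator {1..?\<eta>} \<theta> *\<^sub>R ((1 / \<theta>) *\<^sub>R ts_integral p \<alpha> ((x \<bullet> v) / \<theta>)))"
      unfolding case_prod_unfold
    proof (rule Bochner_Integration.integrable_bound)
      show "AE q in R \<Otimes>\<^sub>M lborel. norm (indicator {1..?\<eta>} (snd q) *\<^sub>R ((1 / snd q) *\<^sub>R ts_integral p \<alpha> ((fst q \<bullet> v) / snd q)))
        \<le> norm (?m (fst q) * indicator {1..?\<eta>} (snd q))"
      proof (rule AE_I2)
        fix q :: "'a \<times> real"
        obtain x \<theta> where q: "q = (x, \<theta>)" by force
        \<comment> \<open>Since 1 \<le> \<theta>, replacing v by v / \<theta> does not increase its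
          norm, so one majorant serves for all \<theta>.\<close>
        have "norm ((1 / \<theta>) *\<^sub>R ts_integral p \<alpha> ((x \<bullet> v) / \<theta>)) \<le> ?m x" if "1 \<le> \<theta>"
        proof -
          have "norm ((1 / \<theta>) *\<^sub>R ts_integral p \<alpha> ((x \<bullet> v) / \<theta>)) \<le> 1 * norm (ts_integral p \<alpha> (x \<bullet> (v /\<^sub>R \<theta>)))"
            using that unfolding norm_scaleR by (intro mult_mono) (auto simp: divide_inverse mult.commute inverse_le_1_iff)
          also have "\<dots> \<le> ts_majorant p \<alpha> (x \<bullet> (v /\<^sub>R \<theta>))" using norm_ts_integral_le[OF p \<alpha>] by simp
          also have "\<dots> \<le> ?m x"
          proof (rule ts_majorant_inner_le[OF p \<alpha>])
            have "inverse \<theta> * norm v \<le> 1 * norm v" using that by (intro mult_right_mono) (auto simp: inverse_le_1_iff)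
            then show "norm (v /\<^sub>R \<theta>) \<le> norm v" using that by simp
          qed
          finally show ?thesis .
        qed
        then show "norm (indicator {1..?\<eta>} (snd q) *\<^sub>R ((1 / snd q) *\<^sub>R ts_integral p \<alpha> ((fst q \<bullet> v) / snd q)))
          \<le> norm (?m (fst q) * indicator {1..?\<eta>} (snd q))"
          by (auto simp: q indicator_def)
      qed
    qed measurable
  qed
  finally show ?thesis by (simp add: set_lebesgue_integral_def)
qed

text \<open>The decomposition in one direction is integrated over \<open>R\<close> term by term.
  Using \<open>has_bochner_integral\<close> carries integrability and value of every term together,
  including the compensators that are present only for 1 \<le> \<alpha>.\<close>

lemma (in incomplete_integrals) integral_scalar_decomposition:
  fixes R :: "'a::euclidean_space measure"
  assumes R: "rosinski_measure \<alpha> R" and \<alpha>: "\<alpha> < 2" and a: "real (Suc m) * p - \<alpha> > 0"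
  shows "(CLINT x|R. CLBINT \<theta>:{1..\<eta>}. (1 / \<theta>) *\<^sub>R ts_integral p \<alpha> ((x \<bullet> v) / \<theta>)) =
    (\<Sum>n<Suc m. H n \<eta> *\<^sub>R ((CLINT x|R. ts_integral p (\<alpha> - real n * p) (x \<bullet> ((1 / \<eta>) *\<^sub>R v))) -
       (if 1 \<le> \<alpha> \<and> \<alpha> - real n * p < 1
        then \<i> * complex_of_real (Gamma ((1 - (\<alpha> - real n * p)) / p) / p / \<eta> * ((\<integral>x. x \<partial>R) \<bullet> v)) else 0))) +
    mass m *\<^sub>R ((CLINT x|R. CLINT w|IBGM \<alpha> (real (Suc m)) p \<eta>. iexp (w * (x \<bullet> v))) - measure R UNIV -
       (if 1 \<le> \<alpha> then \<i> * complex_of_real ((\<integral>w. w \<partial>IBGM \<alpha> (real (Suc m)) p \<eta>) * ((\<integral>x. x \<partial>R) \<bullet> v)) else 0))"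
proof -
  note [measurable_cong] = rosinski_measureD(1)[OF R]
  interpret R: finite_measure R by (rule rosinski_measureD(2)[OF R])
  interpret W: prob_space "IBGM \<alpha> (real (Suc m)) p \<eta>" by (rule prob_space_IBGM[OF a])
  have spR: "space R = UNIV" using sets_eq_imp_space_eq[OF rosinski_measureD(1)[OF R]] by simp
  have T: "has_bochner_integral R (\<lambda>x. ts_integral p (\<alpha> - real n * p) (x \<bullet> ((1 / \<eta>) *\<^sub>R v)))
      (CLINT x|R. ts_integral p (\<alpha> - real n * p) (x \<bullet> ((1 / \<eta>) *\<^sub>R v)))" for n
  proof -
    have "rosinski_measure (\<alpha> - real n * p) R"
      using p by (intro rosinski_measure_mono[OF R _ \<alpha>]) simp
    moreover have "\<alpha> - real n * p < 2" by (rule le_less_trans[OF _ \<alpha>]) (use p in simp)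
    ultimately show ?thesis by (intro has_bochner_integral_integrable ts_integral_integrable p)
  qed
  have D: "has_bochner_integral R (\<lambda>x. if 1 \<le> \<alpha> \<and> Q then \<i> * complex_of_real (k * (x \<bullet> v)) else 0)
      (if 1 \<le> \<alpha> \<and> Q then \<i> * complex_of_real (k * ((\<integral>x. x \<partial>R) \<bullet> v)) else 0)" for k Q
  proof (cases "1 \<le> \<alpha> \<and> Q")
    case True
    then have "has_bochner_integral R (\<lambda>x. x) (\<integral>x. x \<partial>R)"
      using rosinski_first_moment[OF R _ \<alpha>] by (intro has_bochner_integral_integrable) simp
    then show ?thesis
      unfolding if_P[OF True]
      by (intro has_bochner_integral_mult_right has_bochner_integral_of_real has_bochner_integral_inner_left)
  next
    case False
    show ?thesis unfolding if_not_P[OF False] by (rule has_bochner_integral_zero)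
  qed
  note [measurable_cong] = sets_IBGM
  have [measurable]: "(\<lambda>x. CLINT w|IBGM \<alpha> (real (Suc m)) p \<eta>. iexp (w * (x \<bullet> v))) \<in> borel_measurable borel"
    by measurable
  have J: "has_bochner_integral R (\<lambda>x. CLINT w|IBGM \<alpha> (real (Suc m)) p \<eta>. iexp (w * (x \<bullet> v)))
      (CLINT x|R. CLINT w|IBGM \<alpha> (real (Suc m)) p \<eta>. iexp (w * (x \<bullet> v)))"
  proof (intro has_bochner_integral_integrable R.integrable_const_bound[of _ 1] AE_I2)
    fix x
    have "norm (CLINT w|IBGM \<alpha> (real (Suc m)) p \<eta>. iexp (w * (x \<bullet> v))) \<le>
        (\<integral>w. norm (iexp (w * (x \<bullet> v))) \<partial>IBGM \<alpha> (real (Suc m)) p \<eta>)"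
      by (rule integral_norm_bound)
    also have "\<dots> = 1" by (simp add: W.prob_space del: of_nat_Suc of_real_mult)
    finally show "norm (CLINT w|IBGM \<alpha> (real (Suc m)) p \<eta>. iexp (w * (x \<bullet> v))) \<le> 1" .
  qed measurable
  have one: "has_bochner_integral R (\<lambda>x. 1 :: complex) (measure R UNIV)"
    using has_bochner_integral_integrable[of R "\<lambda>x. 1 :: complex"] by (simp add: spR scaleR_conv_of_real)
  have D0: "has_bochner_integral R (\<lambda>x. if 1 \<le> \<alpha> then \<i> * complex_of_real (k * (x \<bullet> v)) else 0)
      (if 1 \<le> \<alpha> then \<i> * complex_of_real (k * ((\<integral>x. x \<partial>R) \<bullet> v)) else 0)" for k
    using D[of True k] by simp
  have s: "(CLBINT \<theta>:{1..\<eta>}. (1 / \<theta>) *\<^sub>R ts_integral p \<alpha> ((x \<bullet> v) / \<theta>)) =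
    (\<Sum>n<Suc m. H n \<eta> *\<^sub>R (ts_integral p (\<alpha> - real n * p) (x \<bullet> ((1 / \<eta>) *\<^sub>R v)) -
       (if 1 \<le> \<alpha> \<and> \<alpha> - real n * p < 1
        then \<i> * complex_of_real (Gamma ((1 - (\<alpha> - real n * p)) / p) / p / \<eta> * (x \<bullet> v)) else 0))) +
    mass m *\<^sub>R ((CLINT w|IBGM \<alpha> (real (Suc m)) p \<eta>. iexp (w * (x \<bullet> v))) - 1 -
       (if 1 \<le> \<alpha> then \<i> * complex_of_real ((\<integral>w. w \<partial>IBGM \<alpha> (real (Suc m)) p \<eta>) * (x \<bullet> v)) else 0))" for x
  proof -
    have 1: "x \<bullet> v / \<eta> = x \<bullet> ((1 / \<eta>) *\<^sub>R v)" by simp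
    have 2: "x \<bullet> ((1 / \<eta>) *\<^sub>R v) * (g / p) = g / p / \<eta> * (x \<bullet> v)" for g by (simp add: divide_inverse mult_ac)
    show ?thesis unfolding scalar_decomposition[OF \<alpha> a, of "x \<bullet> v"] 1 2 ..
  qed
  show ?thesis
    unfolding s
    by (intro has_bochner_integral_integral_eq has_bochner_integral_add has_bochner_integral_sum
        has_bochner_integral_scaleR_right has_bochner_integral_diff T D J one D0)
qed

theorem theorem4p2:
  fixes p \<alpha> l t rate :: real
    and b :: "'a::euclidean_space"
    and R :: "'a measure"
    and M :: "'w measure"
    and Y :: "real \<Rightarrow> 'w \<Rightarrow> 'a"
    and \<gamma> :: nat
  assumes "p > 0" and "\<alpha> < 2" and "l > 0" and "t > 0"
    and "rosinski_measure \<alpha> R" and "R \<noteq> null_measure borel"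
    and "OUTS_process M l p \<alpha> (scale_measure (ennreal l) R) (l *\<^sub>R b) Y"
    and "\<gamma> = (if 0 < \<alpha> then 1 + nat \<lfloor>\<alpha> / p\<rfloor> else 1)"
    and "rate = p * IBGM_const \<alpha> (real \<gamma>) p (exp (l * t)) * measure R UNIV / fact (\<gamma> - 1)"
  shows
    "\<exists>(\<Omega> :: (nat \<times> (nat \<Rightarrow> 'a) \<times> (nat \<Rightarrow> 'a) \<times> (nat \<Rightarrow> real)) measure) N X V W (bs :: nat \<Rightarrow> 'a).
       prob_space \<Omega> \<and>
       indep_family \<Omega> \<gamma> N X V W \<and>
       (\<forall>n<\<gamma>. TS_distr p (\<alpha> - real n * p) (scale_measure (ennreal (kappa p \<alpha> l t n)) R) 0
                 (distr \<Omega> borel (X n))) \<and>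
       (\<forall>n\<ge>1. distr \<Omega> borel (V n) = scale_measure (ennreal (1 / measure R UNIV)) R) \<and>
       (\<forall>n\<ge>1. distr \<Omega> borel (W n) = IBGM \<alpha> (real \<gamma>) p (exp (l * t))) \<and>
       distr \<Omega> (count_space UNIV) N = measure_pmf (poisson_pmf rate) \<and>
       bs 0 = (if 1 \<le> \<alpha> \<and> \<alpha> < 2 then (rate * (\<integral>\<omega>. W 1 \<omega> \<partial>\<Omega>)) *\<^sub>R (\<integral>\<omega>. V 1 \<omega> \<partial>\<Omega>) else 0) \<and>
       (\<forall>n\<in>{1..<\<gamma>}. bs n =
          (if 1 \<le> \<alpha> \<and> \<alpha> < 1 + real n * p
           then (exp (- l * t) * (1 / p) * Gamma ((1 - \<alpha> + real n * p) / p)) *\<^sub>R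
                (\<integral>x. x \<partial>scale_measure (ennreal (kappa p \<alpha> l t n)) R)
           else 0)) \<and>
       (\<forall>s\<ge>0. cond_distr M (Y (s + t)) (Y s)
          (\<lambda>y. distr \<Omega> borel
             (\<lambda>\<omega>. exp (- l * t) *\<^sub>R y + (1 - exp (- l * t)) *\<^sub>R b - (\<Sum>n<\<gamma>. bs n)
                  + exp (- l * t) *\<^sub>R (\<Sum>n<\<gamma>. X n \<omega>)
                  + (\<Sum>n=1..N \<omega>. W n \<omega> *\<^sub>R V n \<omega>))))"
proof -
  note p = assms(1) and \<alpha> = assms(2) and l = assms(3) and t = assms(4) and R = assms(5)
  note sR [measurable_cong] = rosinski_measureD(1)[OF R]
  interpret R: finite_measure R by (rule rosinski_measureD(2)[OF R])
  have spR: "space R = UNIV" using sets_eq_imp_space_eq[OF sR] by simp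
  obtain L where OU: "OU_process M l L Y"
    and L1: "TS_distr p \<alpha> (scale_measure (ennreal l) R) (l *\<^sub>R b) (distr M borel (L 1))"
    using assms(7) by (auto simp: OUTS_process_def)
  have Rl: "rosinski_measure \<alpha> (scale_measure (ennreal l) R)"
    using l by (intro rosinski_measure_scale[OF R \<alpha>]) simp
  interpret L: levy_exponent M L "TS_exponent p \<alpha> (scale_measure (ennreal l) R) (l *\<^sub>R b)"
    using OU L1 by unfold_locales
      (auto simp: OU_process_def TS_distr_def TS_exponent_0 intro: continuous_TS_exponent[OF Rl p \<alpha>])
  define \<eta> where "\<eta> = exp (l * t)"
  have \<eta>: "\<eta> > 1" using l t by (simp add: \<eta>_def)
  have e\<eta>: "exp (- l * t) = 1 / \<eta>" by (simp add: \<eta>_def exp_minus divide_inverse)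
  interpret incomplete_integrals p \<alpha> \<eta> by unfold_locales (rule p, rule \<eta>)
  define m where "m = \<gamma> - 1"
  have \<gamma>: "\<gamma> = Suc m" using assms(8) by (auto simp: m_def)
  \<comment> \<open>The purpose of the choice of \<gamma>: one more than the floor of \<alpha> / p
    exceeds \<alpha> / p.\<close>
  have a: "real (Suc m) * p - \<alpha> > 0"
  proof (cases "0 < \<alpha>")
    case True
    then have "0 \<le> \<alpha> / p" using p by simp
    then have "\<alpha> / p < real (Suc m)"
      using True assms(8) \<gamma> by (simp add: of_nat_nat) linarith
    then show ?thesis using p by (simp add: pos_divide_less_eq)
  next
    case False
    have "0 < real (Suc m) * p" using p by simp
    then show ?thesis using False by linarith
  qed
  define U where "U = measure R UNIV"
  \<comment> \<open>A nonzero R has positive mass, which is needed to normalise R to the law of V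
    and to have a positive Poisson rate.\<close>
  have U: "U > 0"
  proof (rule ccontr)
    assume "\<not> U > 0"
    then have "emeasure R UNIV = 0"
      using measure_nonneg[of R UNIV] by (simp add: U_def R.emeasure_eq_measure)
    then have "emeasure R A = 0" for A using emeasure_mono[of A UNIV R] sR by simp
    then have "R = null_measure borel" by (intro measure_eqI) (auto simp: sR)
    with assms(6) show False ..
  qed
  have rate: "rate = mass m * U"
    unfolding assms(9) mass_def U_def \<gamma> \<eta>_def[symmetric] by simp
  have rate_pos: "rate > 0" using mass_pos[of m] a U by (simp add: rate)
  have \<kappa>: "kappa p \<alpha> l t n = H n \<eta>" for n by (rule kappa_eq_H[OF \<eta>_def])
  have H0: "0 \<le> H n \<eta>" for n using \<eta> by (intro H_nonneg) simp
  have \<alpha>n: "\<alpha> - real n * p < 2" for n by (rule le_less_trans[OF _ \<alpha>]) (use p in simp)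
  have Rn: "rosinski_measure (\<alpha> - real n * p) (scale_measure (ennreal (H n \<eta>)) R)" for n
    using p by (intro rosinski_measure_scale[OF rosinski_measure_mono[OF R _ \<alpha>] \<alpha>n H0]) simp
  have "\<exists>\<mu>. TS_distr p (\<alpha> - real n * p) (scale_measure (ennreal (H n \<eta>)) R) 0 \<mu>" for n
    using TS_distr_exists[OF Rn p \<alpha>n] by blast
  \<comment> \<open>Laws are chosen for all n, since the product space is indexed by all natural
    numbers.\<close>
  then obtain \<mu>X where \<mu>X: "\<And>n. TS_distr p (\<alpha> - real n * p) (scale_measure (ennreal (H n \<eta>)) R) 0 (\<mu>X n)"
    by metis
  define \<mu>V where "\<mu>V = scale_measure (ennreal (1 / U)) R"
  define \<mu>W where "\<mu>W = IBGM \<alpha> (real \<gamma>) p \<eta>"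
  interpret T: transition_space rate \<mu>X \<mu>V \<mu>W
  proof (rule transition_space.intro)
    show "prob_space \<mu>V"
    proof (rule prob_spaceI)
      have "emeasure \<mu>V (space \<mu>V) = ennreal (1 / U) * ennreal U"
        by (simp add: \<mu>V_def space_scale_measure spR R.emeasure_eq_measure U_def)
      then show "emeasure \<mu>V (space \<mu>V) = 1" using U by (simp add: ennreal_mult[symmetric])
    qed
    show "prob_space \<mu>W" unfolding \<mu>W_def \<gamma> by (rule prob_space_IBGM[OF a])
    show "prob_space (\<mu>X n)" "sets (\<mu>X n) = sets borel" for n
      using \<mu>X[of n] unfolding TS_distr_def by blast+
    show "sets \<mu>V = sets borel" "sets \<mu>W = sets borel"
      by (simp_all add: \<mu>V_def \<mu>W_def sR)
    show "rate > 0" by (rule rate_pos)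
  qed
  interpret \<Omega>: prob_space T.\<Omega> by (rule T.prob_space_pairs)
  define EW where "EW = (\<integral>w. w \<partial>\<mu>W)"
  define ER where "ER = (\<integral>x. x \<partial>R)"
  have EW: "(\<integral>\<omega>. T.rW 1 \<omega> \<partial>T.\<Omega>) = EW"
  proof -
    have "(\<integral>w. w \<partial>distr T.\<Omega> borel (T.rW 1)) = (\<integral>\<omega>. T.rW 1 \<omega> \<partial>T.\<Omega>)" by (rule integral_distr) simp_all
    then show ?thesis unfolding T.distr_rW EW_def ..
  qed
  have EV: "(\<integral>\<omega>. T.rV 1 \<omega> \<partial>T.\<Omega>) = (1 / U) *\<^sub>R ER"
  proof -
    have "(\<integral>x. x \<partial>distr T.\<Omega> borel (T.rV 1)) = (\<integral>\<omega>. T.rV 1 \<omega> \<partial>T.\<Omega>)" by (rule integral_distr) simp_all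
    moreover have "(\<integral>x. x \<partial>\<mu>V) = (1 / U) *\<^sub>R ER"
      unfolding \<mu>V_def ER_def by (rule integral_scale_measure) (use U in simp)
    ultimately show ?thesis unfolding T.distr_rV by (rule trans[OF sym])
  qed
  define bs where "bs n =
    (if n = 0 then if 1 \<le> \<alpha> \<and> \<alpha> < 2 then (rate * (\<integral>\<omega>. T.rW 1 \<omega> \<partial>T.\<Omega>)) *\<^sub>R (\<integral>\<omega>. T.rV 1 \<omega> \<partial>T.\<Omega>) else 0
     else if 1 \<le> \<alpha> \<and> \<alpha> < 1 + real n * p
     then (exp (- l * t) * (1 / p) * Gamma ((1 - \<alpha> + real n * p) / p)) *\<^sub>R
          (\<integral>x. x \<partial>scale_measure (ennreal (kappa p \<alpha> l t n)) R)
     else 0)" for n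
  \<comment> \<open>All constants not depending on y are collected, so the law \<open>\<rho>\<close>
    of the rest is the innovation and e^(- l t) y is a pure translation.\<close>
  define D where "D = (1 - exp (- l * t)) *\<^sub>R b - (\<Sum>n<\<gamma>. bs n)"
  let ?S = "\<lambda>\<omega>. exp (- l * t) *\<^sub>R (\<Sum>n<\<gamma>. T.rX n \<omega>) + (\<Sum>k=1..T.rN \<omega>. T.rW k \<omega> *\<^sub>R T.rV k \<omega>)"
  have S [measurable]: "?S \<in> borel_measurable T.\<Omega>" by (rule T.rsum_measurable) simp
  define \<rho> where "\<rho> = distr T.\<Omega> borel (\<lambda>\<omega>. D + ?S \<omega>)"
  have char: "charfun \<rho> v = exp (integral {0..t} (\<lambda>r. TS_exponent p \<alpha> (scale_measure (ennreal l) R) (l *\<^sub>R b)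
      (exp (- l * (t - r)) *\<^sub>R v)))" for v
  proof -
    let ?I = "\<lambda>n. CLINT x|R. ts_integral p (\<alpha> - real n * p) (x \<bullet> ((1 / \<eta>) *\<^sub>R v))"
    let ?D = "\<lambda>n. if 1 \<le> \<alpha> \<and> \<alpha> - real n * p < 1
        then \<i> * complex_of_real (Gamma ((1 - (\<alpha> - real n * p)) / p) / p / \<eta> * (ER \<bullet> v)) else 0"
    let ?C = "if 1 \<le> \<alpha> then \<i> * complex_of_real (EW * (ER \<bullet> v)) else 0"
    define J where "J = (CLINT x|R. CLINT w|\<mu>W. iexp (w * (x \<bullet> v)))"
    \<comment> \<open>The constants are designed for this: b*_0 is the mean of the compound Poisson
      sum, removed when order \<alpha> has a compensator, and b*_n for n \<ge> 1 accounts for the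
      compensator that order \<alpha> has and order \<alpha> - n p has not.\<close>
    have shift: "\<i> * complex_of_real ((\<Sum>n<\<gamma>. bs n) \<bullet> v) = (\<Sum>n<\<gamma>. H n \<eta> *\<^sub>R ?D n) + mass m *\<^sub>R ?C"
    proof -
      have 0: "\<i> * complex_of_real (bs 0 \<bullet> v) = mass m *\<^sub>R ?C"
      proof -
        have "rate * EW * (1 / U) = mass m * EW" using U by (simp add: rate)
        then have "bs 0 = (if 1 \<le> \<alpha> then (mass m * EW) *\<^sub>R ER else 0)"
          unfolding bs_def EW EV scaleR_scaleR using \<alpha> by simp
        then show ?thesis by (simp add: scaleR_conv_of_real)
      qed
      have "\<i> * complex_of_real (bs (Suc n) \<bullet> v) = H (Suc n) \<eta> *\<^sub>R ?D (Suc n)" for n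
      proof -
        have c: "(1 \<le> \<alpha> \<and> \<alpha> < 1 + real (Suc n) * p) = (1 \<le> \<alpha> \<and> \<alpha> - real (Suc n) * p < 1)" by linarith
        have g: "1 - \<alpha> + real (Suc n) * p = 1 - (\<alpha> - real (Suc n) * p)" by simp
        show ?thesis
          unfolding bs_def c g \<kappa> e\<eta>
          by (simp add: integral_scale_measure[OF H0] ER_def[symmetric] scaleR_conv_of_real divide_inverse mult_ac del: of_nat_Suc)
      qed
      \<comment> \<open>The law of X_0 has the same order \<alpha>, so no compensator is lost there,
        and the index 0 is free for the compound Poisson mean.\<close>
      moreover have "?D 0 = 0" by simp
      ultimately show ?thesis
        unfolding \<gamma> sum.lessThan_Suc_shift inner_add_left of_real_add distrib_left inner_sum_left of_real_sum sum_distrib_left 0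
        by (simp only: scaleR_zero_right add_0 add.commute)
    qed
    have X: "charfun (\<mu>X n) (exp (- l * t) *\<^sub>R v) = exp (H n \<eta> *\<^sub>R ?I n)" for n
      using \<mu>X[of n] unfolding e\<eta> by (simp add: TS_distr_def TS_exponent_eq integral_scale_measure[OF H0])
    have VW: "complex_of_real rate * ((CLINT x|\<mu>V. CLINT w|\<mu>W. iexp (w * (x \<bullet> v))) - 1) = mass m *\<^sub>R (J - U)"
    proof -
      have "(CLINT x|\<mu>V. CLINT w|\<mu>W. iexp (w * (x \<bullet> v))) = (1 / U) *\<^sub>R J"
        unfolding \<mu>V_def J_def by (rule integral_scale_measure) (use U in simp)
      then show ?thesis using U by (simp add: rate scaleR_conv_of_real field_simps)
    qed
    have "charfun \<rho> v = iexp (D \<bullet> v) * charfun (distr T.\<Omega> borel ?S) v"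
      unfolding \<rho>_def by (simp add: charfun_distr inner_add_left distrib_left exp_add)
    also have "charfun (distr T.\<Omega> borel ?S) v =
        exp (\<Sum>n<\<gamma>. H n \<eta> *\<^sub>R ?I n) * exp (mass m *\<^sub>R (J - U))"
      by (subst T.charfun_sum) (simp_all only: finite_lessThan X VW exp_sum)
    also have "iexp (D \<bullet> v) * \<dots> = exp (\<i> * complex_of_real ((1 - exp (- l * t)) * (b \<bullet> v)) -
        \<i> * complex_of_real ((\<Sum>n<\<gamma>. bs n) \<bullet> v) + ((\<Sum>n<\<gamma>. H n \<eta> *\<^sub>R ?I n) + mass m *\<^sub>R (J - U)))"
      unfolding exp_add[symmetric] D_def by (simp only: inner_diff_left inner_scaleR_left of_real_diff right_diff_distrib)
    also have "\<dots> = exp (\<i> * complex_of_real ((1 - exp (- l * t)) * (b \<bullet> v)) +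
        ((\<Sum>n<\<gamma>. H n \<eta> *\<^sub>R (?I n - ?D n)) + mass m *\<^sub>R (J - U - ?C)))"
      unfolding shift scaleR_diff_right sum_subtractf by (simp only: algebra_simps)
    also have "(\<Sum>n<\<gamma>. H n \<eta> *\<^sub>R (?I n - ?D n)) + mass m *\<^sub>R (J - U - ?C) =
        (CLINT x|R. CLBINT \<theta>:{1..\<eta>}. (1 / \<theta>) *\<^sub>R ts_integral p \<alpha> ((x \<bullet> v) / \<theta>))"
      unfolding integral_scalar_decomposition[OF R \<alpha> a] J_def EW_def ER_def \<mu>W_def \<gamma> U_def ..
    also have "\<i> * complex_of_real ((1 - exp (- l * t)) * (b \<bullet> v)) + \<dots> =
        integral {0..t} (\<lambda>r. TS_exponent p \<alpha> (scale_measure (ennreal l) R) (l *\<^sub>R b) (exp (- l * (t - r)) *\<^sub>R v))"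
      unfolding \<eta>_def by (rule transition_exponent[OF R p \<alpha> l t, symmetric])
    finally show ?thesis .
  qed
  have cond: "cond_distr M (Y (s + t)) (Y s)
          (\<lambda>y. distr T.\<Omega> borel
             (\<lambda>\<omega>. exp (- l * t) *\<^sub>R y + (1 - exp (- l * t)) *\<^sub>R b - (\<Sum>n<\<gamma>. bs n)
                  + exp (- l * t) *\<^sub>R (\<Sum>n<\<gamma>. T.rX n \<omega>)
                  + (\<Sum>n=1..T.rN \<omega>. T.rW n \<omega> *\<^sub>R T.rV n \<omega>)))" if s: "s \<ge> 0" for s
  proof -
    have "cond_distr M (Y (s + t)) (Y s) (\<lambda>y. distr \<rho> borel (\<lambda>z. exp (- l * t) *\<^sub>R y + z))"
    proof (rule cond_distr_affine)
      show "prob_space M" by (rule L.prob_space_axioms)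
      show "Y s \<in> borel_measurable M" "Y (s + t) \<in> borel_measurable M"
        using OU s t by (auto simp: OU_process_def)
      show "prob_space \<rho>" unfolding \<rho>_def by (rule \<Omega>.prob_space_distr) measurable
      show "sets \<rho> = sets borel" by (simp add: \<rho>_def)
    qed (simp only: L.OU_transition_charfun[OF OU s t] char)
    moreover have "(\<lambda>\<omega>. exp (- l * t) *\<^sub>R y + (D + ?S \<omega>)) =
        (\<lambda>\<omega>. exp (- l * t) *\<^sub>R y + (1 - exp (- l * t)) *\<^sub>R b - (\<Sum>n<\<gamma>. bs n)
                  + exp (- l * t) *\<^sub>R (\<Sum>n<\<gamma>. T.rX n \<omega>)
                  + (\<Sum>n=1..T.rN \<omega>. T.rW n \<omega> *\<^sub>R T.rV n \<omega>))" for y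
      by (rule ext) (simp only: D_def add.assoc add_diff_eq diff_add_eq)
    moreover have "distr \<rho> borel (\<lambda>z. exp (- l * t) *\<^sub>R y + z) =
        distr T.\<Omega> borel (\<lambda>\<omega>. exp (- l * t) *\<^sub>R y + (D + ?S \<omega>))" for y
      unfolding \<rho>_def
    proof (subst distr_distr)
      show "distr T.\<Omega> borel ((\<lambda>z. exp (- l * t) *\<^sub>R y + z) \<circ> (\<lambda>\<omega>. D + ?S \<omega>)) =
          distr T.\<Omega> borel (\<lambda>\<omega>. exp (- l * t) *\<^sub>R y + (D + ?S \<omega>))"
        by (simp only: comp_def)
    qed measurable
    ultimately show ?thesis by (simp only:)
  qed
  show ?thesis
  proof (intro exI conjI ballI allI impI)
    show "prob_space T.\<Omega>" by (rule \<Omega>.prob_space_axioms)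
    show "indep_family T.\<Omega> \<gamma> T.rN T.rX T.rV T.rW" by (rule T.indep_family_rv)
    show "TS_distr p (\<alpha> - real n * p) (scale_measure (ennreal (kappa p \<alpha> l t n)) R) 0 (distr T.\<Omega> borel (T.rX n))" for n
      unfolding T.distr_rX \<kappa> by (rule \<mu>X)
    show "distr T.\<Omega> borel (T.rV n) = scale_measure (ennreal (1 / measure R UNIV)) R" for n
      unfolding T.distr_rV unfolding \<mu>V_def U_def ..
    show "distr T.\<Omega> borel (T.rW n) = IBGM \<alpha> (real \<gamma>) p (exp (l * t))" for n
      unfolding T.distr_rW unfolding \<mu>W_def \<eta>_def ..
    show "distr T.\<Omega> (count_space UNIV) T.rN = measure_pmf (poisson_pmf rate)" by (rule T.distr_rN)
    show "bs 0 = (if 1 \<le> \<alpha> \<and> \<alpha> < 2 then (rate * (\<integral>\<omega>. T.rW 1 \<omega> \<partial>T.\<Omega>)) *\<^sub>R (\<integral>\<omega>. T.rV 1 \<omega> \<partial>T.\<Omega>) else 0)"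
      by (simp only: bs_def simp_thms if_True)
    show "bs n = (if 1 \<le> \<alpha> \<and> \<alpha> < 1 + real n * p
           then (exp (- l * t) * (1 / p) * Gamma ((1 - \<alpha> + real n * p) / p)) *\<^sub>R
                (\<integral>x. x \<partial>scale_measure (ennreal (kappa p \<alpha> l t n)) R)
           else 0)" if "n \<in> {1..<\<gamma>}" for n
      using that by (simp only: bs_def) auto
  qed (rule cond)
qed

end
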